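(* Let $R$ be essentially of finite type over an $F$-finite field of characteristic $p>0$. Let $(M,\kappa)$ be a Cartier module over $R$, $f\in R$ an $M$-regular element and $\lambda$ a positive rational number. (a) If $p$ does not divide the denominator of $\lambda$, then $\sigma(M,f^\lambda)\supseteq\tau(M,f^{\lambda-\varepsilon})$ for any $0<\varepsilon\ll1$. (b) If $M_f$ is $F$-regular, then $\sigma(M,f^\lambda)\subseteq\tau(M,f^{\lambda-\varepsilon})$ for any $0<\varepsilon\ll1$.
   Context: All rings are commutative Noetherian of prime characteristic $p$; $F$ is the Frobenius, and $F^e_*M$ is $M$ with $R$ acting through $p^e$-th powers. $R$ is $F$-finite if $F_*R$ is a finitely generated $R$-module. A Cartier module $(M,\kappa)$ is a finitely generated $R$-module $M$ with an $R$-linear map $\kappa\colon F_*M\to M$; $\kappa^e\colon F^e_*M\to M$ is its iterate, and for $g\in R$, $\kappa^e g$ denotes $m\mapsto\kappa^e(gm)$. $f\in R$ is $M$-regular if it is a non-zero-divisor on $M$. A Cartier algebra is an $\mathbb N$-graded ring $\mathcal C=\bigoplus_{e\ge0}\mathcal C_e$ with $\mathcal C_0=R$ and $r\varphi=\varphi r^{p^e}$ for $\varphi\in\mathcal C_e$, $r\in R$; $\mathcal C_+=\bigoplus_{e\ge1}\mathcal C_e$. A $\mathcal C$-module is a left $\mathcal C$-module finitely generated over $R$; it is nilpotent if $\mathcal C_+^aM=0$ for some $a$; a morphism is a nil-isomorphism if its kernel and cokernel are nilpotent. Test modules: for $f\in R$ and rational $\lambda\ge0$ let $\mathcal C$ be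 the Cartier algebra with $\mathcal C_0=R$, $\mathcal C_e=\kappa^ef^{\lceil\lambda p^e\rceil}R$ ($e\ge1$), acting on $M$. $\tau(M,f^\lambda)$ is the smallest $\mathcal C$-submodule $N\subseteq M$ such that $H^0_\eta(N)_\eta\subseteq H^0_\eta(M)_\eta$ is a nil-isomorphism for every associated prime $\eta$ of the $R$-module $M$ ($H^0_\eta$ = elements killed by a power of $\eta$; the outer subscript is localization). If $R$ is essentially of finite type over an $F$-finite field, $\tau(M,f^\lambda)$ exists for all $\lambda$ and is a non-increasing, right-continuous, discrete filtration. $(M,\kappa)$ is $F$-regular if $\tau(M,f^0)=M$; $M_f$ is a Cartier module over $R_f$ via $\kappa(m/f^{n})=\kappa(f^{n(p-1)}m)/f^{n}$. Non-$F$-pure modules: for rational $\lambda\ge0$ let $\mathcal C=\bigoplus_{e\ge0}\kappa^ef^{\lceil\lambda(p^e-1)\rceil}R$ (note the exponent $p^e-1$). Then $\sigma(M,f^\lambda)$ is the stable value $\mathcal C_+^hM$, $h\gg0$, of the descending chain $\mathcal C_+M\supseteq\mathcal C_+^2M\supseteq\cdots$ (which stabilizes for any $F$-finite $R$). Denominators are taken in lowest terms. *)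

theory Defs
  imports "HOL-Algebra.Module" "HOL-Algebra.Ideal_Product" "HOL-Algebra.Generated_Rings" "HOL-Algebra.Ring_Divisibility"
    "HOL-Computational_Algebra.Primes"
begin

section \<open>Modules\<close>

definition regular_module :: "('a, 'x) ring_scheme \<Rightarrow> ('a, 'a) module" where
  "regular_module R =
     \<lparr>carrier = carrier R, monoid.mult = monoid.mult R, one = one R, ring.zero = ring.zero R, ring.add = ring.add R, smult = monoid.mult R\<rparr>"

definition mod_span :: "('a, 'x) ring_scheme \<Rightarrow> ('a, 'm, 'z) module_scheme \<Rightarrow> 'm set \<Rightarrow> 'm set" where
  "mod_span R M X = \<Inter>{N. submodule N R M \<and> X \<subseteq> N}"

definition fin_gen_module :: "('a, 'x) ring_scheme \<Rightarrow> ('a, 'm, 'z) module_scheme \<Rightarrow> bool" where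
  "fin_gen_module R M \<longleftrightarrow>
     (\<exists>X. finite X \<and> X \<subseteq> carrier M \<and> mod_span R M X = carrier M)"

definition lin_maps ::
    "('a, 'x) ring_scheme \<Rightarrow> ('a, 'm, 'z) module_scheme \<Rightarrow> ('a, 'n, 'w) module_scheme \<Rightarrow> ('m \<Rightarrow> 'n) set" where
  "lin_maps R M N = {\<phi> \<in> carrier M \<rightarrow> carrier N.
     (\<forall>x\<in>carrier M. \<forall>y\<in>carrier M. \<phi> (x \<oplus>\<^bsub>M\<^esub> y) = \<phi> x \<oplus>\<^bsub>N\<^esub> \<phi> y) \<and>
     (\<forall>r\<in>carrier R. \<forall>x\<in>carrier M. \<phi> (r \<odot>\<^bsub>M\<^esub> x) = r \<odot>\<^bsub>N\<^esub> \<phi> x)}"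

text \<open>The multiplicative structure that the record type carries along is irrelevant for modules.\<close>

definition quot_module :: "('a, 'm, 'z) module_scheme \<Rightarrow> 'm set \<Rightarrow> ('a, 'm set) module" where
  "quot_module M N =
     \<lparr>carrier = a_rcosets\<^bsub>M\<^esub> N, monoid.mult = undefined, one = undefined, ring.zero = N, ring.add = set_add M,
      smult = (\<lambda>r X. set_add M N ((\<lambda>x. r \<odot>\<^bsub>M\<^esub> x) ` X))\<rparr>"

definition annihilator :: "('a, 'x) ring_scheme \<Rightarrow> ('a, 'm, 'z) module_scheme \<Rightarrow> 'm \<Rightarrow> 'a set" where
  "annihilator R M m = {r \<in> carrier R. r \<odot>\<^bsub>M\<^esub> m = \<zero>\<^bsub>M\<^esub>}"

definition assoc_primes :: "('a, 'x) ring_scheme \<Rightarrow> ('a, 'm, 'z) module_scheme \<Rightarrow> 'a set set" where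
  "assoc_primes R M = {\<eta>. primeideal \<eta> R \<and> (\<exists>m\<in>carrier M. \<eta> = annihilator R M m)}"

definition module_regular :: "('a, 'x) ring_scheme \<Rightarrow> ('a, 'm, 'z) module_scheme \<Rightarrow> 'a \<Rightarrow> bool" where
  "module_regular R M f \<longleftrightarrow>
     f \<in> carrier R \<and> (\<forall>m\<in>carrier M. f \<odot>\<^bsub>M\<^esub> m = \<zero>\<^bsub>M\<^esub> \<longrightarrow> m = \<zero>\<^bsub>M\<^esub>)"

definition ideal_power :: "('a, 'x) ring_scheme \<Rightarrow> 'a set \<Rightarrow> nat \<Rightarrow> 'a set" where
  "ideal_power R I n = ((\<lambda>J. ideal_prod R I J) ^^ n) (carrier R)"

text \<open>\<open>H\<^sup>0\<^sub>\<eta>(N)\<close> for a submodule \<open>N\<close> of \<open>M\<close>.\<close>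

definition local_cohomology0 ::
    "('a, 'x) ring_scheme \<Rightarrow> ('a, 'm, 'z) module_scheme \<Rightarrow> 'a set \<Rightarrow> 'm set \<Rightarrow> 'm set" where
  "local_cohomology0 R M \<eta> N = {m \<in> N. \<exists>n. \<forall>r\<in>ideal_power R \<eta> n. r \<odot>\<^bsub>M\<^esub> m = \<zero>\<^bsub>M\<^esub>}"


section \<open>Localization\<close>

text \<open>
  \<open>frac R S M m s\<close> is the fraction \<open>m/s\<close>, a class of pairs. Operations on fractions are unions over
  all representatives; as the operations are well defined, all the classes united are equal.
\<close>

definition frac ::
    "('a, 'x) ring_scheme \<Rightarrow> 'a set \<Rightarrow> ('a, 'm, 'z) module_scheme \<Rightarrow> 'm \<Rightarrow> 'a \<Rightarrow> ('m \<times> 'a) set" where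
  "frac R S M m s = {(m', s'). m' \<in> carrier M \<and> s' \<in> S \<and>
     (\<exists>u\<in>S. u \<odot>\<^bsub>M\<^esub> (s' \<odot>\<^bsub>M\<^esub> m) = u \<odot>\<^bsub>M\<^esub> (s \<odot>\<^bsub>M\<^esub> m'))}"

definition loc_set ::
    "('a, 'x) ring_scheme \<Rightarrow> 'a set \<Rightarrow> ('a, 'm, 'z) module_scheme \<Rightarrow> 'm set \<Rightarrow> ('m \<times> 'a) set set" where
  "loc_set R S M N = {frac R S M m s | m s. m \<in> N \<and> s \<in> S}"

definition loc_ring :: "('a, 'x) ring_scheme \<Rightarrow> 'a set \<Rightarrow> ('a \<times> 'a) set ring" where
  "loc_ring R S = (let Q = frac R S (regular_module R) in
     \<lparr>carrier = loc_set R S (regular_module R) (carrier R),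
      monoid.mult = (\<lambda>X Y. \<Union>(a, s)\<in>X. \<Union>(b, t)\<in>Y. Q (a \<otimes>\<^bsub>R\<^esub> b) (s \<otimes>\<^bsub>R\<^esub> t)),
      one = Q \<one>\<^bsub>R\<^esub> \<one>\<^bsub>R\<^esub>,
      ring.zero = Q \<zero>\<^bsub>R\<^esub> \<one>\<^bsub>R\<^esub>,
      ring.add = (\<lambda>X Y. \<Union>(a, s)\<in>X. \<Union>(b, t)\<in>Y. Q (t \<otimes>\<^bsub>R\<^esub> a \<oplus>\<^bsub>R\<^esub> s \<otimes>\<^bsub>R\<^esub> b) (s \<otimes>\<^bsub>R\<^esub> t))\<rparr>)"

definition loc_module ::
    "('a, 'x) ring_scheme \<Rightarrow> 'a set \<Rightarrow> ('a, 'm, 'z) module_scheme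
      \<Rightarrow> (('a \<times> 'a) set, ('m \<times> 'a) set) module" where
  "loc_module R S M = (let Q = frac R S M in
     \<lparr>carrier = loc_set R S M (carrier M),
      monoid.mult = undefined,
      one = undefined,
      ring.zero = Q \<zero>\<^bsub>M\<^esub> \<one>\<^bsub>R\<^esub>,
      ring.add = (\<lambda>X Y. \<Union>(m, s)\<in>X. \<Union>(n, t)\<in>Y. Q (t \<odot>\<^bsub>M\<^esub> m \<oplus>\<^bsub>M\<^esub> s \<odot>\<^bsub>M\<^esub> n) (s \<otimes>\<^bsub>R\<^esub> t)),
      smult = (\<lambda>A X. \<Union>(a, s)\<in>A. \<Union>(m, t)\<in>X. Q (a \<odot>\<^bsub>M\<^esub> m) (s \<otimes>\<^bsub>R\<^esub> t))\<rparr>)"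

definition loc_elem :: "('a, 'x) ring_scheme \<Rightarrow> 'a set \<Rightarrow> 'a \<Rightarrow> ('a \<times> 'a) set" where
  "loc_elem R S a = frac R S (regular_module R) a \<one>\<^bsub>R\<^esub>"

text \<open>\<open>\<kappa>(m/s) = \<kappa>(s\<^sup>p\<^sup>-\<^sup>1m)/s\<close>\<close>

definition loc_cartier ::
    "('a, 'x) ring_scheme \<Rightarrow> 'a set \<Rightarrow> nat \<Rightarrow> ('a, 'm, 'z) module_scheme \<Rightarrow> ('m \<Rightarrow> 'm)
      \<Rightarrow> ('m \<times> 'a) set \<Rightarrow> ('m \<times> 'a) set" where
  "loc_cartier R S p M \<kappa> X =
     (\<Union>(m, s)\<in>X. frac R S M (\<kappa> ((s [^]\<^bsub>R\<^esub> (p - 1)) \<odot>\<^bsub>M\<^esub> m)) s)"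

definition powers :: "('a, 'x) ring_scheme \<Rightarrow> 'a \<Rightarrow> 'a set" where
  "powers R f = range (\<lambda>n::nat. f [^]\<^bsub>R\<^esub> n)"


section \<open>Rings of prime characteristic\<close>

text \<open>This admits the zero ring, which occurs among the localizations.\<close>

definition prime_char :: "nat \<Rightarrow> ('a, 'x) ring_scheme \<Rightarrow> bool" where
  "prime_char p R \<longleftrightarrow> prime p \<and> [p] \<cdot>\<^bsub>R\<^esub> \<one>\<^bsub>R\<^esub> = \<zero>\<^bsub>R\<^esub>"

definition frob_push ::
    "('a, 'x) ring_scheme \<Rightarrow> nat \<Rightarrow> nat \<Rightarrow> ('a, 'm, 'z) module_scheme \<Rightarrow> ('a, 'm, 'z) module_scheme" where
  "frob_push R p e M = M\<lparr>smult := (\<lambda>r m. (r [^]\<^bsub>R\<^esub> (p ^ e)) \<odot>\<^bsub>M\<^esub> m)\<rparr>"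

definition F_finite :: "nat \<Rightarrow> ('a, 'x) ring_scheme \<Rightarrow> bool" where
  "F_finite p R \<longleftrightarrow> fin_gen_module R (frob_push R p 1 (regular_module R))"

text \<open>
  \<open>R\<close> is isomorphic to a localization of a finitely generated \<open>k\<close>-algebra \<open>A\<close> (and thereby a
  \<open>k\<close>-algebra). Taking \<open>A\<close> on the element type of \<open>R\<close> is no restriction: for a localization
  \<open>A \<rightarrow> R\<close> at \<open>S\<close>, the ring \<open>R\<close> is also the localization of the image of \<open>A\<close> at the image of \<open>S\<close>.
\<close>

definition ess_finite_type :: "('k, 'y) ring_scheme \<Rightarrow> ('a, 'x) ring_scheme \<Rightarrow> bool" where
  "ess_finite_type k R \<longleftrightarrow>
     (\<exists>(A :: 'a ring) \<psi> X S.
        cring A \<and> \<psi> \<in> ring_hom k A \<and>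
        finite X \<and> X \<subseteq> carrier A \<and> generate_ring A (\<psi> ` carrier k \<union> X) = carrier A \<and>
        submonoid S A \<and> loc_ring A S \<simeq> R)"


section \<open>Cartier modules and Cartier algebras\<close>

definition cartier_module ::
    "('a, 'x) ring_scheme \<Rightarrow> nat \<Rightarrow> ('a, 'm, 'z) module_scheme \<Rightarrow> ('m \<Rightarrow> 'm) \<Rightarrow> bool" where
  "cartier_module R p M \<kappa> \<longleftrightarrow>
     module R M \<and> fin_gen_module R M \<and> \<kappa> \<in> lin_maps R (frob_push R p 1 M) M"

text \<open>
  The action on \<open>M\<close> of the Cartier algebra with \<open>C\<^sub>e = \<kappa>\<^sup>e f\<^sup>n\<^sup>(\<^sup>e\<^sup>) R\<close>, where \<open>n(0) = 0\<close>: the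
  homogeneous element \<open>\<kappa>\<^sup>e f\<^sup>n\<^sup>(\<^sup>e\<^sup>) r\<close> of degree \<open>e\<close> is addressed by the pair \<open>(e, r)\<close>. In general,
  a parameter \<open>act\<close> below gives the action of these homogeneous elements on a module; submodules
  and nilpotency depend on nothing else.
\<close>

definition cartier_act ::
    "('a, 'x) ring_scheme \<Rightarrow> ('a, 'm, 'z) module_scheme \<Rightarrow> ('m \<Rightarrow> 'm) \<Rightarrow> 'a \<Rightarrow> (nat \<Rightarrow> nat)
      \<Rightarrow> nat \<Rightarrow> 'a \<Rightarrow> 'm \<Rightarrow> 'm" where
  "cartier_act R M \<kappa> f n e r m = (\<kappa> ^^ e) ((f [^]\<^bsub>R\<^esub> n e \<otimes>\<^bsub>R\<^esub> r) \<odot>\<^bsub>M\<^esub> m)"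

definition C_submodule ::
    "('a, 'x) ring_scheme \<Rightarrow> ('a, 'm, 'z) module_scheme \<Rightarrow> (nat \<Rightarrow> 'a \<Rightarrow> 'm \<Rightarrow> 'm) \<Rightarrow> 'm set \<Rightarrow> bool" where
  "C_submodule R M act N \<longleftrightarrow>
     submodule N R M \<and> (\<forall>e. \<forall>r\<in>carrier R. \<forall>m\<in>N. act e r m \<in> N)"

definition C_plus ::
    "('a, 'x) ring_scheme \<Rightarrow> ('a, 'm, 'z) module_scheme \<Rightarrow> (nat \<Rightarrow> 'a \<Rightarrow> 'm \<Rightarrow> 'm) \<Rightarrow> 'm set \<Rightarrow> 'm set" where
  "C_plus R M act N = mod_span R M {act e r m | e r m. 1 \<le> e \<and> r \<in> carrier R \<and> m \<in> N}"

definition C_plus_pow ::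
    "('a, 'x) ring_scheme \<Rightarrow> ('a, 'm, 'z) module_scheme \<Rightarrow> (nat \<Rightarrow> 'a \<Rightarrow> 'm \<Rightarrow> 'm) \<Rightarrow> nat \<Rightarrow> 'm set" where
  "C_plus_pow R M act h = (C_plus R M act ^^ h) (carrier M)"

definition C_nilpotent ::
    "('a, 'x) ring_scheme \<Rightarrow> ('a, 'm, 'z) module_scheme \<Rightarrow> (nat \<Rightarrow> 'a \<Rightarrow> 'm \<Rightarrow> 'm) \<Rightarrow> bool" where
  "C_nilpotent R M act \<longleftrightarrow> (\<exists>a. C_plus_pow R M act a = {\<zero>\<^bsub>M\<^esub>})"

definition quot_act ::
    "('a, 'm, 'z) module_scheme \<Rightarrow> 'm set \<Rightarrow> (nat \<Rightarrow> 'a \<Rightarrow> 'm \<Rightarrow> 'm) \<Rightarrow> nat \<Rightarrow> 'a \<Rightarrow> 'm set \<Rightarrow> 'm set" where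
  "quot_act M N act e r X = set_add M N (act e r ` X)"

text \<open>For a morphism \<open>\<phi>\<close> from \<open>(M, act)\<close> to \<open>(N, act')\<close>: kernel and cokernel are nilpotent.\<close>

definition nil_isomorphism ::
    "('a, 'x) ring_scheme \<Rightarrow> ('a, 'm, 'z) module_scheme \<Rightarrow> (nat \<Rightarrow> 'a \<Rightarrow> 'm \<Rightarrow> 'm)
      \<Rightarrow> ('a, 'n, 'w) module_scheme \<Rightarrow> (nat \<Rightarrow> 'a \<Rightarrow> 'n \<Rightarrow> 'n) \<Rightarrow> ('m \<Rightarrow> 'n) \<Rightarrow> bool" where
  "nil_isomorphism R M act N act' \<phi> \<longleftrightarrow>
     C_nilpotent R (M\<lparr>carrier := {m \<in> carrier M. \<phi> m = \<zero>\<^bsub>N\<^esub>}\<rparr>) act \<and>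
     C_nilpotent R (quot_module N (\<phi> ` carrier M)) (quot_act N (\<phi> ` carrier M) act')"


section \<open>Test modules\<close>

definition tau_exponent :: "nat \<Rightarrow> rat \<Rightarrow> nat \<Rightarrow> nat" where
  "tau_exponent p lam e = (if e = 0 then 0 else nat \<lceil>lam * of_nat (p ^ e)\<rceil>)"

text \<open>
  \<open>N \<subseteq> M\<close> is a \<open>C\<close>-submodule such that \<open>H\<^sup>0\<^sub>\<eta>(N)\<^sub>\<eta> \<subseteq> H\<^sup>0\<^sub>\<eta>(M)\<^sub>\<eta>\<close> is a nil-isomorphism for all
  associated primes \<open>\<eta>\<close>. Both sides are taken as submodules of \<open>M\<^sub>\<eta>\<close>.
\<close>

definition test_candidate ::
    "('a, 'x) ring_scheme \<Rightarrow> nat \<Rightarrow> ('a, 'm, 'z) module_scheme \<Rightarrow> ('m \<Rightarrow> 'm) \<Rightarrow> 'a \<Rightarrow> rat \<Rightarrow> 'm set \<Rightarrow> bool" where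
  "test_candidate R p M \<kappa> f lam N \<longleftrightarrow>
     C_submodule R M (cartier_act R M \<kappa> f (tau_exponent p lam)) N \<and>
     (\<forall>\<eta>\<in>assoc_primes R M.
        let S = carrier R - \<eta>;
            R\<^sub>\<eta> = loc_ring R S;
            M\<^sub>\<eta> = loc_module R S M;
            act = cartier_act R\<^sub>\<eta> M\<^sub>\<eta> (loc_cartier R S p M \<kappa>) (loc_elem R S f) (tau_exponent p lam)
        in nil_isomorphism R\<^sub>\<eta>
             (M\<^sub>\<eta>\<lparr>carrier := loc_set R S M (local_cohomology0 R M \<eta> N)\<rparr>) act
             (M\<^sub>\<eta>\<lparr>carrier := loc_set R S M (local_cohomology0 R M \<eta> (carrier M))\<rparr>) act
             (\<lambda>x. x))"

text \<open>
  The smallest candidate, as the intersection of all of them; \<open>test_module_eqI\<close> states that this is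
  the smallest candidate whenever one exists.
\<close>

definition test_module ::
    "('a, 'x) ring_scheme \<Rightarrow> nat \<Rightarrow> ('a, 'm, 'z) module_scheme \<Rightarrow> ('m \<Rightarrow> 'm) \<Rightarrow> 'a \<Rightarrow> rat \<Rightarrow> 'm set" where
  "test_module R p M \<kappa> f lam = \<Inter>{N. test_candidate R p M \<kappa> f lam N}"

lemma test_module_eqI:
  assumes "test_candidate R p M \<kappa> f lam N"
    and "\<And>N'. test_candidate R p M \<kappa> f lam N' \<Longrightarrow> N \<subseteq> N'"
  shows "test_module R p M \<kappa> f lam = N"
  using assms unfolding test_module_def by blast

text \<open>\<open>\<tau>(M, f\<^sup>0) = M\<close>. As \<open>f\<^sup>0\<close> does not depend on \<open>f\<close>, we take \<open>f = 1\<close>.\<close>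

definition F_regular ::
    "('a, 'x) ring_scheme \<Rightarrow> nat \<Rightarrow> ('a, 'm, 'z) module_scheme \<Rightarrow> ('m \<Rightarrow> 'm) \<Rightarrow> bool" where
  "F_regular R p M \<kappa> \<longleftrightarrow> test_module R p M \<kappa> \<one>\<^bsub>R\<^esub> 0 = carrier M"

lemma cartier_act_zero_exponent:
  "cartier_act R M \<kappa> f (tau_exponent p 0) = cartier_act R M \<kappa> g (tau_exponent p 0)"
  by (simp add: cartier_act_def tau_exponent_def fun_eq_iff nat_pow_def)

lemma test_module_zero_exponent:
  "test_module R p M \<kappa> f 0 = test_module R p M \<kappa> g 0"
  unfolding test_module_def test_candidate_def Let_def
    cartier_act_zero_exponent[of R M \<kappa> f p g]
    cartier_act_zero_exponent[of "loc_ring R S" "loc_module R S M" "loc_cartier R S p M \<kappa>"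
      "loc_elem R S f" p "loc_elem R S g" for S] ..


section \<open>Non-F-pure modules\<close>

definition sigma_exponent :: "nat \<Rightarrow> rat \<Rightarrow> nat \<Rightarrow> nat" where
  "sigma_exponent p lam e = nat \<lceil>lam * (of_nat (p ^ e) - 1)\<rceil>"

text \<open>The elements lying in \<open>C\<^sub>+\<^sup>hM\<close> for all \<open>h \<ggreater> 0\<close>; this is the stable value of the chain by \<open>sigma_eqI\<close>.\<close>

definition sigma ::
    "('a, 'x) ring_scheme \<Rightarrow> nat \<Rightarrow> ('a, 'm, 'z) module_scheme \<Rightarrow> ('m \<Rightarrow> 'm) \<Rightarrow> 'a \<Rightarrow> rat \<Rightarrow> 'm set" where
  "sigma R p M \<kappa> f lam =
     {m. \<exists>h0. \<forall>h\<ge>h0. m \<in> C_plus_pow R M (cartier_act R M \<kappa> f (sigma_exponent p lam)) h}"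

lemma sigma_eqI:
  assumes "\<And>h. h \<ge> h0 \<Longrightarrow> C_plus_pow R M (cartier_act R M \<kappa> f (sigma_exponent p lam)) h = N"
  shows "sigma R p M \<kappa> f lam = N"
proof -
  have "m \<in> N" if "\<forall>h\<ge>h1. m \<in> C_plus_pow R M (cartier_act R M \<kappa> f (sigma_exponent p lam)) h" for m h1
    using that assms[of "max h0 h1"] by (metis max.cobounded1 max.cobounded2)
  then show ?thesis
    using assms unfolding sigma_def by blast
qed

end

theory Submission
  imports Defs "HOL-Number_Theory.Residues"
begin

text \<open>
  The test module \<open>\<tau>\<close> is the intersection of all its candidates. So for part (a) one candidate inside
  \<open>\<sigma>(M, f\<^sup>\<lambda>)\<close> is enough, and for part (b) every candidate must be shown to contain \<open>\<sigma>(M, f\<^sup>\<lambda>)\<close>. The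
  local condition on a candidate \<open>N\<close> is made explicit first: because \<open>f\<close> lies in no associated prime
  \<open>\<eta>\<close>, it says that some power of \<open>\<kappa>\<close> maps \<open>H\<^sup>0\<^sub>\<eta>(M)\<close> into \<open>N\<close> locally at \<open>\<eta>\<close>, with no reference to
  exponents (\<open>test_candidate_iff\<close>).

  Part (a). As \<open>p\<close> does not divide the denominator of \<open>\<lambda>\<close>, there is \<open>e > 0\<close> such that
  \<open>a = \<lambda>(p\<^sup>e - 1)\<close> is an integer. The map \<open>\<phi> = \<kappa>\<^sup>e f\<^sup>a\<close> satisfies \<open>\<phi>\<^sup>n = \<kappa>\<^sup>n\<^sup>e f\<^sup>A\<close> with \<open>A = \<lambda>(p\<^sup>n\<^sup>e - 1)\<close>, and its
  images stabilise by the theorem of Hartshorne, Speiser, Lyubeznik and Gabber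
  (\<open>iter_image_stabilises\<close>); the stable image \<open>T = \<phi>\<^sup>n M\<close> is contained in \<open>\<sigma>(M, f\<^sup>\<lambda>)\<close>. Since \<open>n\<close> is fixed, it is
  possible to choose \<open>\<epsilon>\<close> depending on it, and for \<open>\<epsilon> \<le> \<lambda>/p\<^sup>n\<^sup>e\<close> the largest submodule of \<open>T\<close> that is
  stable under all \<open>\<kappa>\<^sup>i f\<^sup>s\<close> with \<open>s = \<lceil>(\<lambda> - \<epsilon>)p\<^sup>i\<rceil>\<close> and \<open>i > 0\<close> contains \<open>f\<^sup>A \<kappa>\<^sup>n\<^sup>e M\<close> and is therefore a candidate
  (\<open>test_module_subset_sigma\<close>).

  Part (b). Let \<open>N\<close> be a candidate for an exponent \<open>t < \<lambda>\<close>. Then \<open>N\<^sub>f\<close> is a candidate for \<open>M\<^sub>f\<close>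
  (\<open>test_candidate_localization\<close>), so \<open>N\<^sub>f = M\<^sub>f\<close> by F-regularity, and \<open>f\<^sup>b M \<subseteq> N\<close> for some \<open>b\<close>. Elements
  of \<open>\<sigma>(M, f\<^sup>\<lambda>)\<close> are sums of elements of \<open>\<kappa>\<^sup>i f\<^sup>s M\<close> with \<open>i\<close> as large as desired and \<open>s \<ge> \<lambda>(p\<^sup>i - 1)\<close>; then
  \<open>s \<ge> \<lceil>t p\<^sup>i\<rceil> + b\<close>, and they lie in \<open>N\<close> (\<open>sigma_subset_of_power_multiple\<close>).
\<close>

section \<open>Submodules of Noetherian modules\<close>

lemma exists_maximal_of_acc:
  assumes "A \<in> F"
    and acc: "\<And>G :: nat \<Rightarrow> 'b set. (\<And>n. G n \<in> F) \<Longrightarrow> (\<And>n. G n \<subseteq> G (Suc n)) \<Longrightarrow> \<exists>n. G (Suc n) = G n"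
  obtains B where "B \<in> F" "\<And>C. C \<in> F \<Longrightarrow> B \<subseteq> C \<Longrightarrow> C = B"
proof -
  have "\<exists>B\<in>F. \<forall>C\<in>F. B \<subseteq> C \<longrightarrow> C = B"
  proof (rule ccontr)
    assume "\<not> ?thesis"
    then have larger: "\<exists>C\<in>F. B \<subset> C" if "B \<in> F" for B
      using that by blast
    have "\<exists>G. \<forall>n. G n \<in> F \<and> G n \<subset> G (Suc n)"
      by (rule dependent_nat_choice) (use assms(1) larger in auto)
    then obtain G where "\<And>n. G n \<in> F" "\<And>n. G n \<subset> G (Suc n)"
      by blast
    then show False
      using acc[of G] by blast
  qed
  then show thesis
    using that by blast
qed

lemma (in noetherian_ring) ideal_acc:
  assumes "\<And>n :: nat. ideal (J n) R" and "\<And>n. J n \<subseteq> J (Suc n)"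
  shows "\<exists>n0. \<forall>n\<ge>n0. J n = J n0"
proof -
  have mono: "J m \<subseteq> J n" if "m \<le> n" for m n
    using lift_Suc_mono_le[of J, OF assms(2) that] .
  have "\<Union>(range J) \<in> range J"
  proof (rule ideal_chain_is_trivial)
    show "subset.chain {I. ideal I R} (range J)"
      unfolding subset_chain_def
    proof (intro conjI ballI)
      fix X Y assume "X \<in> range J" "Y \<in> range J"
      then obtain m n where "X = J m" "Y = J n"
        by blast
      then show "X \<subseteq> Y \<or> Y \<subseteq> X"
        using mono[of m n] mono[of n m] by (cases "m \<le> n") auto
    qed (use assms(1) in auto)
  qed simp
  then obtain n0 where "\<Union>(range J) = J n0"
    by blast
  then have "\<forall>n\<ge>n0. J n = J n0"
    using mono by blast
  then show ?thesis ..
qed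

context module
begin

lemma smult_comm:
  assumes "a \<in> carrier R" "b \<in> carrier R" "x \<in> carrier M"
  shows "a \<odot>\<^bsub>M\<^esub> (b \<odot>\<^bsub>M\<^esub> x) = b \<odot>\<^bsub>M\<^esub> (a \<odot>\<^bsub>M\<^esub> x)"
  using assms by (metis R.m_comm smult_assoc1)

text \<open>Closure under negation is automatic, because negation is the scalar \<open>-1\<close>.\<close>

lemma submodule_intro:
  assumes "H \<subseteq> carrier M" "\<zero>\<^bsub>M\<^esub> \<in> H"
    and "\<And>x y. x \<in> H \<Longrightarrow> y \<in> H \<Longrightarrow> x \<oplus>\<^bsub>M\<^esub> y \<in> H"
    and "\<And>a x. a \<in> carrier R \<Longrightarrow> x \<in> H \<Longrightarrow> a \<odot>\<^bsub>M\<^esub> x \<in> H"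
  shows "submodule H R M"
proof (rule submoduleI)
  fix x assume "x \<in> H"
  moreover from this have "\<ominus>\<^bsub>M\<^esub> x = (\<ominus> \<one>) \<odot>\<^bsub>M\<^esub> x"
    using assms(1) by (auto simp: smult_l_minus)
  ultimately show "\<ominus>\<^bsub>M\<^esub> x \<in> H"
    using assms(4) by simp
qed (use assms in auto)

lemma submodule_zero: "submodule H R M \<Longrightarrow> \<zero>\<^bsub>M\<^esub> \<in> H"
  using subgroup.one_closed[OF submodule.axioms(1)] by fastforce

lemma submodule_cancel:
  assumes "submodule H R M" "x \<in> carrier M" "y \<in> H" "x \<oplus>\<^bsub>M\<^esub> y \<in> H"
  shows "x \<in> H"
proof -
  have "y \<in> carrier M"
    using assms submoduleE(1) by blast
  then have "x = (x \<oplus>\<^bsub>M\<^esub> y) \<oplus>\<^bsub>M\<^esub> (\<ominus>\<^bsub>M\<^esub> y)"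
    using assms(2) by (simp add: M.a_assoc M.r_neg)
  then show ?thesis
    using submoduleE(3,5)[OF assms(1)] assms(3,4) by metis
qed

lemma submodule_cancel_left:
  assumes "submodule H R M" "x \<in> carrier M" "y \<in> H" "y \<oplus>\<^bsub>M\<^esub> x \<in> H"
  shows "x \<in> H"
  using assms submodule_cancel[of H x y] submoduleE(1)[OF assms(1)] M.a_comm by (metis subsetD)

lemma submodule_Int:
  assumes "submodule A R M" "submodule B R M"
  shows "submodule (A \<inter> B) R M"
  using assms by (intro submodule_intro) (auto simp: submoduleE submodule_zero dest: subsetD[OF submoduleE(1)])

lemma submodule_Inter:
  assumes "\<And>i :: 'i. submodule (A i) R M"
  shows "submodule (\<Inter>i. A i) R M"
proof (rule submodule_intro)
  show "(\<Inter>i. A i) \<subseteq> carrier M"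
    using submoduleE(1)[OF assms] by blast
qed (use submoduleE(4,5)[OF assms] submodule_zero[OF assms] in auto)

lemma submodule_sum:
  assumes A: "submodule A R M" and B: "submodule B R M"
  shows "submodule {a \<oplus>\<^bsub>M\<^esub> b | a b. a \<in> A \<and> b \<in> B} R M"
proof (rule submodule_intro)
  note AM = submoduleE(1)[OF A] and BM = submoduleE(1)[OF B]
  show "{a \<oplus>\<^bsub>M\<^esub> b | a b. a \<in> A \<and> b \<in> B} \<subseteq> carrier M"
    using AM BM by auto
  show "\<zero>\<^bsub>M\<^esub> \<in> {a \<oplus>\<^bsub>M\<^esub> b | a b. a \<in> A \<and> b \<in> B}"
    using submodule_zero[OF A] submodule_zero[OF B] by (force intro!: exI[of _ "\<zero>\<^bsub>M\<^esub>"])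
  show "x \<oplus>\<^bsub>M\<^esub> y \<in> {a \<oplus>\<^bsub>M\<^esub> b | a b. a \<in> A \<and> b \<in> B}"
    if xy: "x \<in> {a \<oplus>\<^bsub>M\<^esub> b | a b. a \<in> A \<and> b \<in> B}" "y \<in> {a \<oplus>\<^bsub>M\<^esub> b | a b. a \<in> A \<and> b \<in> B}" for x y
  proof -
    from xy obtain a b a' b' where *: "a \<in> A" "b \<in> B" "a' \<in> A" "b' \<in> B" "x = a \<oplus>\<^bsub>M\<^esub> b" "y = a' \<oplus>\<^bsub>M\<^esub> b'"
      by auto
    moreover from * have "a \<in> carrier M" "b \<in> carrier M" "a' \<in> carrier M" "b' \<in> carrier M"
      using AM BM by auto
    ultimately have "x \<oplus>\<^bsub>M\<^esub> y = (a \<oplus>\<^bsub>M\<^esub> a') \<oplus>\<^bsub>M\<^esub> (b \<oplus>\<^bsub>M\<^esub> b')"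
      by (simp add: M.a_ac)
    then show ?thesis
      using * submoduleE(5)[OF A] submoduleE(5)[OF B] by blast
  qed
  show "r \<odot>\<^bsub>M\<^esub> x \<in> {a \<oplus>\<^bsub>M\<^esub> b | a b. a \<in> A \<and> b \<in> B}"
    if r: "r \<in> carrier R" and x: "x \<in> {a \<oplus>\<^bsub>M\<^esub> b | a b. a \<in> A \<and> b \<in> B}" for r x
  proof -
    from x obtain a b where *: "a \<in> A" "b \<in> B" "x = a \<oplus>\<^bsub>M\<^esub> b"
      by auto
    then have "r \<odot>\<^bsub>M\<^esub> x = r \<odot>\<^bsub>M\<^esub> a \<oplus>\<^bsub>M\<^esub> r \<odot>\<^bsub>M\<^esub> b"
      using r AM BM by (simp add: smult_r_distr subset_iff)
    then show ?thesis
      using * r submoduleE(4)[OF A] submoduleE(4)[OF B] by blast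
  qed
qed

lemma submodule_sum_incl:
  assumes A: "submodule A R M" and B: "submodule B R M"
  shows "A \<subseteq> {a \<oplus>\<^bsub>M\<^esub> b | a b. a \<in> A \<and> b \<in> B}" "B \<subseteq> {a \<oplus>\<^bsub>M\<^esub> b | a b. a \<in> A \<and> b \<in> B}"
proof -
  have "x = x \<oplus>\<^bsub>M\<^esub> \<zero>\<^bsub>M\<^esub>" if "x \<in> A" for x
    using that submoduleE(1)[OF A] by auto
  then show "A \<subseteq> {a \<oplus>\<^bsub>M\<^esub> b | a b. a \<in> A \<and> b \<in> B}"
    using submodule_zero[OF B] by blast
  have "x = \<zero>\<^bsub>M\<^esub> \<oplus>\<^bsub>M\<^esub> x" if "x \<in> B" for x
    using that submoduleE(1)[OF B] by auto
  then show "B \<subseteq> {a \<oplus>\<^bsub>M\<^esub> b | a b. a \<in> A \<and> b \<in> B}"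
    using submodule_zero[OF A] by blast
qed

lemma submodule_cyclic:
  assumes "x \<in> carrier M"
  shows "submodule {r \<odot>\<^bsub>M\<^esub> x | r. r \<in> carrier R} R M"
proof (rule submodule_intro)
  show "\<zero>\<^bsub>M\<^esub> \<in> {r \<odot>\<^bsub>M\<^esub> x | r. r \<in> carrier R}"
    using smult_l_null[OF assms, symmetric] R.zero_closed by blast
  show "y \<oplus>\<^bsub>M\<^esub> z \<in> {r \<odot>\<^bsub>M\<^esub> x | r. r \<in> carrier R}"
    if yz: "y \<in> {r \<odot>\<^bsub>M\<^esub> x | r. r \<in> carrier R}" "z \<in> {r \<odot>\<^bsub>M\<^esub> x | r. r \<in> carrier R}" for y z
  proof -
    from yz obtain a b where "a \<in> carrier R" "b \<in> carrier R" "y = a \<odot>\<^bsub>M\<^esub> x" "z = b \<odot>\<^bsub>M\<^esub> x"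
      by blast
    then show ?thesis
      by (intro CollectI exI[of _ "a \<oplus> b"]) (simp add: smult_l_distr assms)
  qed
  show "a \<odot>\<^bsub>M\<^esub> y \<in> {r \<odot>\<^bsub>M\<^esub> x | r. r \<in> carrier R}"
    if "a \<in> carrier R" and y: "y \<in> {r \<odot>\<^bsub>M\<^esub> x | r. r \<in> carrier R}" for a y
  proof -
    from that obtain b where "b \<in> carrier R" "y = b \<odot>\<^bsub>M\<^esub> x"
      by blast
    then show ?thesis
      using that(1) by (intro CollectI exI[of _ "a \<otimes> b"]) (simp add: smult_assoc1 assms)
  qed
qed (use assms in auto)

lemma cyclic_self:
  assumes "x \<in> carrier M"
  shows "x \<in> {r \<odot>\<^bsub>M\<^esub> x | r. r \<in> carrier R}"
  using smult_one[OF assms, symmetric] R.one_closed by blast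

lemma mod_span_submodule:
  assumes "X \<subseteq> carrier M"
  shows "submodule (mod_span R M X) R M"
proof (rule submodule_intro)
  show "mod_span R M X \<subseteq> carrier M"
    unfolding mod_span_def using assms carrier_is_submodule by blast
qed (auto simp: mod_span_def submodule_zero submoduleE)

lemma mod_span_incl: "X \<subseteq> mod_span R M X"
  unfolding mod_span_def by blast

lemma mod_span_least: "submodule N R M \<Longrightarrow> X \<subseteq> N \<Longrightarrow> mod_span R M X \<subseteq> N"
  unfolding mod_span_def by blast

lemma submodule_colon_ideal:
  assumes "submodule A R M" "submodule B R M"
  shows "ideal {r \<in> carrier R. \<forall>x\<in>A. r \<odot>\<^bsub>M\<^esub> x \<in> B} R"
proof (rule idealI)
  note B = submoduleE[OF assms(2)] submodule_zero[OF assms(2)] and A = submoduleE(1)[OF assms(1)]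
  show "ring R" ..
  show "subgroup {r \<in> carrier R. \<forall>x\<in>A. r \<odot>\<^bsub>M\<^esub> x \<in> B} (add_monoid R)"
  proof (rule R.add.subgroupI)
    show "{r \<in> carrier R. \<forall>x\<in>A. r \<odot>\<^bsub>M\<^esub> x \<in> B} \<noteq> {}"
      using A B by (auto simp: subset_iff intro!: exI[of _ \<zero>])
  qed (use A B in \<open>auto simp: smult_l_distr smult_l_minus subset_iff\<close>)
  fix a r assume a: "a \<in> {r \<in> carrier R. \<forall>x\<in>A. r \<odot>\<^bsub>M\<^esub> x \<in> B}" and r: "r \<in> carrier R"
  show "r \<otimes> a \<in> {r \<in> carrier R. \<forall>x\<in>A. r \<odot>\<^bsub>M\<^esub> x \<in> B}"
    using a r A B by (auto simp: smult_assoc1 subset_iff)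
  then show "a \<otimes> r \<in> {r \<in> carrier R. \<forall>x\<in>A. r \<odot>\<^bsub>M\<^esub> x \<in> B}"
    using a r by (simp add: R.m_comm)
qed

text \<open>
  The ascending chain condition is inherited along one more generator \<open>x\<close>: a submodule \<open>G\<close> of
  \<open>Rx + Z\<close> is determined, among the submodules containing it, by \<open>G \<inter> Z\<close> and by the ideal of all
  \<open>r\<close> with \<open>rx \<in> G + Z\<close>.
\<close>

lemma submodule_acc_span:
  assumes "noetherian_ring R" "finite X" "X \<subseteq> carrier M"
    and "\<And>n :: nat. submodule (G n) R M" "\<And>n. G n \<subseteq> G (Suc n)" "\<And>n. G n \<subseteq> mod_span R M X"
  shows "\<exists>n0. \<forall>n\<ge>n0. G n = G n0"
  using assms(2-)
proof (induction X arbitrary: G rule: finite_induct)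
  case empty
  have "submodule {\<zero>\<^bsub>M\<^esub>} R M"
    by (rule submodule_intro) auto
  then have "G n \<subseteq> {\<zero>\<^bsub>M\<^esub>}" for n
    using empty(4)[of n] mod_span_least[of "{\<zero>\<^bsub>M\<^esub>}" "{}"] by auto
  then have "G n = {\<zero>\<^bsub>M\<^esub>}" for n
    using submodule_zero[OF empty(2)] by blast
  then show ?case by simp
next
  case (insert x X)
  define Z where "Z = mod_span R M X"
  have x: "x \<in> carrier M" and X: "X \<subseteq> carrier M"
    using insert.prems(1) by auto
  have Z: "submodule Z R M"
    unfolding Z_def by (rule mod_span_submodule[OF X])
  note ZM = submoduleE(1)[OF Z]
  note Gsub = submoduleE(1)[OF insert.prems(2)]
  have mono: "G m \<subseteq> G n" if "m \<le> n" for m n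
    using lift_Suc_mono_le[of G, OF insert.prems(3) that] .
  have "\<exists>n0. \<forall>n\<ge>n0. G n \<inter> Z = G n0 \<inter> Z"
    by (rule insert.IH) (use X Z insert.prems in \<open>auto simp: submodule_Int Z_def\<close>)
  then obtain n1 where n1: "\<And>n. n \<ge> n1 \<Longrightarrow> G n \<inter> Z = G n1 \<inter> Z"
    by blast
  define J where "J n = {r \<in> carrier R. \<forall>y\<in>{r \<odot>\<^bsub>M\<^esub> x | r. r \<in> carrier R}. r \<odot>\<^bsub>M\<^esub> y \<in> {a \<oplus>\<^bsub>M\<^esub> b | a b. a \<in> G n \<and> b \<in> Z}}" for n
  have "\<exists>n0. \<forall>n\<ge>n0. J n = J n0"
  proof (rule noetherian_ring.ideal_acc[OF assms(1)])
    show "ideal (J n) R" for n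
      unfolding J_def by (intro submodule_colon_ideal submodule_cyclic submodule_sum x Z insert.prems)
    show "J n \<subseteq> J (Suc n)" for n
      unfolding J_def using insert.prems(3)[of n] by blast
  qed
  then obtain n2 where n2: "\<And>n. n \<ge> n2 \<Longrightarrow> J n = J n2"
    by blast
  have incl: "mod_span R M (insert x X) \<subseteq> {a \<oplus>\<^bsub>M\<^esub> b | a b. a \<in> {r \<odot>\<^bsub>M\<^esub> x | r. r \<in> carrier R} \<and> b \<in> Z}"
  proof (rule mod_span_least[OF submodule_sum[OF submodule_cyclic[OF x] Z]])
    show "insert x X \<subseteq> {a \<oplus>\<^bsub>M\<^esub> b | a b. a \<in> {r \<odot>\<^bsub>M\<^esub> x | r. r \<in> carrier R} \<and> b \<in> Z}"
      using submodule_sum_incl[OF submodule_cyclic[OF x] Z] cyclic_self[OF x] mod_span_incl[of X]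
      unfolding Z_def by blast
  qed
  have "G n \<subseteq> G (max n1 n2)" if "n \<ge> max n1 n2" for n
  proof
    let ?N = "max n1 n2"
    fix g assume g: "g \<in> G n"
    then obtain r z where rz: "r \<in> carrier R" "z \<in> Z" "g = r \<odot>\<^bsub>M\<^esub> x \<oplus>\<^bsub>M\<^esub> z"
      using insert.prems(4)[of n] incl by auto
    have zM: "z \<in> carrier M" and rx: "r \<odot>\<^bsub>M\<^esub> x \<in> carrier M" and gM: "g \<in> carrier M"
      using rz x ZM by auto
    have "r \<odot>\<^bsub>M\<^esub> x = g \<oplus>\<^bsub>M\<^esub> (\<ominus>\<^bsub>M\<^esub> z)"
      using rz(3) zM rx by (simp add: M.a_assoc M.r_neg)
    then have mem: "r \<odot>\<^bsub>M\<^esub> x \<in> {a \<oplus>\<^bsub>M\<^esub> b | a b. a \<in> G n \<and> b \<in> Z}"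
      using g submoduleE(3)[OF Z rz(2)] by blast
    have "r \<in> J n"
    proof -
      have "r \<odot>\<^bsub>M\<^esub> (s \<odot>\<^bsub>M\<^esub> x) \<in> {a \<oplus>\<^bsub>M\<^esub> b | a b. a \<in> G n \<and> b \<in> Z}" if "s \<in> carrier R" for s
        using submoduleE(4)[OF submodule_sum[OF insert.prems(2) Z] that mem] smult_comm[OF rz(1) that x] by metis
      then show ?thesis
        unfolding J_def using rz(1) by auto
    qed
    then have "r \<in> J ?N"
      using n2[of n] n2[of ?N] that by simp
    then have "r \<odot>\<^bsub>M\<^esub> x \<in> {a \<oplus>\<^bsub>M\<^esub> b | a b. a \<in> G ?N \<and> b \<in> Z}"
      unfolding J_def using cyclic_self[OF x] by blast
    then obtain h w where hw: "h \<in> G ?N" "w \<in> Z" "r \<odot>\<^bsub>M\<^esub> x = h \<oplus>\<^bsub>M\<^esub> w"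
      by blast
    have hM: "h \<in> carrier M" and wM: "w \<in> carrier M"
      using hw Gsub ZM by auto
    have geq: "g = (w \<oplus>\<^bsub>M\<^esub> z) \<oplus>\<^bsub>M\<^esub> h"
      using rz(3) hw(3) hM wM zM by (simp add: M.a_ac)
    have "w \<oplus>\<^bsub>M\<^esub> z \<in> G n"
      using submodule_cancel[OF insert.prems(2), of "w \<oplus>\<^bsub>M\<^esub> z" h n] geq g hw(1) mono[OF that] wM zM by auto
    moreover have "w \<oplus>\<^bsub>M\<^esub> z \<in> Z"
      using submoduleE(5)[OF Z] hw rz by blast
    ultimately have "w \<oplus>\<^bsub>M\<^esub> z \<in> G ?N"
      using n1[of n] n1[of ?N] that by auto
    then show "g \<in> G ?N"
      using geq hw(1) submoduleE(5)[OF insert.prems(2)] by metis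
  qed
  then have "\<forall>n\<ge>max n1 n2. G n = G (max n1 n2)"
    using mono by (meson subset_antisym)
  then show ?case ..
qed

lemma exists_maximal_submodule:
  assumes "noetherian_ring R" "fin_gen_module R M" "A \<in> F" "\<And>A. A \<in> F \<Longrightarrow> submodule A R M"
  obtains B where "B \<in> F" "\<And>C. C \<in> F \<Longrightarrow> B \<subseteq> C \<Longrightarrow> C = B"
proof (rule exists_maximal_of_acc[OF assms(3)])
  fix G :: "nat \<Rightarrow> 'c set"
  assume G: "\<And>n. G n \<in> F" "\<And>n. G n \<subseteq> G (Suc n)"
  obtain X where X: "finite X" "X \<subseteq> carrier M" "mod_span R M X = carrier M"
    using assms(2) unfolding fin_gen_module_def by blast
  have "\<exists>n0. \<forall>n\<ge>n0. G n = G n0"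
    by (rule submodule_acc_span[OF assms(1) X(1,2)])
      (use G assms(4) submoduleE(1) X(3) in auto)
  then show "\<exists>n. G (Suc n) = G n"
    by (meson le_SucI order_refl)
qed (use that in blast)

text \<open>
  A descending chain of submodules of \<open>U\<close> containing \<open>W\<close>, where \<open>U/W\<close> is killed by \<open>P\<close> locally at
  the prime \<open>P\<close>, stabilises locally at \<open>P\<close>: over the residue field of \<open>P\<close> this is finite
  dimensionality. Dimension is replaced by a submodule \<open>G\<close>, maximal among those that meet some
  member of the chain only in \<open>W\<close> (locally at \<open>P\<close>); an element \<open>v\<close> of the chain that does not
  enter the next member could be added to \<open>G\<close>.
\<close>

lemma chain_stabilises_locally:
  assumes "noetherian_ring R" "fin_gen_module R M" "primeideal P R"
    and N: "\<And>n :: nat. submodule (N n) R M" "\<And>n. N (Suc n) \<subseteq> N n" "\<And>n. W \<subseteq> N n" "\<And>n. N n \<subseteq> U"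
    and W: "submodule W R M"
    and s: "s \<in> carrier R - P" "\<And>a u. a \<in> P \<Longrightarrow> u \<in> U \<Longrightarrow> s \<odot>\<^bsub>M\<^esub> (a \<odot>\<^bsub>M\<^esub> u) \<in> W"
  shows "\<exists>n0. \<forall>n\<ge>n0. \<forall>v\<in>N n. \<exists>c\<in>carrier R - P. c \<odot>\<^bsub>M\<^esub> v \<in> N (Suc n)"
proof -
  interpret P: primeideal P R by fact
  have P_mult: "c \<otimes> d \<in> carrier R - P" if "c \<in> carrier R - P" "d \<in> carrier R - P" for c d
    using that P.I_prime by auto
  have one: "\<one> \<in> carrier R - P"
    using P.I_notcarr P.one_imp_carrier by auto
  define F where "F = {G. submodule G R M \<and> (\<exists>n. \<forall>x\<in>G \<inter> N n. \<exists>c\<in>carrier R - P. c \<odot>\<^bsub>M\<^esub> x \<in> W)}"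
  have "{\<zero>\<^bsub>M\<^esub>} \<in> F"
  proof -
    have "submodule {\<zero>\<^bsub>M\<^esub>} R M"
      by (rule submodule_intro) auto
    then show ?thesis
      unfolding F_def using one submodule_zero[OF W] by fastforce
  qed
  then obtain G where G: "G \<in> F" and Gmax: "\<And>C. C \<in> F \<Longrightarrow> G \<subseteq> C \<Longrightarrow> C = G"
    using exists_maximal_submodule[OF assms(1,2), of "{\<zero>\<^bsub>M\<^esub>}" F] unfolding F_def by blast
  then have Gs: "submodule G R M"
    unfolding F_def by blast
  from G obtain n where n: "\<And>x. x \<in> G \<Longrightarrow> x \<in> N n \<Longrightarrow> \<exists>c\<in>carrier R - P. c \<odot>\<^bsub>M\<^esub> x \<in> W"
    unfolding F_def by blast
  have anti: "N m \<subseteq> N n" if "n \<le> m" for m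
    using lift_Suc_antimono_le[of N, OF N(2) that] .
  have "\<exists>c\<in>carrier R - P. c \<odot>\<^bsub>M\<^esub> v \<in> N (Suc m)" if m: "m \<ge> n" and v: "v \<in> N m" for m v
  proof (rule ccontr)
    assume neg: "\<not> ?thesis"
    have vM: "v \<in> carrier M"
      using v N(1) submoduleE(1) by blast
    define G' where "G' = {g \<oplus>\<^bsub>M\<^esub> y | g y. g \<in> G \<and> y \<in> {r \<odot>\<^bsub>M\<^esub> v | r. r \<in> carrier R}}"
    have G's: "submodule G' R M" and GG': "G \<subseteq> G'" and vG': "v \<in> G'"
      unfolding G'_def using submodule_sum[OF Gs submodule_cyclic[OF vM]]
        submodule_sum_incl[OF Gs submodule_cyclic[OF vM]] cyclic_self[OF vM] by blast+
    have "\<exists>c\<in>carrier R - P. c \<odot>\<^bsub>M\<^esub> x \<in> W" if x: "x \<in> G'" "x \<in> N (Suc m)" for x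
    proof -
      obtain g a where ga: "g \<in> G" "a \<in> carrier R" "x = g \<oplus>\<^bsub>M\<^esub> a \<odot>\<^bsub>M\<^esub> v"
        using x unfolding G'_def by blast
      have gM: "g \<in> carrier M"
        using ga Gs submoduleE(1) by blast
      have av: "a \<odot>\<^bsub>M\<^esub> v \<in> N m"
        using ga v N(1) submoduleE(4) by blast
      have "g \<in> N m"
        using submodule_cancel[OF N(1) gM av] ga(3) x(2) N(2) by blast
      then obtain c where c: "c \<in> carrier R - P" "c \<odot>\<^bsub>M\<^esub> g \<in> W"
        using n ga(1) anti[OF m] by blast
      have cx: "c \<odot>\<^bsub>M\<^esub> x = c \<odot>\<^bsub>M\<^esub> g \<oplus>\<^bsub>M\<^esub> (c \<otimes> a) \<odot>\<^bsub>M\<^esub> v"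
        using c ga gM vM by (simp add: smult_r_distr smult_assoc1)
      have "c \<odot>\<^bsub>M\<^esub> x \<in> N (Suc m)"
        using c x(2) N(1) submoduleE(4) by blast
      then have "(c \<otimes> a) \<odot>\<^bsub>M\<^esub> v \<in> N (Suc m)"
        using submodule_cancel_left[OF N(1), of "(c \<otimes> a) \<odot>\<^bsub>M\<^esub> v" "c \<odot>\<^bsub>M\<^esub> g"] cx c ga vM N(3) by auto
      then have "c \<otimes> a \<in> P"
        using neg c ga by blast
      then have "a \<in> P"
        using c ga P.I_prime by blast
      then have 1: "s \<odot>\<^bsub>M\<^esub> (a \<odot>\<^bsub>M\<^esub> v) \<in> W"
        using s(2) v N(4) by blast
      have "(s \<otimes> c) \<odot>\<^bsub>M\<^esub> x = s \<odot>\<^bsub>M\<^esub> (c \<odot>\<^bsub>M\<^esub> g) \<oplus>\<^bsub>M\<^esub> c \<odot>\<^bsub>M\<^esub> (s \<odot>\<^bsub>M\<^esub> (a \<odot>\<^bsub>M\<^esub> v))"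
        using c ga gM vM s(1) by (simp add: smult_r_distr smult_assoc1 smult_comm[of c s])
      then have "(s \<otimes> c) \<odot>\<^bsub>M\<^esub> x \<in> W"
        using c(1) s(1) submoduleE(5)[OF W submoduleE(4)[OF W _ c(2)] submoduleE(4)[OF W _ 1]] by simp
      then show ?thesis
        using P_mult[OF s(1) c(1)] by blast
    qed
    then have "G' \<in> F"
      unfolding F_def using G's by blast
    then have "v \<in> G"
      using Gmax GG' vG' by blast
    then obtain c where "c \<in> carrier R - P" "c \<odot>\<^bsub>M\<^esub> v \<in> W"
      using n v anti[OF m] by blast
    then show False
      using neg N(3) by blast
  qed
  then show ?thesis
    by blast
qed

text \<open>One denominator serves all elements of a submodule, as the module is Noetherian.\<close>

lemma uniform_denominator:
  assumes "noetherian_ring R" "fin_gen_module R M" "submodule A R M" "submodule B R M"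
    and S: "S \<subseteq> carrier R" "\<one> \<in> S" "\<And>c d. c \<in> S \<Longrightarrow> d \<in> S \<Longrightarrow> c \<otimes> d \<in> S"
    and ex: "\<And>v. v \<in> A \<Longrightarrow> \<exists>c\<in>S. c \<odot>\<^bsub>M\<^esub> v \<in> B"
  shows "\<exists>c\<in>S. \<forall>v\<in>A. c \<odot>\<^bsub>M\<^esub> v \<in> B"
proof -
  define F where "F = {G. submodule G R M \<and> G \<subseteq> A \<and> (\<exists>c\<in>S. \<forall>v\<in>G. c \<odot>\<^bsub>M\<^esub> v \<in> B)}"
  have "submodule {\<zero>\<^bsub>M\<^esub>} R M"
    by (rule submodule_intro) auto
  then have "{\<zero>\<^bsub>M\<^esub>} \<in> F"
    unfolding F_def using S(1,2) submodule_zero[OF assms(3)] submodule_zero[OF assms(4)]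
    by (auto intro!: bexI[of _ \<one>])
  then obtain G where G: "G \<in> F" and Gmax: "\<And>C. C \<in> F \<Longrightarrow> G \<subseteq> C \<Longrightarrow> C = G"
    using exists_maximal_submodule[OF assms(1,2), of "{\<zero>\<^bsub>M\<^esub>}" F] unfolding F_def by blast
  from G obtain c where Gs: "submodule G R M" "G \<subseteq> A" and c: "c \<in> S" "\<And>v. v \<in> G \<Longrightarrow> c \<odot>\<^bsub>M\<^esub> v \<in> B"
    unfolding F_def by blast
  have "v \<in> G" if v: "v \<in> A" for v
  proof -
    have vM: "v \<in> carrier M"
      using v assms(3) submoduleE(1) by blast
    obtain d where d: "d \<in> S" "d \<odot>\<^bsub>M\<^esub> v \<in> B"
      using ex v by blast
    define G' where "G' = {g \<oplus>\<^bsub>M\<^esub> y | g y. g \<in> G \<and> y \<in> {r \<odot>\<^bsub>M\<^esub> v | r. r \<in> carrier R}}"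
    have G's: "submodule G' R M" and GG': "G \<subseteq> G'" and vG': "v \<in> G'"
      unfolding G'_def using submodule_sum[OF Gs(1) submodule_cyclic[OF vM]]
        submodule_sum_incl[OF Gs(1) submodule_cyclic[OF vM]] cyclic_self[OF vM] by blast+
    have "x \<in> A \<and> (c \<otimes> d) \<odot>\<^bsub>M\<^esub> x \<in> B" if x: "x \<in> G'" for x
    proof -
      obtain g a where ga: "g \<in> G" "a \<in> carrier R" "x = g \<oplus>\<^bsub>M\<^esub> a \<odot>\<^bsub>M\<^esub> v"
        using x unfolding G'_def by blast
      have gM: "g \<in> carrier M"
        using ga Gs submoduleE(1) by blast
      have cR: "c \<in> carrier R" "d \<in> carrier R"
        using c d S by auto
      have "(c \<otimes> d) \<odot>\<^bsub>M\<^esub> x = d \<odot>\<^bsub>M\<^esub> (c \<odot>\<^bsub>M\<^esub> g) \<oplus>\<^bsub>M\<^esub> (c \<otimes> a) \<odot>\<^bsub>M\<^esub> (d \<odot>\<^bsub>M\<^esub> v)"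
        using ga gM vM cR by (simp add: smult_r_distr smult_assoc1 smult_comm[of c d] smult_comm[of a d])
      then have "(c \<otimes> d) \<odot>\<^bsub>M\<^esub> x \<in> B"
        using c(2)[OF ga(1)] d cR ga(2) submoduleE(4,5)[OF assms(4)] by simp
      moreover have "x \<in> A"
        using ga v Gs(2) submoduleE(4,5)[OF assms(3)] by blast
      ultimately show ?thesis
        by blast
    qed
    then have "G' \<in> F"
      unfolding F_def using G's S(3)[OF c(1) d(1)] by blast
    then show "v \<in> G"
      using Gmax GG' vG' by blast
  qed
  then show ?thesis
    using c by blast
qed

end

section \<open>Stabilisation of the images of a \<open>q\<close>-linear map\<close>

text \<open>
  \<open>\<kappa>\<close> is an \<open>R\<close>-linear map \<open>F\<^sub>*M \<rightarrow> M\<close> when \<open>q = p\<close>; composites \<open>\<kappa>\<^sup>e f\<^sup>a\<close> are of the same kind with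
  \<open>q = p\<^sup>e\<close>.
\<close>

locale q_linear = module R M for R :: "('a, 'x) ring_scheme" (structure)
    and M :: "('a, 'm, 'z) module_scheme" (structure) +
  fixes q :: nat and \<kappa> :: "'m \<Rightarrow> 'm"
  assumes q_pos: "0 < q"
    and \<kappa>_closed [simp, intro]: "x \<in> carrier M \<Longrightarrow> \<kappa> x \<in> carrier M"
    and \<kappa>_add: "x \<in> carrier M \<Longrightarrow> y \<in> carrier M \<Longrightarrow> \<kappa> (x \<oplus>\<^bsub>M\<^esub> y) = \<kappa> x \<oplus>\<^bsub>M\<^esub> \<kappa> y"
    and \<kappa>_smult: "r \<in> carrier R \<Longrightarrow> x \<in> carrier M \<Longrightarrow> \<kappa> ((r [^]\<^bsub>R\<^esub> q) \<odot>\<^bsub>M\<^esub> x) = r \<odot>\<^bsub>M\<^esub> \<kappa> x"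
begin

lemma \<kappa>_zero [simp]: "\<kappa> \<zero>\<^bsub>M\<^esub> = \<zero>\<^bsub>M\<^esub>"
proof -
  have "\<zero> [^] q = \<zero>"
    using q_pos by (cases q) (auto simp: R.nat_pow_zero)
  then show ?thesis
    using \<kappa>_smult[of \<zero> "\<zero>\<^bsub>M\<^esub>"] by simp
qed

lemma iter_closed [simp, intro]: "x \<in> carrier M \<Longrightarrow> (\<kappa> ^^ e) x \<in> carrier M"
  by (induction e) auto

lemma iter_add:
  "x \<in> carrier M \<Longrightarrow> y \<in> carrier M \<Longrightarrow> (\<kappa> ^^ e) (x \<oplus>\<^bsub>M\<^esub> y) = (\<kappa> ^^ e) x \<oplus>\<^bsub>M\<^esub> (\<kappa> ^^ e) y"
  by (induction e) (auto simp: \<kappa>_add)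

lemma iter_zero [simp]: "(\<kappa> ^^ e) \<zero>\<^bsub>M\<^esub> = \<zero>\<^bsub>M\<^esub>"
  by (induction e) auto

lemma iter_smult:
  "r \<in> carrier R \<Longrightarrow> x \<in> carrier M \<Longrightarrow> (\<kappa> ^^ e) ((r [^]\<^bsub>R\<^esub> (q ^ e)) \<odot>\<^bsub>M\<^esub> x) = r \<odot>\<^bsub>M\<^esub> (\<kappa> ^^ e) x"
proof (induction e arbitrary: r)
  case (Suc e)
  have "r [^]\<^bsub>R\<^esub> (q ^ Suc e) = (r [^]\<^bsub>R\<^esub> q) [^]\<^bsub>R\<^esub> (q ^ e)"
    using Suc.prems by (simp add: R.nat_pow_pow)
  then have "(\<kappa> ^^ Suc e) ((r [^]\<^bsub>R\<^esub> (q ^ Suc e)) \<odot>\<^bsub>M\<^esub> x) = \<kappa> ((r [^]\<^bsub>R\<^esub> q) \<odot>\<^bsub>M\<^esub> (\<kappa> ^^ e) x)"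
    using Suc.IH[of "r [^]\<^bsub>R\<^esub> q"] Suc.prems by simp
  then show ?case
    using Suc.prems by (simp add: \<kappa>_smult)
qed simp

lemma iter_image_submodule:
  assumes "submodule N R M"
  shows "submodule ((\<kappa> ^^ e) ` N) R M"
proof (rule submodule_intro)
  note N = submoduleE[OF assms] submodule_zero[OF assms]
  show "(\<kappa> ^^ e) ` N \<subseteq> carrier M"
    using N(1) by auto
  show "\<zero>\<^bsub>M\<^esub> \<in> (\<kappa> ^^ e) ` N"
    using N by (intro image_eqI[of _ _ "\<zero>\<^bsub>M\<^esub>"]) auto
  show "x \<oplus>\<^bsub>M\<^esub> y \<in> (\<kappa> ^^ e) ` N" if xy: "x \<in> (\<kappa> ^^ e) ` N" "y \<in> (\<kappa> ^^ e) ` N" for x y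
  proof -
    from xy obtain x' y' where *: "x' \<in> N" "x = (\<kappa> ^^ e) x'" "y' \<in> N" "y = (\<kappa> ^^ e) y'"
      by blast
    then have "x \<oplus>\<^bsub>M\<^esub> y = (\<kappa> ^^ e) (x' \<oplus>\<^bsub>M\<^esub> y')"
      using subsetD[OF N(1)] iter_add[of x' y' e] by simp
    then show ?thesis
      using * N(5) by blast
  qed
  show "a \<odot>\<^bsub>M\<^esub> x \<in> (\<kappa> ^^ e) ` N" if ax: "a \<in> carrier R" "x \<in> (\<kappa> ^^ e) ` N" for a x
  proof -
    from ax obtain x' where *: "x' \<in> N" "x = (\<kappa> ^^ e) x'"
      by blast
    then have "a \<odot>\<^bsub>M\<^esub> x = (\<kappa> ^^ e) ((a [^] (q ^ e)) \<odot>\<^bsub>M\<^esub> x')"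
      using N(1) iter_smult[of a x' e] ax(1) by auto
    then show ?thesis
      using * N(4)[of "a [^] (q ^ e)"] ax(1) by blast
  qed
qed

lemma iter_image_antimono: "(\<kappa> ^^ Suc n) ` carrier M \<subseteq> (\<kappa> ^^ n) ` carrier M"
  by (auto simp: funpow_Suc_right simp del: funpow.simps)

text \<open>
  Let \<open>M\<^sub>n = \<kappa>\<^sup>n M\<close>. The ideals \<open>I\<^sub>n\<close> of all \<open>r\<close> with \<open>r M\<^sub>n \<subseteq> M\<^sub>n\<^sub>+\<^sub>1\<close> increase with \<open>n\<close>, hence are eventually a
  fixed ideal \<open>I\<close>, and the claim is \<open>1 \<in> I\<close>. As \<open>x\<^sup>2 \<in> I\<^sub>n\<close> implies \<open>x \<in> I\<^sub>n\<^sub>+\<^sub>1\<close>, the ideal \<open>I\<close> is radical; so if it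
  is proper, then a maximal ideal of the form \<open>P = (I : y)\<close> with \<open>y \<notin> I\<close> is a prime that contains \<open>I\<close>
  and agrees with it locally. On the other hand \<open>I\<^sup>2 M\<^sub>n\<close> is contained in all later images. Locally at
  \<open>P\<close>, the chain thus lives in the module \<open>M\<^sub>n / P\<^sup>2 M\<^sub>n\<close> of finite length, and it stabilises there: some
  \<open>c \<notin> P\<close> lies in an \<open>I\<^sub>n\<close>, a contradiction.
\<close>

theorem iter_image_stabilises:
  assumes noeth: "noetherian_ring R" and fg: "fin_gen_module R M" and q: "2 \<le> q"
  shows "\<exists>n0. \<forall>n\<ge>n0. (\<kappa> ^^ n) ` carrier M = (\<kappa> ^^ n0) ` carrier M"
proof -
  interpret noetherian_ring R by fact
  define N where "N n = (\<kappa> ^^ n) ` carrier M" for n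
  have Ns: "submodule (N n) R M" for n
    unfolding N_def by (intro iter_image_submodule carrier_is_submodule)
  note NM = submoduleE(1)[OF Ns] and N_smult = submoduleE(4)[OF Ns]
  have N_anti1: "N (Suc n) \<subseteq> N n" for n
    unfolding N_def by (rule iter_image_antimono)
  have N_anti: "N n \<subseteq> N m" if "m \<le> n" for m n
    using lift_Suc_antimono_le[of N, OF N_anti1 that] .
  have N_image: "N (Suc n) = \<kappa> ` N n" for n
    unfolding N_def by (auto simp: image_image)
  define I where "I n = {r \<in> carrier R. \<forall>x\<in>N n. r \<odot>\<^bsub>M\<^esub> x \<in> N (Suc n)}" for n
  have I_ideal: "ideal (I n) R" for n
    unfolding I_def by (intro submodule_colon_ideal Ns)
  have pow_split: "r [^] q = r [^] (q - 2) \<otimes> (r \<otimes> r)" if "r \<in> carrier R" for r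
  proof -
    have "r [^] (q - 2) \<otimes> r [^] (2 :: nat) = r [^] (q - 2 + 2)"
      by (rule R.nat_pow_mult[OF that])
    moreover have "r [^] (2 :: nat) = r \<otimes> r"
      using that by (simp add: numeral_2_eq_2)
    moreover have "q - 2 + 2 = q"
      using q by simp
    ultimately show ?thesis
      by (simp only:)
  qed
  have radical_step: "r \<in> I (Suc n)" if r: "r \<in> carrier R" "r \<otimes> r \<in> I n" for r n
  proof -
    have "r \<odot>\<^bsub>M\<^esub> x \<in> N (Suc (Suc n))" if x: "x \<in> N (Suc n)" for x
    proof -
      obtain y where y: "y \<in> N n" "x = \<kappa> y"
        using x unfolding N_image by blast
      have "(r [^] q) \<odot>\<^bsub>M\<^esub> y = (r [^] (q - 2)) \<odot>\<^bsub>M\<^esub> ((r \<otimes> r) \<odot>\<^bsub>M\<^esub> y)"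
        using pow_split[OF r(1)] r(1) y(1) NM by (simp add: smult_assoc1 subset_iff)
      then have "(r [^] q) \<odot>\<^bsub>M\<^esub> y \<in> N (Suc n)"
        using r y(1) N_smult unfolding I_def by auto
      moreover have "r \<odot>\<^bsub>M\<^esub> x = \<kappa> ((r [^] q) \<odot>\<^bsub>M\<^esub> y)"
        using y r(1) NM[of n] by (simp add: \<kappa>_smult subset_iff)
      ultimately show ?thesis
        using N_image by blast
    qed
    then show ?thesis
      unfolding I_def using r(1) by blast
  qed
  have "I n \<subseteq> I (Suc n)" for n
  proof
    fix r assume r: "r \<in> I n"
    then have "r \<in> carrier R"
      unfolding I_def by blast
    then show "r \<in> I (Suc n)"
      using radical_step[of r n] ideal.I_l_closed[OF I_ideal r, of r] by blast
  qed
  then obtain n0 where I_const: "\<And>n. n \<ge> n0 \<Longrightarrow> I n = I n0"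
    using ideal_acc[of I] I_ideal by blast
  interpret I: ideal "I n0" R
    by (rule I_ideal)
  have radical: "r \<in> I n0" if "r \<in> carrier R" "r \<otimes> r \<in> I n0" for r
    using radical_step[OF that] I_const[of "Suc n0"] by simp
  have "\<one> \<in> I n0"
  proof (rule ccontr)
    assume one: "\<one> \<notin> I n0"
    define colon where "colon y = {r \<in> carrier R. y \<otimes> r \<in> I n0}" for y
    have colon_ideal: "ideal (colon y) R" if y: "y \<in> carrier R" for y
    proof (rule idealI)
      show "subgroup (colon y) (add_monoid R)"
        unfolding colon_def using y
        by (intro R.add.subgroupI) (auto simp: R.r_distr R.r_minus intro!: exI[of _ \<zero>])
      show "r \<otimes> a \<in> colon y" if "a \<in> colon y" "r \<in> carrier R" for a r
        using that y I.I_l_closed[of "y \<otimes> a" r] unfolding colon_def by (auto simp: R.m_ac)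
      show "a \<otimes> r \<in> colon y" if "a \<in> colon y" "r \<in> carrier R" for a r
        using that y I.I_l_closed[of "y \<otimes> a" r] unfolding colon_def by (auto simp: R.m_ac)
    qed (rule ring_axioms)
    define F where "F = {colon y | y. y \<in> carrier R \<and> y \<notin> I n0}"
    have "colon \<one> \<in> F"
      unfolding F_def using one by blast
    then obtain P where "P \<in> F" and Pmax: "\<And>Q. Q \<in> F \<Longrightarrow> P \<subseteq> Q \<Longrightarrow> Q = P"
    proof (rule exists_maximal_of_acc)
      fix G :: "nat \<Rightarrow> 'a set"
      assume G: "\<And>n. G n \<in> F" "\<And>n. G n \<subseteq> G (Suc n)"
      have "ideal (G n) R" for n
      proof -
        obtain z where "z \<in> carrier R" "G n = colon z"
          using G(1)[of n] unfolding F_def by blast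
        then show ?thesis
          using colon_ideal by simp
      qed
      then show "\<exists>n. G (Suc n) = G n"
        using ideal_acc[of G] G(2) by (meson le_SucI order_refl)
    qed blast
    then obtain y where y: "y \<in> carrier R" "y \<notin> I n0" and P: "P = colon y"
      unfolding F_def by blast
    have yP: "y \<otimes> a \<in> I n0" "a \<in> carrier R" if "a \<in> P" for a
      using that unfolding P colon_def by auto
    have IP: "I n0 \<subseteq> P"
      unfolding P colon_def using y I.I_l_closed I.Icarr by blast
    have y_notin: "y \<notin> P"
      using radical y unfolding P colon_def by blast
    have "primeideal P R"
    proof (rule primeidealI)
      show "ideal P R"
        unfolding P by (rule colon_ideal[OF y(1)])
      show "cring R" by (rule R.is_cring)
      show "carrier R \<noteq> P"
        using y_notin y(1) by blast
      show "a \<in> P \<or> b \<in> P" if ab: "a \<in> carrier R" "b \<in> carrier R" "a \<otimes> b \<in> P" for a b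
      proof (cases "b \<in> P")
        case False
        then have "y \<otimes> b \<notin> I n0"
          using ab unfolding P colon_def by blast
        then have "colon (y \<otimes> b) \<in> F"
          unfolding F_def using y ab by blast
        moreover have "P \<subseteq> colon (y \<otimes> b)"
        proof
          fix r assume "r \<in> P"
          then show "r \<in> colon (y \<otimes> b)"
            using y ab I.I_l_closed[of "y \<otimes> r" b] unfolding P colon_def by (auto simp: R.m_ac)
        qed
        ultimately have "colon (y \<otimes> b) = P"
          by (rule Pmax)
        moreover have "a \<in> colon (y \<otimes> b)"
          using ab y unfolding P colon_def by (auto simp: R.m_ac)
        ultimately show ?thesis by blast
      qed simp
    qed
    then interpret P: primeideal P R .
    define L where "L n = N (n0 + n)" for n
    have Ls: "submodule (L n) R M" for n
      unfolding L_def by (rule Ns)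
    have L_anti1: "L (Suc n) \<subseteq> L n" for n
      unfolding L_def using N_anti1 by simp
    have L_anti: "L n \<subseteq> L 0" for n
      unfolding L_def by (rule N_anti) simp
    note LM = submoduleE(1)[OF Ls]
    \<comment> \<open>\<open>I\<^sup>2 M\<^sub>n\<close> lies in all images: \<open>r s x = r \<kappa>(z) = \<kappa>(r\<^sup>q z)\<close>, and \<open>r\<^sup>q\<close> is again divisible by \<open>r\<^sup>2\<close>\<close>
    have square: "r \<odot>\<^bsub>M\<^esub> (s \<odot>\<^bsub>M\<^esub> x) \<in> L n" if "r \<in> I n0" "s \<in> I n0" "x \<in> L 0" for r s x n
      using that
    proof (induction n arbitrary: r s x)
      case 0
      then show ?case
        by (auto intro!: submoduleE(4)[OF Ls] I.Icarr)
    next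
      case (Suc n)
      have r: "r \<in> carrier R"
        using Suc.prems I.Icarr by blast
      have "s \<odot>\<^bsub>M\<^esub> x \<in> N (Suc n0)"
        using Suc.prems unfolding I_def L_def by auto
      then obtain z where z: "z \<in> L 0" "s \<odot>\<^bsub>M\<^esub> x = \<kappa> z"
        unfolding N_image L_def by auto
      define w where "w = (r [^] (q - 2)) \<odot>\<^bsub>M\<^esub> z"
      have w: "w \<in> L 0"
        unfolding w_def using submoduleE(4)[OF Ls _ z(1)] r by simp
      have "(r [^] q) \<odot>\<^bsub>M\<^esub> z = r \<odot>\<^bsub>M\<^esub> (r \<odot>\<^bsub>M\<^esub> w)"
        unfolding w_def using pow_split[OF r] r z(1) LM
        by (simp add: smult_assoc1[symmetric] R.m_ac subset_iff)
      then have "(r [^] q) \<odot>\<^bsub>M\<^esub> z \<in> L n"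
        using Suc.IH[OF Suc.prems(1) Suc.prems(1) w] by simp
      moreover have "r \<odot>\<^bsub>M\<^esub> (s \<odot>\<^bsub>M\<^esub> x) = \<kappa> ((r [^] q) \<odot>\<^bsub>M\<^esub> z)"
        using z r LM[of 0] by (simp add: \<kappa>_smult subset_iff)
      ultimately show ?case
        unfolding L_def using N_image by auto
    qed
    define U where "U = mod_span R M {a \<odot>\<^bsub>M\<^esub> x | a x. a \<in> P \<and> x \<in> L 0}"
    have gens: "{a \<odot>\<^bsub>M\<^esub> x | a x. a \<in> P \<and> x \<in> L 0} \<subseteq> L 0"
      using submoduleE(4)[OF Ls] P.Icarr by blast
    have Us: "submodule U R M"
      unfolding U_def using gens LM by (intro mod_span_submodule) blast
    have U_incl: "a \<odot>\<^bsub>M\<^esub> x \<in> U" if "a \<in> P" "x \<in> L 0" for a x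
      unfolding U_def using mod_span_incl that by fast
    have UL: "U \<subseteq> L 0"
      unfolding U_def using mod_span_least[OF Ls gens] .
    define D where "D = (\<Inter>n. L n)"
    have Ds: "submodule D R M"
      unfolding D_def by (rule submodule_Inter[OF Ls])
    have yy: "y \<otimes> y \<in> carrier R - P"
      using y(1) y_notin P.I_prime[of y y] by blast
    \<comment> \<open>Hence so does \<open>y\<^sup>2 P\<^sup>2 M\<^sub>n\<close>, because \<open>yP \<subseteq> I\<close>.\<close>
    have yyD: "(y \<otimes> y) \<odot>\<^bsub>M\<^esub> (a \<odot>\<^bsub>M\<^esub> u) \<in> D" if a: "a \<in> P" and u: "u \<in> U" for a u
    proof -
      let ?C = "{u \<in> carrier M. (y \<otimes> y \<otimes> a) \<odot>\<^bsub>M\<^esub> u \<in> D}"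
      have aR: "a \<in> carrier R"
        using a by (rule P.Icarr)
      have "submodule ?C R M"
      proof (rule submodule_intro)
        show "r \<odot>\<^bsub>M\<^esub> x \<in> ?C" if "r \<in> carrier R" "x \<in> ?C" for r x
          using that aR y(1) submoduleE(4)[OF Ds, of r] smult_comm[of "y \<otimes> y \<otimes> a" r x] by auto
      qed (use submodule_zero[OF Ds] submoduleE(5)[OF Ds] y(1) aR in \<open>auto simp: smult_r_distr\<close>)
      moreover have "{a \<odot>\<^bsub>M\<^esub> x | a x. a \<in> P \<and> x \<in> L 0} \<subseteq> ?C"
      proof clarify
        fix b x assume bx: "b \<in> P" "x \<in> L 0"
        have bR: "b \<in> carrier R" and xM: "x \<in> carrier M"
          using bx LM P.Icarr by auto
        have "(y \<otimes> y \<otimes> a) \<odot>\<^bsub>M\<^esub> (b \<odot>\<^bsub>M\<^esub> x) = (y \<otimes> a) \<odot>\<^bsub>M\<^esub> ((y \<otimes> b) \<odot>\<^bsub>M\<^esub> x)"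
          using y(1) aR bR xM by (simp add: smult_assoc1[symmetric] R.m_ac)
        then have "(y \<otimes> y \<otimes> a) \<odot>\<^bsub>M\<^esub> (b \<odot>\<^bsub>M\<^esub> x) \<in> D"
          unfolding D_def using square[OF yP(1)[OF a] yP(1)[OF bx(1)] bx(2)] by auto
        then show "b \<odot>\<^bsub>M\<^esub> x \<in> carrier M \<and> (y \<otimes> y \<otimes> a) \<odot>\<^bsub>M\<^esub> (b \<odot>\<^bsub>M\<^esub> x) \<in> D"
          using bR xM by blast
      qed
      ultimately have "U \<subseteq> ?C"
        unfolding U_def by (rule mod_span_least)
      then show ?thesis
        using u aR y(1) by (auto simp: smult_assoc1)
    qed
    \<comment> \<open>The two layers \<open>M\<^sub>n / P M\<^sub>n\<close> and \<open>P M\<^sub>n / P\<^sup>2 M\<^sub>n\<close> are each killed by \<open>P\<close>; \<open>U\<close> is \<open>P M\<^sub>n\<close>.\<close>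
    define L' where "L' n = {a \<oplus>\<^bsub>M\<^esub> b | a b. a \<in> L n \<and> b \<in> U}" for n
    have L'_sub: "L' n \<subseteq> L 0" for n
      unfolding L'_def using L_anti UL submoduleE(5)[OF Ls] by blast
    have "\<exists>n1. \<forall>n\<ge>n1. \<forall>v\<in>L' n. \<exists>c\<in>carrier R - P. c \<odot>\<^bsub>M\<^esub> v \<in> L' (Suc n)"
    proof (rule chain_stabilises_locally[where N = L' and W = U and U = "L 0" and s = \<one>, OF noeth fg \<open>primeideal P R\<close>])
      show "submodule (L' n) R M" for n
        unfolding L'_def by (rule submodule_sum[OF Ls Us])
      show "L' (Suc n) \<subseteq> L' n" for n
        unfolding L'_def using L_anti1 by blast
      show "U \<subseteq> L' n" for n
        unfolding L'_def by (rule submodule_sum_incl(2)[OF Ls Us])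
      show "\<one> \<in> carrier R - P"
        using P.I_notcarr P.one_imp_carrier by auto
      show "\<one> \<odot>\<^bsub>M\<^esub> (a \<odot>\<^bsub>M\<^esub> u) \<in> U" if "a \<in> P" "u \<in> L 0" for a u
        using U_incl[OF that] submoduleE(1)[OF Us] by auto
    qed (rule L'_sub, rule Us)
    then obtain n1 where n1: "\<And>n v. n \<ge> n1 \<Longrightarrow> v \<in> L' n \<Longrightarrow> \<exists>c\<in>carrier R - P. c \<odot>\<^bsub>M\<^esub> v \<in> L' (Suc n)"
      by blast
    have "\<exists>n2. \<forall>n\<ge>n2. \<forall>v\<in>L n \<inter> U. \<exists>c\<in>carrier R - P. c \<odot>\<^bsub>M\<^esub> v \<in> L (Suc n) \<inter> U"
    proof (rule chain_stabilises_locally[where N = "\<lambda>n. L n \<inter> U" and W = "D \<inter> U" and U = U and s = "y \<otimes> y",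
        OF noeth fg \<open>primeideal P R\<close>])
      show "submodule (L n \<inter> U) R M" for n
        by (rule submodule_Int[OF Ls Us])
      show "L (Suc n) \<inter> U \<subseteq> L n \<inter> U" for n
        using L_anti1 by blast
      show "D \<inter> U \<subseteq> L n \<inter> U" for n
        unfolding D_def by blast
      show "L n \<inter> U \<subseteq> U" for n by blast
      show "submodule (D \<inter> U) R M"
        by (rule submodule_Int[OF Ds Us])
      show "y \<otimes> y \<in> carrier R - P" by (rule yy)
      show "(y \<otimes> y) \<odot>\<^bsub>M\<^esub> (a \<odot>\<^bsub>M\<^esub> u) \<in> D \<inter> U" if "a \<in> P" "u \<in> U" for a u
        using yyD[OF that] submoduleE(4)[OF Us] P.Icarr[OF that(1)] that(2) yy by blast
    qed
    then obtain n2 where n2: "\<And>n v. n \<ge> n2 \<Longrightarrow> v \<in> L n \<inter> U \<Longrightarrow> \<exists>c\<in>carrier R - P. c \<odot>\<^bsub>M\<^esub> v \<in> L (Suc n) \<inter> U"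
      by blast
    define n where "n = max n1 n2"
    have mult: "c \<otimes> d \<in> carrier R - P" if "c \<in> carrier R - P" "d \<in> carrier R - P" for c d
      using that P.I_prime by auto
    have "\<exists>c\<in>carrier R - P. c \<odot>\<^bsub>M\<^esub> v \<in> L (Suc n)" if v: "v \<in> L n" for v
    proof -
      have "v \<in> L' n"
        using v submodule_sum_incl(1)[OF Ls Us] unfolding L'_def by blast
      then obtain c a b where c: "c \<in> carrier R - P" and ab: "a \<in> L (Suc n)" "b \<in> U" "c \<odot>\<^bsub>M\<^esub> v = a \<oplus>\<^bsub>M\<^esub> b"
        using n1[of n v] unfolding L'_def n_def by auto
      have aM: "a \<in> carrier M" and bM: "b \<in> carrier M" and vM: "v \<in> carrier M"
        using ab v LM submoduleE(1)[OF Us] by auto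
      have "a \<oplus>\<^bsub>M\<^esub> b \<in> L n"
        using ab(3) submoduleE(4)[OF Ls _ v] c by (metis DiffD1)
      then have "b \<in> L n"
        using submodule_cancel_left[OF Ls bM] ab(1) L_anti1 by blast
      then obtain d where d: "d \<in> carrier R - P" "d \<odot>\<^bsub>M\<^esub> b \<in> L (Suc n)"
        using n2[of n b] ab(2) unfolding n_def by auto
      have "(d \<otimes> c) \<odot>\<^bsub>M\<^esub> v = d \<odot>\<^bsub>M\<^esub> a \<oplus>\<^bsub>M\<^esub> d \<odot>\<^bsub>M\<^esub> b"
        using c d ab(3) aM bM vM by (simp add: smult_assoc1 smult_r_distr)
      then have "(d \<otimes> c) \<odot>\<^bsub>M\<^esub> v \<in> L (Suc n)"
        using submoduleE(5)[OF Ls submoduleE(4)[OF Ls _ ab(1)] d(2)] d(1) by simp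
      then show ?thesis
        using mult[OF d(1) c] by blast
    qed
    then have "\<exists>c\<in>carrier R - P. \<forall>v\<in>L n. c \<odot>\<^bsub>M\<^esub> v \<in> L (Suc n)"
      using mult P.I_notcarr P.one_imp_carrier
      by (intro uniform_denominator[OF noeth fg Ls Ls]) auto
    then obtain c where "c \<in> carrier R - P" "\<And>v. v \<in> L n \<Longrightarrow> c \<odot>\<^bsub>M\<^esub> v \<in> L (Suc n)"
      by blast
    then have "c \<in> I (n0 + n)" "c \<notin> P"
      unfolding I_def L_def by auto
    then show False
      using I_const[of "n0 + n"] IP by auto
  qed
  have step: "N (Suc n) = N n" if "n \<ge> n0" for n
  proof -
    have "\<one> \<in> I n"
      using \<open>\<one> \<in> I n0\<close> I_const[OF that] by simp
    then have "x \<in> N (Suc n)" if "x \<in> N n" for x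
      using that NM[of n] unfolding I_def by (auto simp: subset_iff)
    then show ?thesis
      using N_anti1 by blast
  qed
  have "N n = N n0" if "n \<ge> n0" for n
    using that by (induction rule: dec_induct) (simp_all add: step)
  then show ?thesis
    unfolding N_def by blast
qed

end

section \<open>Localization\<close>

lemma (in cring) regular_module_module: "module R (regular_module R)"
  unfolding regular_module_def
  by (rule moduleI) (auto simp: l_distr r_distr m_assoc is_cring intro!: abelian_groupI l_neg a_comm a_assoc a_inv_closed
      bexI[of _ "\<ominus> _"])

text \<open>
  The multiplicatively closed set \<open>S\<close> may contain zero divisors and even zero. This is why equality of
  fractions carries an additional factor \<open>u \<in> S\<close> throughout.
\<close>

locale localization = module R M for R :: "('a, 'x) ring_scheme" (structure)
    and M :: "('a, 'm, 'z) module_scheme" (structure) +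
  fixes S :: "'a set"
  assumes S_subset: "S \<subseteq> carrier R"
    and S_one [simp, intro]: "\<one> \<in> S"
    and S_mult [simp, intro]: "s \<in> S \<Longrightarrow> t \<in> S \<Longrightarrow> s \<otimes> t \<in> S"
begin

abbreviation fr :: "'m \<Rightarrow> 'a \<Rightarrow> ('m \<times> 'a) set" where
  "fr \<equiv> frac R S M"

lemma S_carrier [simp, intro]: "s \<in> S \<Longrightarrow> s \<in> carrier R"
  using S_subset by blast

lemma S_pow [simp, intro]: "s \<in> S \<Longrightarrow> s [^] (n :: nat) \<in> S"
  by (induction n) auto

lemma localization_regular: "localization R (regular_module R) S"
  by (intro localization.intro localization_axioms.intro R.regular_module_module S_subset) auto

lemma frac_subset:
  assumes [simp]: "m \<in> carrier M" "n \<in> carrier M" "s \<in> S" "t \<in> S" "u \<in> S"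
    and eq: "u \<odot>\<^bsub>M\<^esub> (t \<odot>\<^bsub>M\<^esub> m) = u \<odot>\<^bsub>M\<^esub> (s \<odot>\<^bsub>M\<^esub> n)"
  shows "fr m s \<subseteq> fr n t"
proof (clarsimp simp: frac_def)
  fix m' s' v assume [simp]: "m' \<in> carrier M" "s' \<in> S" "v \<in> S"
    and v: "v \<odot>\<^bsub>M\<^esub> (s' \<odot>\<^bsub>M\<^esub> m) = v \<odot>\<^bsub>M\<^esub> (s \<odot>\<^bsub>M\<^esub> m')"
  have "(u \<otimes> (v \<otimes> s)) \<odot>\<^bsub>M\<^esub> (s' \<odot>\<^bsub>M\<^esub> n) = (v \<otimes> s') \<odot>\<^bsub>M\<^esub> (u \<odot>\<^bsub>M\<^esub> (s \<odot>\<^bsub>M\<^esub> n))"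
    by (simp add: smult_assoc1[symmetric] R.m_ac)
  also have "\<dots> = (u \<otimes> t) \<odot>\<^bsub>M\<^esub> (v \<odot>\<^bsub>M\<^esub> (s' \<odot>\<^bsub>M\<^esub> m))"
    unfolding eq[symmetric] by (simp add: smult_assoc1[symmetric] R.m_ac)
  also have "\<dots> = (u \<otimes> (v \<otimes> s)) \<odot>\<^bsub>M\<^esub> (t \<odot>\<^bsub>M\<^esub> m')"
    unfolding v by (simp add: smult_assoc1[symmetric] R.m_ac)
  finally show "\<exists>u\<in>S. u \<odot>\<^bsub>M\<^esub> (s' \<odot>\<^bsub>M\<^esub> n) = u \<odot>\<^bsub>M\<^esub> (t \<odot>\<^bsub>M\<^esub> m')"
    by (intro bexI[of _ "u \<otimes> (v \<otimes> s)"]) auto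
qed

lemma frac_eqI:
  assumes "m \<in> carrier M" "n \<in> carrier M" "s \<in> S" "t \<in> S" "u \<in> S"
    and "u \<odot>\<^bsub>M\<^esub> (t \<odot>\<^bsub>M\<^esub> m) = u \<odot>\<^bsub>M\<^esub> (s \<odot>\<^bsub>M\<^esub> n)"
  shows "fr m s = fr n t"
  using frac_subset[OF assms] frac_subset[OF assms(2,1,4,3,5) assms(6)[symmetric]] by blast

lemma frac_self: "m \<in> carrier M \<Longrightarrow> s \<in> S \<Longrightarrow> (m, s) \<in> fr m s"
  unfolding frac_def by auto

lemma frac_eqD:
  assumes "n \<in> carrier M" "t \<in> S" "fr m s = fr n t"
  shows "\<exists>u\<in>S. u \<odot>\<^bsub>M\<^esub> (t \<odot>\<^bsub>M\<^esub> m) = u \<odot>\<^bsub>M\<^esub> (s \<odot>\<^bsub>M\<^esub> n)"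
  using frac_self[OF assms(1,2)] unfolding assms(3)[symmetric] by (auto simp: frac_def)

lemma frac_cancel:
  assumes [simp]: "m \<in> carrier M" "s \<in> S" "u \<in> S"
  shows "fr (u \<odot>\<^bsub>M\<^esub> m) (u \<otimes> s) = fr m s"
  by (rule frac_eqI[of _ _ _ _ \<one>]) (auto simp: smult_assoc1[symmetric] R.m_ac)

text \<open>
  Operations on fractions are unions over all representatives. If an expression \<open>F\<close> does not depend
  on the representative, then such a union collapses to its value at any one of them; this turns
  each operation into its usual formula.
\<close>

lemma frac_UN:
  assumes "m \<in> carrier M" "s \<in> S"
    and "\<And>m' s'. m' \<in> carrier M \<Longrightarrow> s' \<in> S \<Longrightarrow> fr m' s' = fr m s \<Longrightarrow> F m' s' = F m s"
  shows "(\<Union>(m', s')\<in>fr m s. F m' s') = F m s"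
proof -
  have "F m' s' = F m s" if "(m', s') \<in> fr m s" for m' s'
  proof -
    from that obtain u where "m' \<in> carrier M" "s' \<in> S" "u \<in> S" "u \<odot>\<^bsub>M\<^esub> (s' \<odot>\<^bsub>M\<^esub> m) = u \<odot>\<^bsub>M\<^esub> (s \<odot>\<^bsub>M\<^esub> m')"
      unfolding frac_def by auto
    then show ?thesis
      using assms frac_eqI[of m m' s s' u] by metis
  qed
  then show ?thesis
    using frac_self[OF assms(1,2)] by fast
qed

abbreviation RS :: "('a \<times> 'a) set ring" where "RS \<equiv> loc_ring R S"
abbreviation MS :: "(('a \<times> 'a) set, ('m \<times> 'a) set) module" where "MS \<equiv> loc_module R S M"
abbreviation frR :: "'a \<Rightarrow> 'a \<Rightarrow> ('a \<times> 'a) set" where "frR \<equiv> frac R S (regular_module R)"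

lemma loc_add:
  assumes m [simp]: "m \<in> carrier M" and n [simp]: "n \<in> carrier M" and s [simp]: "s \<in> S" and t [simp]: "t \<in> S"
  shows "fr m s \<oplus>\<^bsub>MS\<^esub> fr n t = fr (t \<odot>\<^bsub>M\<^esub> m \<oplus>\<^bsub>M\<^esub> s \<odot>\<^bsub>M\<^esub> n) (s \<otimes> t)"
proof -
  have wd: "fr (t' \<odot>\<^bsub>M\<^esub> m' \<oplus>\<^bsub>M\<^esub> s' \<odot>\<^bsub>M\<^esub> n') (s' \<otimes> t') = fr (t \<odot>\<^bsub>M\<^esub> m \<oplus>\<^bsub>M\<^esub> s \<odot>\<^bsub>M\<^esub> n) (s \<otimes> t)"
    if [simp]: "m' \<in> carrier M" "s' \<in> S" "n' \<in> carrier M" "t' \<in> S"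
      and eq: "fr m' s' = fr m s" "fr n' t' = fr n t" for m' s' n' t'
  proof -
    obtain u where [simp]: "u \<in> S" and u: "u \<odot>\<^bsub>M\<^esub> (s \<odot>\<^bsub>M\<^esub> m') = u \<odot>\<^bsub>M\<^esub> (s' \<odot>\<^bsub>M\<^esub> m)"
      using frac_eqD[OF m s eq(1)] by blast
    obtain v where [simp]: "v \<in> S" and v: "v \<odot>\<^bsub>M\<^esub> (t \<odot>\<^bsub>M\<^esub> n') = v \<odot>\<^bsub>M\<^esub> (t' \<odot>\<^bsub>M\<^esub> n)"
      using frac_eqD[OF n t eq(2)] by blast
    have "(u \<otimes> v) \<odot>\<^bsub>M\<^esub> ((s \<otimes> t) \<odot>\<^bsub>M\<^esub> (t' \<odot>\<^bsub>M\<^esub> m' \<oplus>\<^bsub>M\<^esub> s' \<odot>\<^bsub>M\<^esub> n'))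
      = (v \<otimes> (t \<otimes> t')) \<odot>\<^bsub>M\<^esub> (u \<odot>\<^bsub>M\<^esub> (s \<odot>\<^bsub>M\<^esub> m')) \<oplus>\<^bsub>M\<^esub> (u \<otimes> (s \<otimes> s')) \<odot>\<^bsub>M\<^esub> (v \<odot>\<^bsub>M\<^esub> (t \<odot>\<^bsub>M\<^esub> n'))"
      by (simp add: smult_r_distr smult_assoc1[symmetric] R.m_ac)
    also have "\<dots> = (u \<otimes> v) \<odot>\<^bsub>M\<^esub> ((s' \<otimes> t') \<odot>\<^bsub>M\<^esub> (t \<odot>\<^bsub>M\<^esub> m \<oplus>\<^bsub>M\<^esub> s \<odot>\<^bsub>M\<^esub> n))"
      unfolding u v by (simp add: smult_r_distr smult_assoc1[symmetric] R.m_ac)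
    finally show ?thesis
      by (intro frac_eqI[of _ _ _ _ "u \<otimes> v"]) auto
  qed
  have inner: "(\<Union>(n', t')\<in>fr n t. fr (t' \<odot>\<^bsub>M\<^esub> m' \<oplus>\<^bsub>M\<^esub> s' \<odot>\<^bsub>M\<^esub> n') (s' \<otimes> t'))
      = fr (t \<odot>\<^bsub>M\<^esub> m \<oplus>\<^bsub>M\<^esub> s \<odot>\<^bsub>M\<^esub> n) (s \<otimes> t)"
    if "m' \<in> carrier M" "s' \<in> S" "fr m' s' = fr m s" for m' s'
  proof -
    have "(\<Union>(n', t')\<in>fr n t. fr (t' \<odot>\<^bsub>M\<^esub> m' \<oplus>\<^bsub>M\<^esub> s' \<odot>\<^bsub>M\<^esub> n') (s' \<otimes> t'))
      = fr (t \<odot>\<^bsub>M\<^esub> m' \<oplus>\<^bsub>M\<^esub> s' \<odot>\<^bsub>M\<^esub> n) (s' \<otimes> t)"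
      by (rule frac_UN[OF n t]) (metis wd that n t)
    then show ?thesis
      using wd[OF that(1,2) n t that(3) refl] by simp
  qed
  have "fr m s \<oplus>\<^bsub>MS\<^esub> fr n t = (\<Union>(m, s)\<in>fr m s. \<Union>(n, t)\<in>fr n t. fr (t \<odot>\<^bsub>M\<^esub> m \<oplus>\<^bsub>M\<^esub> s \<odot>\<^bsub>M\<^esub> n) (s \<otimes> t))"
    by (simp add: loc_module_def Let_def)
  also have "\<dots> = (\<Union>(n, t)\<in>fr n t. fr (t \<odot>\<^bsub>M\<^esub> m \<oplus>\<^bsub>M\<^esub> s \<odot>\<^bsub>M\<^esub> n) (s \<otimes> t))"
    by (rule frac_UN[OF m s]) (simp add: inner)
  also have "\<dots> = fr (t \<odot>\<^bsub>M\<^esub> m \<oplus>\<^bsub>M\<^esub> s \<odot>\<^bsub>M\<^esub> n) (s \<otimes> t)"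
    by (simp add: inner)
  finally show ?thesis .
qed

lemma loc_smult:
  assumes a [simp]: "a \<in> carrier R" and s [simp]: "s \<in> S" and m [simp]: "m \<in> carrier M" and t [simp]: "t \<in> S"
  shows "frR a s \<odot>\<^bsub>MS\<^esub> fr m t = fr (a \<odot>\<^bsub>M\<^esub> m) (s \<otimes> t)"
proof -
  interpret reg: localization R "regular_module R" S
    by (rule localization_regular)
  have reg_simps: "carrier (regular_module R) = carrier R" "x \<odot>\<^bsub>regular_module R\<^esub> y = x \<otimes> y" for x y
    by (simp_all add: regular_module_def)
  have wd: "fr (a' \<odot>\<^bsub>M\<^esub> m') (s' \<otimes> t') = fr (a \<odot>\<^bsub>M\<^esub> m) (s \<otimes> t)"
    if [simp]: "a' \<in> carrier R" "s' \<in> S" "m' \<in> carrier M" "t' \<in> S"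
      and eq: "frR a' s' = frR a s" "fr m' t' = fr m t" for a' s' m' t'
  proof -
    obtain u where [simp]: "u \<in> S" and u: "u \<otimes> (s \<otimes> a') = u \<otimes> (s' \<otimes> a)"
      using reg.frac_eqD[OF _ s eq(1)] by (auto simp: reg_simps)
    obtain v where [simp]: "v \<in> S" and v: "v \<odot>\<^bsub>M\<^esub> (t \<odot>\<^bsub>M\<^esub> m') = v \<odot>\<^bsub>M\<^esub> (t' \<odot>\<^bsub>M\<^esub> m)"
      using frac_eqD[OF m t eq(2)] by blast
    have "(u \<otimes> v) \<odot>\<^bsub>M\<^esub> ((s \<otimes> t) \<odot>\<^bsub>M\<^esub> (a' \<odot>\<^bsub>M\<^esub> m')) = (u \<otimes> (s \<otimes> a')) \<odot>\<^bsub>M\<^esub> (v \<odot>\<^bsub>M\<^esub> (t \<odot>\<^bsub>M\<^esub> m'))"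
      by (simp add: smult_assoc1[symmetric] R.m_ac)
    also have "\<dots> = (u \<otimes> v) \<odot>\<^bsub>M\<^esub> ((s' \<otimes> t') \<odot>\<^bsub>M\<^esub> (a \<odot>\<^bsub>M\<^esub> m))"
      unfolding u v by (simp add: smult_assoc1[symmetric] R.m_ac)
    finally show ?thesis
      by (intro frac_eqI[of _ _ _ _ "u \<otimes> v"]) auto
  qed
  have inner: "(\<Union>(m', t')\<in>fr m t. fr (a' \<odot>\<^bsub>M\<^esub> m') (s' \<otimes> t')) = fr (a \<odot>\<^bsub>M\<^esub> m) (s \<otimes> t)"
    if "a' \<in> carrier R" "s' \<in> S" "frR a' s' = frR a s" for a' s'
  proof -
    have "(\<Union>(m', t')\<in>fr m t. fr (a' \<odot>\<^bsub>M\<^esub> m') (s' \<otimes> t')) = fr (a' \<odot>\<^bsub>M\<^esub> m) (s' \<otimes> t)"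
      by (rule frac_UN[OF m t]) (metis wd that m t)
    then show ?thesis
      using wd[OF that(1,2) m t that(3) refl] by simp
  qed
  have "frR a s \<odot>\<^bsub>MS\<^esub> fr m t = (\<Union>(a, s)\<in>frR a s. \<Union>(m, t)\<in>fr m t. fr (a \<odot>\<^bsub>M\<^esub> m) (s \<otimes> t))"
    by (simp add: loc_module_def Let_def)
  also have "\<dots> = (\<Union>(m, t)\<in>fr m t. fr (a \<odot>\<^bsub>M\<^esub> m) (s \<otimes> t))"
    by (rule reg.frac_UN) (auto simp: reg_simps inner)
  also have "\<dots> = fr (a \<odot>\<^bsub>M\<^esub> m) (s \<otimes> t)"
    by (simp add: inner)
  finally show ?thesis .
qed

lemma loc_zero: "\<zero>\<^bsub>MS\<^esub> = fr \<zero>\<^bsub>M\<^esub> \<one>"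
  by (simp add: loc_module_def Let_def)

lemma loc_carrier: "carrier MS = {fr m s | m s. m \<in> carrier M \<and> s \<in> S}"
  by (simp add: loc_module_def Let_def loc_set_def)

lemma frac_in_carrier [simp, intro]: "m \<in> carrier M \<Longrightarrow> s \<in> S \<Longrightarrow> fr m s \<in> carrier MS"
  unfolding loc_carrier by blast

lemma loc_cases:
  assumes "X \<in> carrier MS"
  obtains m s where "m \<in> carrier M" "s \<in> S" "X = fr m s"
  using assms unfolding loc_carrier by blast

lemma frac_zero: "s \<in> S \<Longrightarrow> fr \<zero>\<^bsub>M\<^esub> s = \<zero>\<^bsub>MS\<^esub>"
  unfolding loc_zero by (rule frac_eqI[of _ _ _ _ \<one>]) auto

lemma frac_eq_zeroD:
  assumes "m \<in> carrier M" "s \<in> S" "fr m s = \<zero>\<^bsub>MS\<^esub>"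
  shows "\<exists>u\<in>S. u \<odot>\<^bsub>M\<^esub> m = \<zero>\<^bsub>M\<^esub>"
  using frac_eqD[of "\<zero>\<^bsub>M\<^esub>" \<one> m s] assms unfolding loc_zero by auto

lemma loc_abelian_group: "abelian_group MS"
proof (rule abelian_groupI)
  fix X Y Z assume XYZ: "X \<in> carrier MS" "Y \<in> carrier MS" "Z \<in> carrier MS"
  obtain m s where [simp]: "m \<in> carrier M" "s \<in> S" and X: "X = fr m s"
    using XYZ by (auto elim: loc_cases)
  obtain n t where [simp]: "n \<in> carrier M" "t \<in> S" and Y: "Y = fr n t"
    using XYZ by (auto elim: loc_cases)
  obtain k u where [simp]: "k \<in> carrier M" "u \<in> S" and Z: "Z = fr k u"
    using XYZ by (auto elim: loc_cases)
  show "X \<oplus>\<^bsub>MS\<^esub> Y \<oplus>\<^bsub>MS\<^esub> Z = X \<oplus>\<^bsub>MS\<^esub> (Y \<oplus>\<^bsub>MS\<^esub> Z)"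
    unfolding X Y Z by (simp add: loc_add smult_r_distr smult_assoc1[symmetric] R.m_ac M.a_ac)
next
  fix X Y assume XY: "X \<in> carrier MS" "Y \<in> carrier MS"
  obtain m s where [simp]: "m \<in> carrier M" "s \<in> S" and X: "X = fr m s"
    using XY by (auto elim: loc_cases)
  obtain n t where [simp]: "n \<in> carrier M" "t \<in> S" and Y: "Y = fr n t"
    using XY by (auto elim: loc_cases)
  show "X \<oplus>\<^bsub>MS\<^esub> Y = Y \<oplus>\<^bsub>MS\<^esub> X"
    unfolding X Y by (simp add: loc_add R.m_ac M.a_ac)
  show "X \<oplus>\<^bsub>MS\<^esub> Y \<in> carrier MS"
    unfolding X Y by (simp add: loc_add)
next
  fix X assume "X \<in> carrier MS"
  then obtain m s where [simp]: "m \<in> carrier M" "s \<in> S" and X: "X = fr m s"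
    by (auto elim: loc_cases)
  show "\<zero>\<^bsub>MS\<^esub> \<oplus>\<^bsub>MS\<^esub> X = X"
    unfolding X loc_zero by (simp add: loc_add)
  have "fr (\<ominus>\<^bsub>M\<^esub> m) s \<oplus>\<^bsub>MS\<^esub> X = \<zero>\<^bsub>MS\<^esub>"
    unfolding X by (simp add: loc_add smult_r_minus M.l_neg frac_zero)
  then show "\<exists>Y\<in>carrier MS. Y \<oplus>\<^bsub>MS\<^esub> X = \<zero>\<^bsub>MS\<^esub>"
    by (rule bexI) auto
qed (auto simp: loc_zero)

lemma loc_ring_mult:
  assumes "a \<in> carrier R" "s \<in> S" "b \<in> carrier R" "t \<in> S"
  shows "frR a s \<otimes>\<^bsub>RS\<^esub> frR b t = frR (a \<otimes> b) (s \<otimes> t)"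
proof -
  interpret reg: localization R "regular_module R" S
    by (rule localization_regular)
  have "frR a s \<otimes>\<^bsub>RS\<^esub> frR b t = frR a s \<odot>\<^bsub>loc_module R S (regular_module R)\<^esub> frR b t"
    by (simp add: loc_module_def loc_ring_def Let_def regular_module_def)
  then show ?thesis
    using assms reg.loc_smult[of a s b t] by (simp add: regular_module_def)
qed

lemma loc_ring_add:
  assumes "a \<in> carrier R" "s \<in> S" "b \<in> carrier R" "t \<in> S"
  shows "frR a s \<oplus>\<^bsub>RS\<^esub> frR b t = frR (t \<otimes> a \<oplus> s \<otimes> b) (s \<otimes> t)"
proof -
  interpret reg: localization R "regular_module R" S
    by (rule localization_regular)
  have "frR a s \<oplus>\<^bsub>RS\<^esub> frR b t = frR a s \<oplus>\<^bsub>loc_module R S (regular_module R)\<^esub> frR b t"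
    by (simp add: loc_module_def loc_ring_def Let_def regular_module_def)
  then show ?thesis
    using assms reg.loc_add[of a b s t] by (simp add: regular_module_def)
qed

lemma loc_ring_carrier: "carrier RS = {frR a s | a s. a \<in> carrier R \<and> s \<in> S}"
  by (simp add: loc_ring_def Let_def loc_set_def)

lemma frac_in_ring [simp, intro]: "a \<in> carrier R \<Longrightarrow> s \<in> S \<Longrightarrow> frR a s \<in> carrier RS"
  unfolding loc_ring_carrier by blast

lemma loc_ring_cases:
  assumes "X \<in> carrier RS"
  obtains a s where "a \<in> carrier R" "s \<in> S" "X = frR a s"
  using assms unfolding loc_ring_carrier by blast

lemma loc_ring_one: "\<one>\<^bsub>RS\<^esub> = frR \<one> \<one>"
  by (simp add: loc_ring_def Let_def)

lemma frR_eqI: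
  assumes "a \<in> carrier R" "b \<in> carrier R" "s \<in> S" "t \<in> S" "t \<otimes> a = s \<otimes> b"
  shows "frR a s = frR b t"
proof -
  interpret reg: localization R "regular_module R" S
    by (rule localization_regular)
  show ?thesis
    by (rule reg.frac_eqI[of _ _ _ _ \<one>]) (use assms in \<open>auto simp: regular_module_def\<close>)
qed

lemma loc_ring_cring: "cring RS"
proof (rule cringI)
  interpret reg: localization R "regular_module R" S
    by (rule localization_regular)
  have same: "carrier RS = carrier reg.MS" "ring.add RS = ring.add reg.MS" "ring.zero RS = ring.zero reg.MS"
    by (simp_all add: loc_module_def loc_ring_def Let_def regular_module_def)
  interpret add: abelian_group reg.MS
    by (rule reg.loc_abelian_group)
  show "abelian_group RS"
    proof (rule abelian_groupI)
    show "\<exists>Y\<in>carrier RS. Y \<oplus>\<^bsub>RS\<^esub> X = \<zero>\<^bsub>RS\<^esub>" if "X \<in> carrier RS" for X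
      using that add.l_neg[of X] add.a_inv_closed[of X] unfolding same by blast
  qed (simp_all add: same add.a_ac)
  show "comm_monoid RS"
  proof (rule comm_monoidI)
    fix X Y Z assume XYZ: "X \<in> carrier RS" "Y \<in> carrier RS" "Z \<in> carrier RS"
    obtain a s where [simp]: "a \<in> carrier R" "s \<in> S" and X: "X = frR a s"
      using XYZ by (auto elim: loc_ring_cases)
    obtain b t where [simp]: "b \<in> carrier R" "t \<in> S" and Y: "Y = frR b t"
      using XYZ by (auto elim: loc_ring_cases)
    obtain c u where [simp]: "c \<in> carrier R" "u \<in> S" and Z: "Z = frR c u"
      using XYZ by (auto elim: loc_ring_cases)
    show "X \<otimes>\<^bsub>RS\<^esub> Y \<otimes>\<^bsub>RS\<^esub> Z = X \<otimes>\<^bsub>RS\<^esub> (Y \<otimes>\<^bsub>RS\<^esub> Z)"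
      unfolding X Y Z by (simp add: loc_ring_mult R.m_ac)
  next
    fix X Y assume XY: "X \<in> carrier RS" "Y \<in> carrier RS"
    obtain a s where [simp]: "a \<in> carrier R" "s \<in> S" and X: "X = frR a s"
      using XY by (auto elim: loc_ring_cases)
    obtain b t where [simp]: "b \<in> carrier R" "t \<in> S" and Y: "Y = frR b t"
      using XY by (auto elim: loc_ring_cases)
    show "X \<otimes>\<^bsub>RS\<^esub> Y = Y \<otimes>\<^bsub>RS\<^esub> X"
      unfolding X Y by (simp add: loc_ring_mult R.m_ac)
    show "X \<otimes>\<^bsub>RS\<^esub> Y \<in> carrier RS"
      unfolding X Y by (simp add: loc_ring_mult)
  next
    fix X assume "X \<in> carrier RS"
    then obtain a s where [simp]: "a \<in> carrier R" "s \<in> S" and X: "X = frR a s"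
      by (auto elim: loc_ring_cases)
    show "\<one>\<^bsub>RS\<^esub> \<otimes>\<^bsub>RS\<^esub> X = X"
      unfolding X loc_ring_one by (simp add: loc_ring_mult)
  qed (auto simp: loc_ring_one)
  fix X Y Z assume XYZ: "X \<in> carrier RS" "Y \<in> carrier RS" "Z \<in> carrier RS"
  obtain a s where [simp]: "a \<in> carrier R" "s \<in> S" and X: "X = frR a s"
    using XYZ by (auto elim: loc_ring_cases)
  obtain b t where [simp]: "b \<in> carrier R" "t \<in> S" and Y: "Y = frR b t"
    using XYZ by (auto elim: loc_ring_cases)
  obtain c u where [simp]: "c \<in> carrier R" "u \<in> S" and Z: "Z = frR c u"
    using XYZ by (auto elim: loc_ring_cases)
  show "(X \<oplus>\<^bsub>RS\<^esub> Y) \<otimes>\<^bsub>RS\<^esub> Z = X \<otimes>\<^bsub>RS\<^esub> Z \<oplus>\<^bsub>RS\<^esub> Y \<otimes>\<^bsub>RS\<^esub> Z"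
    unfolding X Y Z by (simp add: loc_ring_mult loc_ring_add) (rule frR_eqI, auto simp: R.l_distr R.r_distr R.m_ac)
qed

lemma loc_module_module: "module RS MS"
proof (rule moduleI)
  fix A X assume "A \<in> carrier RS" "X \<in> carrier MS"
  then show "A \<odot>\<^bsub>MS\<^esub> X \<in> carrier MS"
    by (elim loc_ring_cases loc_cases) (simp add: loc_smult)
next
  fix A B X assume "A \<in> carrier RS" "B \<in> carrier RS" "X \<in> carrier MS"
  then obtain a s b t m u where [simp]: "a \<in> carrier R" "s \<in> S" "b \<in> carrier R" "t \<in> S" "m \<in> carrier M" "u \<in> S"
    and ABX: "A = frR a s" "B = frR b t" "X = fr m u"
    by (elim loc_ring_cases loc_cases) blast
  show "(A \<otimes>\<^bsub>RS\<^esub> B) \<odot>\<^bsub>MS\<^esub> X = A \<odot>\<^bsub>MS\<^esub> (B \<odot>\<^bsub>MS\<^esub> X)"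
    unfolding ABX by (simp add: loc_smult loc_ring_mult smult_assoc1 R.m_ac)
  show "(A \<oplus>\<^bsub>RS\<^esub> B) \<odot>\<^bsub>MS\<^esub> X = A \<odot>\<^bsub>MS\<^esub> X \<oplus>\<^bsub>MS\<^esub> B \<odot>\<^bsub>MS\<^esub> X"
    unfolding ABX
    by (simp add: loc_smult loc_ring_add loc_add, rule frac_eqI[of _ _ _ _ \<one>])
      (auto simp: smult_l_distr smult_r_distr smult_assoc1[symmetric] R.m_ac)
next
  fix A X Y assume "A \<in> carrier RS" "X \<in> carrier MS" "Y \<in> carrier MS"
  then obtain a s m u n v where [simp]: "a \<in> carrier R" "s \<in> S" "m \<in> carrier M" "u \<in> S" "n \<in> carrier M" "v \<in> S"
    and AXY: "A = frR a s" "X = fr m u" "Y = fr n v"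
    by (elim loc_ring_cases loc_cases) blast
  show "A \<odot>\<^bsub>MS\<^esub> (X \<oplus>\<^bsub>MS\<^esub> Y) = A \<odot>\<^bsub>MS\<^esub> X \<oplus>\<^bsub>MS\<^esub> A \<odot>\<^bsub>MS\<^esub> Y"
    unfolding AXY
    by (simp add: loc_smult loc_add, rule frac_eqI[of _ _ _ _ \<one>])
      (auto simp: smult_r_distr smult_assoc1[symmetric] R.m_ac)
next
  fix X assume "X \<in> carrier MS"
  then show "\<one>\<^bsub>RS\<^esub> \<odot>\<^bsub>MS\<^esub> X = X"
    by (elim loc_cases) (simp add: loc_ring_one loc_smult)
qed (auto intro: loc_ring_cring loc_abelian_group)

lemma loc_ring_pow:
  assumes "a \<in> carrier R" "s \<in> S"
  shows "frR a s [^]\<^bsub>RS\<^esub> (n :: nat) = frR (a [^] n) (s [^] n)"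
proof (induction n)
  case 0
  interpret RS: cring RS by (rule loc_ring_cring)
  show ?case by (simp add: loc_ring_one)
next
  case (Suc n)
  interpret RS: cring RS by (rule loc_ring_cring)
  show ?case using Suc assms by (simp add: loc_ring_mult)
qed

lemma loc_set_iff:
  assumes N: "submodule N R M" and m: "m \<in> carrier M" and s: "s \<in> S"
  shows "fr m s \<in> loc_set R S M N \<longleftrightarrow> (\<exists>u\<in>S. u \<odot>\<^bsub>M\<^esub> m \<in> N)"
proof
  assume "fr m s \<in> loc_set R S M N"
  then obtain n t where nt: "n \<in> N" "t \<in> S" "fr m s = fr n t"
    unfolding loc_set_def by blast
  then obtain u where u: "u \<in> S" "u \<odot>\<^bsub>M\<^esub> (t \<odot>\<^bsub>M\<^esub> m) = u \<odot>\<^bsub>M\<^esub> (s \<odot>\<^bsub>M\<^esub> n)"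
    using frac_eqD[of n t m s] submoduleE(1)[OF N] by blast
  then have "(u \<otimes> t) \<odot>\<^bsub>M\<^esub> m \<in> N"
    using nt s m submoduleE(4)[OF N] by (simp add: smult_assoc1)
  then show "\<exists>u\<in>S. u \<odot>\<^bsub>M\<^esub> m \<in> N"
    using u nt by blast
next
  assume "\<exists>u\<in>S. u \<odot>\<^bsub>M\<^esub> m \<in> N"
  then obtain u where "u \<in> S" "u \<odot>\<^bsub>M\<^esub> m \<in> N" by blast
  then show "fr m s \<in> loc_set R S M N"
    using frac_cancel[OF m s, of u] s unfolding loc_set_def by (metis (mono_tags, lifting) S_mult mem_Collect_eq)
qed

lemma loc_set_submodule:
  assumes N: "submodule N R M"
  shows "submodule (loc_set R S M N) RS MS"
proof (rule module.submodule_intro[OF loc_module_module])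
  note NM = submoduleE(1)[OF N]
  show "loc_set R S M N \<subseteq> carrier MS"
    unfolding loc_set_def loc_carrier using NM by blast
  show "\<zero>\<^bsub>MS\<^esub> \<in> loc_set R S M N"
    unfolding loc_set_def loc_zero using submodule_zero[OF N] by blast
  show "X \<oplus>\<^bsub>MS\<^esub> Y \<in> loc_set R S M N" if XY: "X \<in> loc_set R S M N" "Y \<in> loc_set R S M N" for X Y
  proof -
    obtain m s where ms: "m \<in> N" "s \<in> S" "X = fr m s"
      using XY unfolding loc_set_def by blast
    obtain n t where nt: "n \<in> N" "t \<in> S" "Y = fr n t"
      using XY unfolding loc_set_def by blast
    have "X \<oplus>\<^bsub>MS\<^esub> Y = fr (t \<odot>\<^bsub>M\<^esub> m \<oplus>\<^bsub>M\<^esub> s \<odot>\<^bsub>M\<^esub> n) (s \<otimes> t)"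
      using ms nt NM by (simp add: loc_add subset_iff)
    moreover have "t \<odot>\<^bsub>M\<^esub> m \<oplus>\<^bsub>M\<^esub> s \<odot>\<^bsub>M\<^esub> n \<in> N"
      using ms nt by (auto intro!: submoduleE(4,5)[OF N])
    ultimately show ?thesis
      unfolding loc_set_def using ms nt by blast
  qed
  show "A \<odot>\<^bsub>MS\<^esub> X \<in> loc_set R S M N" if AX: "A \<in> carrier RS" "X \<in> loc_set R S M N" for A X
  proof -
    obtain m s where ms: "m \<in> N" "s \<in> S" "X = fr m s"
      using AX unfolding loc_set_def by blast
    obtain a t where at: "a \<in> carrier R" "t \<in> S" "A = frR a t"
      using AX by (auto elim: loc_ring_cases)
    have "A \<odot>\<^bsub>MS\<^esub> X = fr (a \<odot>\<^bsub>M\<^esub> m) (t \<otimes> s)"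
      using ms at NM by (simp add: loc_smult subset_iff)
    then show ?thesis
      unfolding loc_set_def using ms at submoduleE(4)[OF N] by blast
  qed
qed

end

locale q_linear_localization = q_linear R M q \<kappa> + localization R M S
  for R :: "('a, 'x) ring_scheme" (structure)
    and M :: "('a, 'm, 'z) module_scheme" (structure) and q \<kappa> S
begin

abbreviation \<kappa>S :: "('m \<times> 'a) set \<Rightarrow> ('m \<times> 'a) set" where
  "\<kappa>S \<equiv> loc_cartier R S q M \<kappa>"

lemma pow_q: "r \<in> carrier R \<Longrightarrow> r [^] q = r [^] (q - 1) \<otimes> r"
  using q_pos by (metis R.nat_pow_Suc Suc_diff_1)

text \<open>
  If \<open>u s m' = u s' m\<close>, then \<open>u s \<kappa>(s'\<^sup>q\<^sup>-\<^sup>1 m') = \<kappa>((us)\<^sup>q s'\<^sup>q\<^sup>-\<^sup>1 m')\<close>, and the argument of \<open>\<kappa>\<close> on the right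
  is \<open>u\<^sup>q\<^sup>-\<^sup>1 s\<^sup>q\<^sup>-\<^sup>1 s'\<^sup>q\<^sup>-\<^sup>1 (u s m')\<close>, which does not change when the two fractions are exchanged.
\<close>

lemma loc_cartier_frac:
  assumes m [simp]: "m \<in> carrier M" and s [simp]: "s \<in> S"
  shows "\<kappa>S (fr m s) = fr (\<kappa> ((s [^] (q - 1)) \<odot>\<^bsub>M\<^esub> m)) s"
  unfolding loc_cartier_def
proof (rule frac_UN[OF m s])
  fix m' s' assume [simp]: "m' \<in> carrier M" "s' \<in> S" and eq: "fr m' s' = fr m s"
  obtain u where [simp]: "u \<in> S" and u: "u \<odot>\<^bsub>M\<^esub> (s \<odot>\<^bsub>M\<^esub> m') = u \<odot>\<^bsub>M\<^esub> (s' \<odot>\<^bsub>M\<^esub> m)"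
    using frac_eqD[OF m s eq] by blast
  have split: "(u \<otimes> s) [^] q = u [^] (q - 1) \<otimes> (s [^] (q - 1) \<otimes> (u \<otimes> s))"
    if [simp]: "s \<in> S" for s
    by (simp add: pow_q R.nat_pow_distrib R.m_ac)
  have "u \<odot>\<^bsub>M\<^esub> (s \<odot>\<^bsub>M\<^esub> \<kappa> ((s' [^] (q - 1)) \<odot>\<^bsub>M\<^esub> m')) = \<kappa> (((u \<otimes> s) [^] q) \<odot>\<^bsub>M\<^esub> ((s' [^] (q - 1)) \<odot>\<^bsub>M\<^esub> m'))"
    by (simp add: \<kappa>_smult smult_assoc1)
  also have "((u \<otimes> s) [^] q) \<odot>\<^bsub>M\<^esub> ((s' [^] (q - 1)) \<odot>\<^bsub>M\<^esub> m')
    = (u [^] (q - 1) \<otimes> (s [^] (q - 1) \<otimes> s' [^] (q - 1))) \<odot>\<^bsub>M\<^esub> (u \<odot>\<^bsub>M\<^esub> (s \<odot>\<^bsub>M\<^esub> m'))"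
    unfolding split[OF s] by (simp add: smult_assoc1[symmetric] R.m_ac)
  also have "\<dots> = ((u \<otimes> s') [^] q) \<odot>\<^bsub>M\<^esub> ((s [^] (q - 1)) \<odot>\<^bsub>M\<^esub> m)"
    unfolding split[OF \<open>s' \<in> S\<close>] u by (simp add: smult_assoc1[symmetric] R.m_ac)
  also have "\<kappa> \<dots> = u \<odot>\<^bsub>M\<^esub> (s' \<odot>\<^bsub>M\<^esub> \<kappa> ((s [^] (q - 1)) \<odot>\<^bsub>M\<^esub> m))"
    by (simp add: \<kappa>_smult smult_assoc1)
  finally show "fr (\<kappa> ((s' [^] (q - 1)) \<odot>\<^bsub>M\<^esub> m')) s' = fr (\<kappa> ((s [^] (q - 1)) \<odot>\<^bsub>M\<^esub> m)) s"
    by (intro frac_eqI[of _ _ _ _ u]) auto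
qed

lemma loc_q_linear: "q_linear RS MS q \<kappa>S"
proof (intro q_linear.intro q_linear_axioms.intro)
  show "module RS MS" by (rule loc_module_module)
  show "0 < q" by (rule q_pos)
  fix X assume "X \<in> carrier MS"
  then obtain m s where [simp]: "m \<in> carrier M" "s \<in> S" and X: "X = fr m s"
    by (auto elim: loc_cases)
  show "\<kappa>S X \<in> carrier MS"
    unfolding X by (simp add: loc_cartier_frac)
  show "\<kappa>S (X \<oplus>\<^bsub>MS\<^esub> Y) = \<kappa>S X \<oplus>\<^bsub>MS\<^esub> \<kappa>S Y" if "Y \<in> carrier MS" for Y
  proof -
    obtain n t where [simp]: "n \<in> carrier M" "t \<in> S" and Y: "Y = fr n t"
      using \<open>Y \<in> carrier MS\<close> by (auto elim: loc_cases)
    have "((s \<otimes> t) [^] (q - 1)) \<odot>\<^bsub>M\<^esub> (t \<odot>\<^bsub>M\<^esub> m \<oplus>\<^bsub>M\<^esub> s \<odot>\<^bsub>M\<^esub> n)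
      = (t [^] q) \<odot>\<^bsub>M\<^esub> ((s [^] (q - 1)) \<odot>\<^bsub>M\<^esub> m) \<oplus>\<^bsub>M\<^esub> (s [^] q) \<odot>\<^bsub>M\<^esub> ((t [^] (q - 1)) \<odot>\<^bsub>M\<^esub> n)"
      by (simp add: pow_q R.nat_pow_distrib smult_r_distr smult_assoc1[symmetric] R.m_ac)
    then have "\<kappa> (((s \<otimes> t) [^] (q - 1)) \<odot>\<^bsub>M\<^esub> (t \<odot>\<^bsub>M\<^esub> m \<oplus>\<^bsub>M\<^esub> s \<odot>\<^bsub>M\<^esub> n))
      = t \<odot>\<^bsub>M\<^esub> \<kappa> ((s [^] (q - 1)) \<odot>\<^bsub>M\<^esub> m) \<oplus>\<^bsub>M\<^esub> s \<odot>\<^bsub>M\<^esub> \<kappa> ((t [^] (q - 1)) \<odot>\<^bsub>M\<^esub> n)"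
      by (simp add: \<kappa>_add \<kappa>_smult)
    then show ?thesis
      unfolding X Y by (simp add: loc_add loc_cartier_frac)
  qed
  show "\<kappa>S ((A [^]\<^bsub>RS\<^esub> q) \<odot>\<^bsub>MS\<^esub> X) = A \<odot>\<^bsub>MS\<^esub> \<kappa>S X" if "A \<in> carrier RS" for A
  proof -
    obtain a t where [simp]: "a \<in> carrier R" "t \<in> S" and A: "A = frR a t"
      using \<open>A \<in> carrier RS\<close> by (auto elim: loc_ring_cases)
    have "(t [^] q) [^] (q - 1) = (t [^] (q - 1)) [^] q"
      by (simp add: R.nat_pow_pow mult.commute)
    then have "((t [^] q \<otimes> s) [^] (q - 1)) \<odot>\<^bsub>M\<^esub> ((a [^] q) \<odot>\<^bsub>M\<^esub> m)
      = ((t [^] (q - 1) \<otimes> a) [^] q) \<odot>\<^bsub>M\<^esub> ((s [^] (q - 1)) \<odot>\<^bsub>M\<^esub> m)"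
      by (simp add: R.nat_pow_distrib smult_assoc1[symmetric] R.m_ac)
    then have "\<kappa> (((t [^] q \<otimes> s) [^] (q - 1)) \<odot>\<^bsub>M\<^esub> ((a [^] q) \<odot>\<^bsub>M\<^esub> m))
      = t [^] (q - 1) \<odot>\<^bsub>M\<^esub> (a \<odot>\<^bsub>M\<^esub> \<kappa> ((s [^] (q - 1)) \<odot>\<^bsub>M\<^esub> m))"
      by (simp add: \<kappa>_smult smult_assoc1)
    moreover have "t [^] q \<otimes> s = t [^] (q - 1) \<otimes> (t \<otimes> s)"
      by (simp add: pow_q R.m_ac)
    ultimately show ?thesis
      unfolding X A by (simp add: loc_ring_pow loc_smult loc_cartier_frac frac_cancel)
  qed
qed

lemma loc_cartier_iter:
  assumes [simp]: "m \<in> carrier M" "s \<in> S"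
  shows "(\<kappa>S ^^ e) (fr m s) = fr ((\<kappa> ^^ e) ((s [^] (q ^ e - 1)) \<odot>\<^bsub>M\<^esub> m)) s"
proof (induction e)
  case (Suc e)
  have "(s [^] (q - 1)) \<odot>\<^bsub>M\<^esub> (\<kappa> ^^ e) ((s [^] (q ^ e - 1)) \<odot>\<^bsub>M\<^esub> m)
    = (\<kappa> ^^ e) ((s [^] ((q - 1) * q ^ e)) \<odot>\<^bsub>M\<^esub> ((s [^] (q ^ e - 1)) \<odot>\<^bsub>M\<^esub> m))"
    by (simp add: iter_smult[symmetric] R.nat_pow_pow)
  also have "\<dots> = (\<kappa> ^^ e) ((s [^] ((q - 1) * q ^ e + (q ^ e - 1))) \<odot>\<^bsub>M\<^esub> m)"
    by (simp add: smult_assoc1[symmetric] R.nat_pow_mult)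
  also have "(q - 1) * q ^ e + (q ^ e - 1) = q ^ Suc e - 1"
    using q_pos by (simp add: algebra_simps diff_mult_distrib)
  finally show ?case
    using Suc.IH by (simp add: loc_cartier_frac)
qed (simp add: R.nat_pow_0)

end

section \<open>Cartier algebra actions\<close>

text \<open>
  The condition under which the maps \<open>\<kappa>\<^sup>e f\<^sup>n\<^sup>(\<^sup>e\<^sup>) r\<close> are closed under composition, so that they are the
  homogeneous elements of a Cartier algebra.
\<close>

definition cartier_exponent :: "nat \<Rightarrow> (nat \<Rightarrow> nat) \<Rightarrow> bool" where
  "cartier_exponent q n \<longleftrightarrow> n 0 = 0 \<and> (\<forall>e e'. n (e + e') \<le> n e * q ^ e' + n e')"

lemma nat_ceiling_le_iff: "nat \<lceil>x\<rceil> \<le> k \<longleftrightarrow> (x :: rat) \<le> of_nat k"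
  by (simp add: nat_le_iff ceiling_le_iff)

lemma le_nat_ceiling: "(x :: rat) \<le> of_nat (nat \<lceil>x\<rceil>)"
  using nat_ceiling_le_iff[of x "nat \<lceil>x\<rceil>"] by simp

lemma cartier_exponent_tau: "cartier_exponent p (tau_exponent p lam)"
proof -
  have "nat \<lceil>lam * of_nat (p ^ (e + e'))\<rceil> \<le> nat \<lceil>lam * of_nat (p ^ e)\<rceil> * p ^ e'" for e e'
  proof -
    have "lam * of_nat (p ^ (e + e')) = lam * of_nat (p ^ e) * of_nat (p ^ e')"
      by (simp add: power_add)
    also have "\<dots> \<le> of_nat (nat \<lceil>lam * of_nat (p ^ e)\<rceil>) * of_nat (p ^ e')"
      by (intro mult_right_mono le_nat_ceiling) simp
    finally show ?thesis
      by (simp add: nat_ceiling_le_iff)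
  qed
  then show ?thesis
    unfolding cartier_exponent_def tau_exponent_def by (auto intro: trans_le_add1)
qed

lemma cartier_exponent_sigma: "cartier_exponent p (sigma_exponent p lam)"
proof -
  have "sigma_exponent p lam (e + e') \<le> sigma_exponent p lam e * p ^ e' + sigma_exponent p lam e'" for e e'
  proof -
    have "lam * (of_nat (p ^ (e + e')) - 1)
      = lam * (of_nat (p ^ e) - 1) * of_nat (p ^ e') + lam * (of_nat (p ^ e') - 1)"
      by (simp add: power_add algebra_simps)
    also have "\<dots> \<le> of_nat (sigma_exponent p lam e) * of_nat (p ^ e') + of_nat (sigma_exponent p lam e')"
      unfolding sigma_exponent_def by (intro add_mono mult_right_mono le_nat_ceiling) simp
    finally show ?thesis
      unfolding sigma_exponent_def nat_ceiling_le_iff by simp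
  qed
  then show ?thesis
    unfolding cartier_exponent_def by (simp add: sigma_exponent_def)
qed

context q_linear
begin

lemma iter_smult_iter:
  assumes "c \<in> carrier R" "x \<in> carrier M"
  shows "(\<kappa> ^^ e) (c \<odot>\<^bsub>M\<^esub> (\<kappa> ^^ e') x) = (\<kappa> ^^ (e + e')) ((c [^] (q ^ e')) \<odot>\<^bsub>M\<^esub> x)"
  using assms by (simp add: funpow_add iter_smult)

lemma act_closed [simp, intro]:
  "f \<in> carrier R \<Longrightarrow> r \<in> carrier R \<Longrightarrow> x \<in> carrier M \<Longrightarrow> cartier_act R M \<kappa> f n e r x \<in> carrier M"
  unfolding cartier_act_def by simp

lemma act_add:
  "f \<in> carrier R \<Longrightarrow> r \<in> carrier R \<Longrightarrow> x \<in> carrier M \<Longrightarrow> y \<in> carrier M \<Longrightarrow>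
    cartier_act R M \<kappa> f n e r (x \<oplus>\<^bsub>M\<^esub> y) = cartier_act R M \<kappa> f n e r x \<oplus>\<^bsub>M\<^esub> cartier_act R M \<kappa> f n e r y"
  unfolding cartier_act_def by (simp add: smult_r_distr iter_add)

lemma act_smult:
  "f \<in> carrier R \<Longrightarrow> r \<in> carrier R \<Longrightarrow> s \<in> carrier R \<Longrightarrow> x \<in> carrier M \<Longrightarrow>
    cartier_act R M \<kappa> f n e r (s \<odot>\<^bsub>M\<^esub> x) = cartier_act R M \<kappa> f n e (r \<otimes> s) x"
  unfolding cartier_act_def by (simp add: smult_assoc1)

lemma act_zero:
  "f \<in> carrier R \<Longrightarrow> r \<in> carrier R \<Longrightarrow> cartier_act R M \<kappa> f n e r \<zero>\<^bsub>M\<^esub> = \<zero>\<^bsub>M\<^esub>"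
  unfolding cartier_act_def by simp

lemma act_degree_0: "n 0 = 0 \<Longrightarrow> x \<in> carrier M \<Longrightarrow> cartier_act R M \<kappa> f n 0 \<one> x = x"
  unfolding cartier_act_def by simp

lemma act_of_larger_exponent:
  assumes "f \<in> carrier R" "r \<in> carrier R" "x \<in> carrier M" "n e \<le> k"
  shows "(\<kappa> ^^ e) ((f [^] k \<otimes> r) \<odot>\<^bsub>M\<^esub> x) = cartier_act R M \<kappa> f n e (f [^] (k - n e) \<otimes> r) x"
proof -
  have "f [^] k = f [^] n e \<otimes> f [^] (k - n e)"
    using assms by (simp add: R.nat_pow_mult)
  then show ?thesis
    unfolding cartier_act_def using assms by (simp add: R.m_assoc)
qed

lemma act_act:
  assumes "f \<in> carrier R" "r \<in> carrier R" "r' \<in> carrier R" "x \<in> carrier M"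
  shows "cartier_act R M \<kappa> f n e r (cartier_act R M \<kappa> f n e' r' x)
    = (\<kappa> ^^ (e + e')) ((f [^] (n e * q ^ e' + n e') \<otimes> (r [^] (q ^ e') \<otimes> r')) \<odot>\<^bsub>M\<^esub> x)"
  unfolding cartier_act_def using assms
  by (simp add: iter_smult_iter smult_assoc1[symmetric] R.nat_pow_distrib R.nat_pow_pow R.nat_pow_mult[symmetric] R.m_ac)

lemma act_compose:
  assumes "cartier_exponent q n" "f \<in> carrier R" "r \<in> carrier R" "r' \<in> carrier R" "x \<in> carrier M"
  obtains r'' where "r'' \<in> carrier R"
    "cartier_act R M \<kappa> f n e r (cartier_act R M \<kappa> f n e' r' x) = cartier_act R M \<kappa> f n (e + e') r'' x"
proof -
  have "n (e + e') \<le> n e * q ^ e' + n e'"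
    using assms(1) unfolding cartier_exponent_def by blast
  then show thesis
    by (intro that[of "f [^] (n e * q ^ e' + n e' - n (e + e')) \<otimes> (r [^] (q ^ e') \<otimes> r')"])
      (use assms in \<open>simp_all add: act_act act_of_larger_exponent\<close>)
qed

lemma C_submodule_act:
  assumes "C_submodule R M (cartier_act R M \<kappa> f n) N" "r \<in> carrier R" "x \<in> N"
  shows "cartier_act R M \<kappa> f n e r x \<in> N"
  using assms unfolding C_submodule_def by blast

lemma C_submodule_submodule: "C_submodule R M act N \<Longrightarrow> submodule N R M"
  unfolding C_submodule_def by blast

lemma act_preimage_submodule:
  assumes f: "f \<in> carrier R" and T: "submodule T R M"
  shows "submodule {x \<in> carrier M. \<forall>e. P e \<longrightarrow> (\<forall>r\<in>carrier R. cartier_act R M \<kappa> f n e r x \<in> T)} R M"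
proof (rule submodule_intro)
  show "a \<odot>\<^bsub>M\<^esub> x \<in> {x \<in> carrier M. \<forall>e. P e \<longrightarrow> (\<forall>r\<in>carrier R. cartier_act R M \<kappa> f n e r x \<in> T)}"
    if "a \<in> carrier R" "x \<in> {x \<in> carrier M. \<forall>e. P e \<longrightarrow> (\<forall>r\<in>carrier R. cartier_act R M \<kappa> f n e r x \<in> T)}" for a x
    using that f by (auto simp: act_smult)
qed (use f submodule_zero[OF T] submoduleE(5)[OF T] in \<open>auto simp: act_zero act_add\<close>)

text \<open>
  Homogeneous elements compose, so an element that all of them send into \<open>T\<close> is sent by each of them to
  another such element. This is what turns a mere submodule \<open>T\<close> of \<open>\<sigma>\<close> into a candidate for the test
  module.
\<close>

lemma largest_C_submodule:
  assumes n: "cartier_exponent q n" and f: "f \<in> carrier R" and T: "submodule T R M"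
  shows "C_submodule R M (cartier_act R M \<kappa> f n)
      {x \<in> carrier M. \<forall>e. \<forall>r\<in>carrier R. cartier_act R M \<kappa> f n e r x \<in> T}" (is "C_submodule R M _ ?N")
    and "{x \<in> carrier M. \<forall>e. \<forall>r\<in>carrier R. cartier_act R M \<kappa> f n e r x \<in> T} \<subseteq> T"
proof -
  have "submodule ?N R M"
    using act_preimage_submodule[OF f T, of "\<lambda>_. True" n] by simp
  moreover have "cartier_act R M \<kappa> f n e r x \<in> ?N" if "r \<in> carrier R" "x \<in> ?N" for e r x
  proof -
    have "cartier_act R M \<kappa> f n e' r' (cartier_act R M \<kappa> f n e r x) \<in> T" if "r' \<in> carrier R" for e' r'
      using act_compose[OF n f that \<open>r \<in> carrier R\<close>, of x e' e] \<open>x \<in> ?N\<close> by (metis (mono_tags, lifting) mem_Collect_eq)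
    then show ?thesis
      using that f by auto
  qed
  ultimately show "C_submodule R M (cartier_act R M \<kappa> f n) ?N"
    unfolding C_submodule_def by blast
  show "?N \<subseteq> T"
  proof
    fix x assume x: "x \<in> ?N"
    then have "cartier_act R M \<kappa> f n 0 \<one> x \<in> T"
      by blast
    then show "x \<in> T"
      using x n act_degree_0[of n x f] unfolding cartier_exponent_def by simp
  qed
qed

end

section \<open>Nilpotency of quotients\<close>

context module
begin

text \<open>
  An additive map that preserves \<open>L\<close> acts on cosets through representatives. This covers both scalar
  multiplication and the Cartier algebra action on the quotient.
\<close>

lemma coset_additive_image:
  assumes L: "submodule L R M" and x: "x \<in> carrier M"
    and g: "\<And>y. y \<in> carrier M \<Longrightarrow> g y \<in> carrier M" "\<And>y. y \<in> L \<Longrightarrow> g y \<in> L"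
      "\<And>y z. y \<in> carrier M \<Longrightarrow> z \<in> carrier M \<Longrightarrow> g (y \<oplus>\<^bsub>M\<^esub> z) = g y \<oplus>\<^bsub>M\<^esub> g z"
  shows "set_add M L (g ` (L +>\<^bsub>M\<^esub> x)) = L +>\<^bsub>M\<^esub> g x"
proof
  note LM = submoduleE(1)[OF L]
  show "set_add M L (g ` (L +>\<^bsub>M\<^esub> x)) \<subseteq> L +>\<^bsub>M\<^esub> g x"
  proof
    fix z assume "z \<in> set_add M L (g ` (L +>\<^bsub>M\<^esub> x))"
    then obtain h h' where h: "h \<in> L" "h' \<in> L" "z = h \<oplus>\<^bsub>M\<^esub> g (h' \<oplus>\<^bsub>M\<^esub> x)"
      unfolding set_add_def' a_r_coset_def' by blast
    then have "z = (h \<oplus>\<^bsub>M\<^esub> g h') \<oplus>\<^bsub>M\<^esub> g x"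
      using LM x g by (simp add: M.a_assoc subset_iff)
    then show "z \<in> L +>\<^bsub>M\<^esub> g x"
      unfolding a_r_coset_def' using h g(2) submoduleE(5)[OF L] by blast
  qed
  show "L +>\<^bsub>M\<^esub> g x \<subseteq> set_add M L (g ` (L +>\<^bsub>M\<^esub> x))"
  proof
    fix z assume "z \<in> L +>\<^bsub>M\<^esub> g x"
    then obtain h where h: "h \<in> L" "z = h \<oplus>\<^bsub>M\<^esub> g (\<zero>\<^bsub>M\<^esub> \<oplus>\<^bsub>M\<^esub> x)"
      using x unfolding a_r_coset_def' by auto
    then show "z \<in> set_add M L (g ` (L +>\<^bsub>M\<^esub> x))"
      unfolding set_add_def' a_r_coset_def' using submodule_zero[OF L] by blast
  qed
qed

lemma submodule_abelian_subgroup: "submodule L R M \<Longrightarrow> abelian_subgroup L M"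
  by (intro abelian_subgroupI3 additive_subgroupI submodule.axioms(1) M.abelian_group_axioms)

lemma quot_module_carrier: "carrier (quot_module M L) = {L +>\<^bsub>M\<^esub> x | x. x \<in> carrier M}"
  by (auto simp: quot_module_def A_RCOSETS_def')

lemma quot_module_add:
  "submodule L R M \<Longrightarrow> x \<in> carrier M \<Longrightarrow> y \<in> carrier M \<Longrightarrow>
    (L +>\<^bsub>M\<^esub> x) \<oplus>\<^bsub>quot_module M L\<^esub> (L +>\<^bsub>M\<^esub> y) = L +>\<^bsub>M\<^esub> (x \<oplus>\<^bsub>M\<^esub> y)"
  using abelian_subgroup.a_rcos_sum[OF submodule_abelian_subgroup] by (simp add: quot_module_def)

lemma quot_module_smult:
  "submodule L R M \<Longrightarrow> r \<in> carrier R \<Longrightarrow> x \<in> carrier M \<Longrightarrow>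
    r \<odot>\<^bsub>quot_module M L\<^esub> (L +>\<^bsub>M\<^esub> x) = L +>\<^bsub>M\<^esub> (r \<odot>\<^bsub>M\<^esub> x)"
  using coset_additive_image[of L x "\<lambda>x. r \<odot>\<^bsub>M\<^esub> x"]
  by (simp add: quot_module_def submoduleE(4) smult_r_distr)

lemma coset_eq_zero_iff:
  assumes L: "submodule L R M" and x: "x \<in> carrier M"
  shows "L +>\<^bsub>M\<^esub> x = L \<longleftrightarrow> x \<in> L"
  using abelian_subgroup.a_rcos_const[OF submodule_abelian_subgroup[OF L]]
    abelian_subgroup.a_rcos_self[OF submodule_abelian_subgroup[OF L] x] by metis

lemma quot_module_zero: "submodule L R M \<Longrightarrow> \<zero>\<^bsub>quot_module M L\<^esub> = L +>\<^bsub>M\<^esub> \<zero>\<^bsub>M\<^esub>"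
  using coset_eq_zero_iff[of L "\<zero>\<^bsub>M\<^esub>"] submodule_zero by (simp add: quot_module_def)

lemma quot_module_module:
  assumes L: "submodule L R M"
  shows "module R (quot_module M L)"
proof -
  let ?Q = "quot_module M L"
  note simps = quot_module_add[OF L] quot_module_smult[OF L] quot_module_zero[OF L]
  have cases: thesis if "X \<in> carrier ?Q" "\<And>x. x \<in> carrier M \<Longrightarrow> X = L +>\<^bsub>M\<^esub> x \<Longrightarrow> thesis" for X thesis
    using that unfolding quot_module_carrier by blast
  have in_carrier: "L +>\<^bsub>M\<^esub> x \<in> carrier ?Q" if "x \<in> carrier M" for x
    using that unfolding quot_module_carrier by blast
  have "abelian_group ?Q"
  proof (rule abelian_groupI)
    fix X assume "X \<in> carrier ?Q"
    then show "\<exists>Y\<in>carrier ?Q. Y \<oplus>\<^bsub>?Q\<^esub> X = \<zero>\<^bsub>?Q\<^esub>"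
    proof (rule cases)
      fix x assume "x \<in> carrier M" "X = L +>\<^bsub>M\<^esub> x"
      then show ?thesis
        by (intro bexI[of _ "L +>\<^bsub>M\<^esub> (\<ominus>\<^bsub>M\<^esub> x)"] in_carrier) (simp_all add: simps M.l_neg)
    qed
  qed (auto elim!: cases simp: simps M.a_ac intro!: in_carrier)
  then show ?thesis
    by (intro moduleI R.is_cring)
      (auto elim!: cases simp: simps smult_l_distr smult_r_distr smult_assoc1 intro!: in_carrier)
qed

end

context q_linear
begin

lemma quot_act_coset:
  assumes f: "f \<in> carrier R" and L: "C_submodule R M (cartier_act R M \<kappa> f n) L"
    and r: "r \<in> carrier R" and x: "x \<in> carrier M"
  shows "quot_act M L (cartier_act R M \<kappa> f n) e r (L +>\<^bsub>M\<^esub> x) = L +>\<^bsub>M\<^esub> cartier_act R M \<kappa> f n e r x"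
  unfolding quot_act_def
  by (rule coset_additive_image[OF C_submodule_submodule[OF L] x])
    (use f r in \<open>auto simp: act_add C_submodule_act[OF L]\<close>)

text \<open>Every composite of \<open>a\<close> elements of positive degree factors through \<open>\<kappa>\<^sup>a\<close>.\<close>

lemma quotient_nilpotent:
  assumes f: "f \<in> carrier R" and L: "C_submodule R M (cartier_act R M \<kappa> f n) L"
    and a: "(\<kappa> ^^ a) ` carrier M \<subseteq> L"
  shows "C_nilpotent R (quot_module M L) (quot_act M L (cartier_act R M \<kappa> f n))"
proof -
  let ?Q = "quot_module M L" and ?act = "cartier_act R M \<kappa> f n"
  let ?K = "\<lambda>j. {L +>\<^bsub>M\<^esub> x | x. x \<in> (\<kappa> ^^ j) ` carrier M}"
  have Ls: "submodule L R M"
    by (rule C_submodule_submodule[OF L])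
  interpret Q: module R ?Q
    by (rule quot_module_module[OF Ls])
  note simps = quot_module_add[OF Ls] quot_module_smult[OF Ls] quot_module_zero[OF Ls]
  have K: "submodule (?K j) R ?Q" for j
  proof -
    have I: "submodule ((\<kappa> ^^ j) ` carrier M) R M"
      by (rule iter_image_submodule[OF carrier_is_submodule])
    note IM = submoduleE(1)[OF I] and Iz = submodule_zero[OF I] and Ia = submoduleE(5)[OF I] and Is = submoduleE(4)[OF I]
    show ?thesis
    proof (rule Q.submodule_intro)
      show "?K j \<subseteq> carrier ?Q"
        unfolding quot_module_carrier using IM by blast
      show "\<zero>\<^bsub>?Q\<^esub> \<in> ?K j"
        unfolding simps using Iz by blast
      fix X assume "X \<in> ?K j"
      then obtain x where x: "x \<in> (\<kappa> ^^ j) ` carrier M" "X = L +>\<^bsub>M\<^esub> x"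
        by blast
      have xM: "x \<in> carrier M"
        using x(1) IM by blast
      show "X \<oplus>\<^bsub>?Q\<^esub> Y \<in> ?K j" if "Y \<in> ?K j" for Y
      proof -
        obtain y where y: "y \<in> (\<kappa> ^^ j) ` carrier M" "Y = L +>\<^bsub>M\<^esub> y"
          using \<open>Y \<in> ?K j\<close> by blast
        have "X \<oplus>\<^bsub>?Q\<^esub> Y = L +>\<^bsub>M\<^esub> (x \<oplus>\<^bsub>M\<^esub> y)"
          using x y xM IM by (simp add: simps subset_iff)
        then show ?thesis
          using Ia[OF x(1) y(1)] by blast
      qed
      show "r \<odot>\<^bsub>?Q\<^esub> X \<in> ?K j" if r: "r \<in> carrier R" for r
      proof -
        have "r \<odot>\<^bsub>?Q\<^esub> X = L +>\<^bsub>M\<^esub> (r \<odot>\<^bsub>M\<^esub> x)"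
          using x xM r by (simp add: simps)
        then show ?thesis
          using Is[OF r x(1)] by blast
      qed
    qed
  qed
  have sub: "C_plus_pow R ?Q (quot_act M L ?act) j \<subseteq> ?K j" for j
  proof (induction j)
    case 0
    show ?case
      unfolding C_plus_pow_def quot_module_carrier by auto
  next
    case (Suc j)
    have "quot_act M L ?act e r X \<in> ?K (Suc j)" if e: "1 \<le> e" and r: "r \<in> carrier R" and X: "X \<in> ?K j" for e r X
    proof -
      obtain y where y: "y \<in> carrier M" "X = L +>\<^bsub>M\<^esub> (\<kappa> ^^ j) y"
        using X by blast
      define c where "c = (f [^] n e \<otimes> r) [^] (q ^ j)"
      have c: "c \<in> carrier R"
        unfolding c_def using f r by simp
      have "?act e r ((\<kappa> ^^ j) y) = (\<kappa> ^^ (e + j)) (c \<odot>\<^bsub>M\<^esub> y)"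
        unfolding cartier_act_def c_def using f r y by (simp add: iter_smult_iter)
      also have "e + j = Suc j + (e - 1)"
        using e by simp
      also have "(\<kappa> ^^ (Suc j + (e - 1))) (c \<odot>\<^bsub>M\<^esub> y) = (\<kappa> ^^ Suc j) ((\<kappa> ^^ (e - 1)) (c \<odot>\<^bsub>M\<^esub> y))"
        by (simp only: funpow_add o_apply)
      finally have "?act e r ((\<kappa> ^^ j) y) \<in> (\<kappa> ^^ Suc j) ` carrier M"
        using c y by blast
      moreover have "quot_act M L ?act e r X = L +>\<^bsub>M\<^esub> ?act e r ((\<kappa> ^^ j) y)"
        unfolding y(2) using y by (intro quot_act_coset f L r) auto
      ultimately show ?thesis by blast
    qed
    then have "C_plus R ?Q (quot_act M L ?act) (C_plus_pow R ?Q (quot_act M L ?act) j) \<subseteq> ?K (Suc j)"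
      unfolding C_plus_def using Suc.IH by (intro Q.mod_span_least[OF K]) blast
    then show ?case
      by (simp add: C_plus_pow_def)
  qed
  have "?K a \<subseteq> {\<zero>\<^bsub>?Q\<^esub>}"
  proof clarify
    fix x assume "x \<in> carrier M"
    then show "L +>\<^bsub>M\<^esub> (\<kappa> ^^ a) x = \<zero>\<^bsub>?Q\<^esub>"
      using a coset_eq_zero_iff[OF Ls, of "(\<kappa> ^^ a) x"] by (simp add: quot_module_def image_subset_iff)
  qed
  moreover have "\<zero>\<^bsub>?Q\<^esub> \<in> C_plus_pow R ?Q (quot_act M L ?act) a"
  proof (cases a)
    case 0
    then show ?thesis
      by (simp add: C_plus_pow_def)
  next
    case (Suc j)
    then show ?thesis
      by (auto simp: C_plus_pow_def C_plus_def mod_span_def intro: Q.submodule_zero)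
  qed
  ultimately show ?thesis
    unfolding C_nilpotent_def using sub[of a] by blast
qed

text \<open>
  Conversely, \<open>C\<^sub>+\<^sup>a\<close> contains \<open>f\<^sup>c \<kappa>\<^sup>a\<close> for some \<open>c\<close>: in \<open>\<kappa> f\<^sup>n\<^sup>(\<^sup>1\<^sup>) f\<^sup>b\<close>, choose \<open>b\<close> so that \<open>n(1) + b\<close> is a
  multiple of \<open>q\<close>, and pull the power of \<open>f\<close> out of \<open>\<kappa>\<close>.
\<close>

lemma iter_image_of_quotient_nilpotent:
  assumes f: "f \<in> carrier R" and L: "C_submodule R M (cartier_act R M \<kappa> f n) L"
    and nil: "C_nilpotent R (quot_module M L) (quot_act M L (cartier_act R M \<kappa> f n))"
  obtains a c where "\<And>x. x \<in> carrier M \<Longrightarrow> (f [^] (c :: nat)) \<odot>\<^bsub>M\<^esub> (\<kappa> ^^ a) x \<in> L"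
proof -
  let ?Q = "quot_module M L" and ?act = "cartier_act R M \<kappa> f n"
  have Ls: "submodule L R M"
    by (rule C_submodule_submodule[OF L])
  interpret Q: module R ?Q
    by (rule quot_module_module[OF Ls])
  have ex: "\<exists>c :: nat. \<forall>x\<in>carrier M. L +>\<^bsub>M\<^esub> ((f [^] c) \<odot>\<^bsub>M\<^esub> (\<kappa> ^^ j) x) \<in> C_plus_pow R ?Q (quot_act M L ?act) j" for j
  proof (induction j)
    case 0
    show ?case
      by (rule exI[of _ 0]) (auto simp: C_plus_pow_def quot_module_carrier)
  next
    case (Suc j)
    then obtain c :: nat where c: "\<And>x. x \<in> carrier M \<Longrightarrow>
        L +>\<^bsub>M\<^esub> ((f [^] c) \<odot>\<^bsub>M\<^esub> (\<kappa> ^^ j) x) \<in> C_plus_pow R ?Q (quot_act M L ?act) j"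
      by blast
    have "L +>\<^bsub>M\<^esub> ((f [^] (n 1 + c)) \<odot>\<^bsub>M\<^esub> (\<kappa> ^^ Suc j) x) \<in> C_plus_pow R ?Q (quot_act M L ?act) (Suc j)"
      if x: "x \<in> carrier M" for x
    proof -
      define b where "b = (q - 1) * (n 1 + c)"
      have "n 1 + b + c = (n 1 + c) * q"
        unfolding b_def using q_pos by (cases q) (auto simp: algebra_simps)
      then have "f [^] n 1 \<otimes> f [^] b \<otimes> f [^] c = (f [^] (n 1 + c)) [^] q"
        using f by (simp add: R.nat_pow_mult R.nat_pow_pow)
      then have "?act 1 (f [^] b) ((f [^] c) \<odot>\<^bsub>M\<^esub> (\<kappa> ^^ j) x) = (f [^] (n 1 + c)) \<odot>\<^bsub>M\<^esub> (\<kappa> ^^ Suc j) x"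
        unfolding cartier_act_def using f x by (simp add: smult_assoc1[symmetric] \<kappa>_smult)
      then have "quot_act M L ?act 1 (f [^] b) (L +>\<^bsub>M\<^esub> ((f [^] c) \<odot>\<^bsub>M\<^esub> (\<kappa> ^^ j) x))
        = L +>\<^bsub>M\<^esub> ((f [^] (n 1 + c)) \<odot>\<^bsub>M\<^esub> (\<kappa> ^^ Suc j) x)"
        using quot_act_coset[OF f L, of "f [^] b" "(f [^] c) \<odot>\<^bsub>M\<^esub> (\<kappa> ^^ j) x" 1] f x by simp
      then have "L +>\<^bsub>M\<^esub> ((f [^] (n 1 + c)) \<odot>\<^bsub>M\<^esub> (\<kappa> ^^ Suc j) x)
        \<in> {quot_act M L ?act e r X | e r X. 1 \<le> e \<and> r \<in> carrier R \<and> X \<in> C_plus_pow R ?Q (quot_act M L ?act) j}"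
        using c[OF x] f by (intro CollectI exI[of _ 1] exI[of _ "f [^] b"] exI[of _ "L +>\<^bsub>M\<^esub> ((f [^] c) \<odot>\<^bsub>M\<^esub> (\<kappa> ^^ j) x)"]) auto
      then have "L +>\<^bsub>M\<^esub> ((f [^] (n 1 + c)) \<odot>\<^bsub>M\<^esub> (\<kappa> ^^ Suc j) x)
        \<in> C_plus R ?Q (quot_act M L ?act) (C_plus_pow R ?Q (quot_act M L ?act) j)"
        unfolding C_plus_def by (rule subsetD[OF Q.mod_span_incl])
      then show ?thesis
        by (simp add: C_plus_pow_def)
    qed
    then show ?case by blast
  qed
  obtain a where a: "C_plus_pow R ?Q (quot_act M L ?act) a = {\<zero>\<^bsub>?Q\<^esub>}"
    using nil unfolding C_nilpotent_def by blast
  obtain c :: nat where c: "\<And>x. x \<in> carrier M \<Longrightarrow> L +>\<^bsub>M\<^esub> ((f [^] c) \<odot>\<^bsub>M\<^esub> (\<kappa> ^^ a) x) \<in> {L}"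
    using ex[of a] unfolding a by (auto simp: quot_module_def)
  show thesis
  proof (rule that[of c a])
    show "(f [^] c) \<odot>\<^bsub>M\<^esub> (\<kappa> ^^ a) x \<in> L" if "x \<in> carrier M" for x
      using c[OF that] coset_eq_zero_iff[OF Ls, of "(f [^] c) \<odot>\<^bsub>M\<^esub> (\<kappa> ^^ a) x"] that f by auto
  qed
qed

end

section \<open>The local condition on candidates for the test module\<close>

context module
begin

lemma ideal_power_ideal: "ideal \<eta> R \<Longrightarrow> ideal (ideal_power R \<eta> n) R"
  unfolding ideal_power_def
  by (induction n) (auto intro: R.ideal_prod_is_ideal R.oneideal)

lemma ideal_power_antimono:
  assumes "ideal \<eta> R" "m \<le> n"
  shows "ideal_power R \<eta> n \<subseteq> ideal_power R \<eta> m"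
proof -
  have "ideal_power R \<eta> (Suc n) \<subseteq> ideal_power R \<eta> n" for n
    using R.ideal_prod_inter[OF assms(1) ideal_power_ideal[OF assms(1), of n]] unfolding ideal_power_def by auto
  then show ?thesis
    using lift_Suc_antimono_le[of "ideal_power R \<eta>", OF _ assms(2)] by blast
qed

lemma local_cohomology0_Int:
  "N \<subseteq> carrier M \<Longrightarrow> local_cohomology0 R M \<eta> N = N \<inter> local_cohomology0 R M \<eta> (carrier M)"
  unfolding local_cohomology0_def by blast

lemma local_cohomology0_submodule:
  assumes \<eta>: "ideal \<eta> R" and N: "submodule N R M"
  shows "submodule (local_cohomology0 R M \<eta> N) R M"
proof (rule submodule_intro)
  note NM = submoduleE(1)[OF N]
  have powR: "r \<in> carrier R" if "r \<in> ideal_power R \<eta> n" for r n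
    using ideal.Icarr[OF ideal_power_ideal[OF \<eta>] that] .
  show "local_cohomology0 R M \<eta> N \<subseteq> carrier M"
    unfolding local_cohomology0_def using NM by blast
  show "\<zero>\<^bsub>M\<^esub> \<in> local_cohomology0 R M \<eta> N"
    unfolding local_cohomology0_def using submodule_zero[OF N] powR by fastforce
  show "x \<oplus>\<^bsub>M\<^esub> y \<in> local_cohomology0 R M \<eta> N" if xy: "x \<in> local_cohomology0 R M \<eta> N" "y \<in> local_cohomology0 R M \<eta> N" for x y
  proof -
    obtain m n where mn: "\<And>r. r \<in> ideal_power R \<eta> m \<Longrightarrow> r \<odot>\<^bsub>M\<^esub> x = \<zero>\<^bsub>M\<^esub>" "\<And>r. r \<in> ideal_power R \<eta> n \<Longrightarrow> r \<odot>\<^bsub>M\<^esub> y = \<zero>\<^bsub>M\<^esub>"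
      and N': "x \<in> N" "y \<in> N"
      using xy unfolding local_cohomology0_def by blast
    have "r \<odot>\<^bsub>M\<^esub> (x \<oplus>\<^bsub>M\<^esub> y) = \<zero>\<^bsub>M\<^esub>" if r: "r \<in> ideal_power R \<eta> (max m n)" for r
    proof -
      have "r \<in> ideal_power R \<eta> m" "r \<in> ideal_power R \<eta> n"
        using r ideal_power_antimono[OF \<eta>, of m "max m n"] ideal_power_antimono[OF \<eta>, of n "max m n"] by auto
      then show ?thesis
        using mn N' NM powR[OF r] by (simp add: smult_r_distr subset_iff)
    qed
    then show ?thesis
      unfolding local_cohomology0_def using N' submoduleE(5)[OF N] by blast
  qed
  show "a \<odot>\<^bsub>M\<^esub> x \<in> local_cohomology0 R M \<eta> N" if ax: "a \<in> carrier R" "x \<in> local_cohomology0 R M \<eta> N" for a x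
  proof -
    obtain n where n: "\<And>r. r \<in> ideal_power R \<eta> n \<Longrightarrow> r \<odot>\<^bsub>M\<^esub> x = \<zero>\<^bsub>M\<^esub>" and N': "x \<in> N"
      using ax unfolding local_cohomology0_def by blast
    have "r \<odot>\<^bsub>M\<^esub> (a \<odot>\<^bsub>M\<^esub> x) = \<zero>\<^bsub>M\<^esub>" if r: "r \<in> ideal_power R \<eta> n" for r
      using smult_comm[OF powR[OF r] ax(1), of x] n[OF r] N' NM ax(1) by auto
    then show ?thesis
      unfolding local_cohomology0_def using N' submoduleE(4)[OF N ax(1)] by blast
  qed
qed

end

lemma (in q_linear) local_cohomology0_\<kappa>:
  assumes \<eta>: "ideal \<eta> R" and x: "x \<in> local_cohomology0 R M \<eta> (carrier M)"
  shows "\<kappa> x \<in> local_cohomology0 R M \<eta> (carrier M)"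
proof -
  obtain n where n: "\<And>r. r \<in> ideal_power R \<eta> n \<Longrightarrow> r \<odot>\<^bsub>M\<^esub> x = \<zero>\<^bsub>M\<^esub>" and xM: "x \<in> carrier M"
    using x unfolding local_cohomology0_def by blast
  interpret J: ideal "ideal_power R \<eta> n" R
    by (rule ideal_power_ideal[OF \<eta>])
  have "r \<odot>\<^bsub>M\<^esub> \<kappa> x = \<zero>\<^bsub>M\<^esub>" if r: "r \<in> ideal_power R \<eta> n" for r
  proof -
    have "r [^] q = r [^] (q - 1) \<otimes> r"
      using q_pos by (metis R.nat_pow_Suc Suc_diff_1)
    then have "r [^] q \<in> ideal_power R \<eta> n"
      using J.I_l_closed[OF r] J.Icarr[OF r] by simp
    then have "\<kappa> ((r [^] q) \<odot>\<^bsub>M\<^esub> x) = \<zero>\<^bsub>M\<^esub>"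
      using n by simp
    then show ?thesis
      using \<kappa>_smult[of r x] J.Icarr[OF r] xM by simp
  qed
  then show ?thesis
    unfolding local_cohomology0_def using xM by blast
qed

lemma (in q_linear) local_cohomology0_iter:
  assumes "ideal \<eta> R" "x \<in> local_cohomology0 R M \<eta> (carrier M)"
  shows "(\<kappa> ^^ e) x \<in> local_cohomology0 R M \<eta> (carrier M)"
  using assms by (induction e) (auto intro: local_cohomology0_\<kappa>)

lemma (in q_linear) local_cohomology0_act:
  assumes "ideal \<eta> R" "x \<in> local_cohomology0 R M \<eta> (carrier M)" "f \<in> carrier R" "r \<in> carrier R"
  shows "cartier_act R M \<kappa> f n e r x \<in> local_cohomology0 R M \<eta> (carrier M)"
  unfolding cartier_act_def
  using assms submoduleE(4)[OF local_cohomology0_submodule[OF assms(1) carrier_is_submodule]]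
  by (intro local_cohomology0_iter) auto

lemma (in cring) prime_complement_localization:
  assumes "primeideal \<eta> R" "module R M"
  shows "localization R M (carrier R - \<eta>)"
proof -
  interpret \<eta>: primeideal \<eta> R by fact
  have "\<one> \<notin> \<eta>"
    using \<eta>.I_notcarr \<eta>.one_imp_carrier by blast
  then show ?thesis
    using \<eta>.I_prime by (intro localization.intro localization_axioms.intro assms(2)) auto
qed

lemma cartier_act_carrier_update: "cartier_act R (M\<lparr>carrier := H\<rparr>) = cartier_act R M"
  by (intro ext) (simp add: cartier_act_def)

context q_linear_localization
begin

lemma loc_act_frac:
  assumes [simp]: "f \<in> carrier R" "a \<in> carrier R" "t \<in> S" "m \<in> carrier M" "s \<in> S"
  shows "cartier_act RS MS \<kappa>S (loc_elem R S f) n e (frR a t) (fr m s)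
    = fr (cartier_act R M \<kappa> f n e ((t \<otimes> s) [^] (q ^ e - 1) \<otimes> a) m) (t \<otimes> s)"
proof -
  have "((t \<otimes> s) [^] (q ^ e - 1)) \<odot>\<^bsub>M\<^esub> ((f [^] n e \<otimes> a) \<odot>\<^bsub>M\<^esub> m) = (f [^] n e \<otimes> ((t \<otimes> s) [^] (q ^ e - 1) \<otimes> a)) \<odot>\<^bsub>M\<^esub> m"
    by (simp add: smult_assoc1[symmetric] R.m_ac)
  then show ?thesis
    unfolding cartier_act_def loc_elem_def
    by (simp add: loc_ring_pow loc_ring_mult loc_smult loc_cartier_iter)
qed

end

context q_linear
begin

text \<open>
  Whether a \<open>C\<close>-submodule \<open>N\<close> satisfies the local condition at a prime \<open>\<eta>\<close> not containing \<open>f\<close> depends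
  neither on the exponents nor on \<open>f\<close>, which becomes a unit: some power of \<open>\<kappa>\<close> must map
  \<open>H\<^sup>0\<^sub>\<eta>(M)\<close> into \<open>N\<close> locally at \<open>\<eta>\<close>.
\<close>

lemma nil_isomorphism_local_iff:
  fixes \<eta> N f n
  defines "S \<equiv> carrier R - \<eta>"
  defines "MS \<equiv> loc_module R S M"
  defines "act \<equiv> cartier_act (loc_ring R S) MS (loc_cartier R S q M \<kappa>) (loc_elem R S f) n"
  assumes \<eta>: "primeideal \<eta> R" and f: "f \<in> carrier R" "f \<notin> \<eta>"
    and N: "C_submodule R M (cartier_act R M \<kappa> f n) N"
  shows "nil_isomorphism (loc_ring R S)
      (MS\<lparr>carrier := loc_set R S M (local_cohomology0 R M \<eta> N)\<rparr>) act
      (MS\<lparr>carrier := loc_set R S M (local_cohomology0 R M \<eta> (carrier M))\<rparr>) act (\<lambda>x. x)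
    \<longleftrightarrow> (\<exists>a. \<forall>x\<in>local_cohomology0 R M \<eta> (carrier M). \<exists>u\<in>S. u \<odot>\<^bsub>M\<^esub> (\<kappa> ^^ a) x \<in> N)"
proof -
  interpret \<eta>: primeideal \<eta> R by fact
  interpret loc: q_linear_localization R M q \<kappa> S
    unfolding S_def
    by (intro q_linear_localization.intro q_linear_axioms R.prime_complement_localization \<eta> module_axioms)
  note Ns = C_submodule_submodule[OF N]
  note \<eta>i = \<eta>.is_ideal
  define H where "H = local_cohomology0 R M \<eta> (carrier M)"
  have Hs: "submodule H R M"
    unfolding H_def by (rule local_cohomology0_submodule[OF \<eta>i carrier_is_submodule])
  have HN: "local_cohomology0 R M \<eta> N = N \<inter> H"
    unfolding H_def by (rule local_cohomology0_Int[OF submoduleE(1)[OF Ns]])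
  have HNs: "submodule (N \<inter> H) R M"
    by (rule submodule_Int[OF Ns Hs])
  note HM = submoduleE(1)[OF Hs]
  have H_iter: "(\<kappa> ^^ e) x \<in> H" if "x \<in> H" for e x
    using that local_cohomology0_iter[OF \<eta>i] unfolding H_def by blast
  define HS where "HS = loc_set R S M H"
  define L where "L = loc_set R S M (N \<inter> H)"
  have HSs: "submodule HS (loc_ring R S) MS"
    unfolding HS_def MS_def by (rule loc.loc_set_submodule[OF Hs])
  have Ls: "submodule L (loc_ring R S) MS"
    unfolding L_def MS_def by (rule loc.loc_set_submodule[OF HNs])
  have LHS: "L \<subseteq> HS"
    unfolding L_def HS_def loc_set_def by blast
  interpret MS: q_linear "loc_ring R S" MS q "loc_cartier R S q M \<kappa>"
    unfolding MS_def by (rule loc.loc_q_linear)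
  have HSM: "HS \<subseteq> carrier MS"
    by (rule MS.submoduleE(1)[OF HSs])
  have HSmod: "module (loc_ring R S) (MS\<lparr>carrier := HS\<rparr>)"
    by (rule submodule.submodule_is_module[OF HSs MS.module_axioms])
  have HS_cases: thesis if "X \<in> HS" "\<And>x s. x \<in> H \<Longrightarrow> s \<in> S \<Longrightarrow> X = frac R S M x s \<Longrightarrow> thesis" for X thesis
    using that unfolding HS_def loc_set_def by blast
  interpret HS: q_linear "loc_ring R S" "MS\<lparr>carrier := HS\<rparr>" q "loc_cartier R S q M \<kappa>"
  proof (intro q_linear.intro[OF HSmod] q_linear_axioms.intro)
    fix X assume X: "X \<in> carrier (MS\<lparr>carrier := HS\<rparr>)"
    show "loc_cartier R S q M \<kappa> X \<in> carrier (MS\<lparr>carrier := HS\<rparr>)"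
    proof (rule HS_cases)
      show "X \<in> HS" using X by simp
      fix x s assume x: "x \<in> H" "s \<in> S" "X = frac R S M x s"
      have "loc_cartier R S q M \<kappa> X = frac R S M (\<kappa> ((s [^] (q - 1)) \<odot>\<^bsub>M\<^esub> x)) s"
        unfolding x(3) using x HM by (intro loc.loc_cartier_frac) auto
      moreover have "\<kappa> ((s [^] (q - 1)) \<odot>\<^bsub>M\<^esub> x) \<in> H"
        using H_iter[of "(s [^] (q - 1)) \<odot>\<^bsub>M\<^esub> x" 1] submoduleE(4)[OF Hs _ x(1)] x(2) by simp
      ultimately show ?thesis
        unfolding HS_def loc_set_def using x(2) by auto
    qed
  qed (use q_pos HSM MS.\<kappa>_add MS.\<kappa>_smult in \<open>simp_all add: subset_iff\<close>)
  let ?fS = "loc_elem R S f"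
  have fS: "?fS = frac R S (regular_module R) f \<one>" and fSc: "?fS \<in> carrier (loc_ring R S)"
    unfolding loc_elem_def using f(1) by auto
  have L_C: "C_submodule (loc_ring R S) (MS\<lparr>carrier := HS\<rparr>)
      (cartier_act (loc_ring R S) (MS\<lparr>carrier := HS\<rparr>) (loc_cartier R S q M \<kappa>) ?fS n) L"
    unfolding C_submodule_def cartier_act_carrier_update
  proof (intro conjI allI ballI)
    show "submodule L (loc_ring R S) (MS\<lparr>carrier := HS\<rparr>)"
      using MS.submoduleE[OF Ls] MS.submodule_zero[OF Ls] LHS by (intro HS.submodule_intro) auto
    fix e A X assume A: "A \<in> carrier (loc_ring R S)" and X: "X \<in> L"
    obtain a t where a: "a \<in> carrier R" "t \<in> S" "A = frac R S (regular_module R) a t"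
      using A by (elim loc.loc_ring_cases) blast
    obtain x s where x: "x \<in> N" "x \<in> H" "s \<in> S" "X = frac R S M x s"
      using X unfolding L_def loc_set_def by blast
    have ts: "t \<otimes> s \<in> S" and c: "(t \<otimes> s) [^] (q ^ e - 1) \<otimes> a \<in> carrier R"
      using a x by auto
    have "cartier_act (loc_ring R S) MS (loc_cartier R S q M \<kappa>) ?fS n e A X
      = frac R S M (cartier_act R M \<kappa> f n e ((t \<otimes> s) [^] (q ^ e - 1) \<otimes> a) x) (t \<otimes> s)"
      unfolding a(3) x(4) MS_def using a x HM f by (intro loc.loc_act_frac) auto
    moreover have "cartier_act R M \<kappa> f n e ((t \<otimes> s) [^] (q ^ e - 1) \<otimes> a) x \<in> N \<inter> H"
      using C_submodule_act[OF N c x(1)] local_cohomology0_act[OF \<eta>i _ f(1) c] x(2) unfolding H_def by blast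
    ultimately show "cartier_act (loc_ring R S) MS (loc_cartier R S q M \<kappa>) ?fS n e A X \<in> L"
      unfolding L_def loc_set_def using ts by blast
  qed
  have "{m \<in> L. m = \<zero>\<^bsub>MS\<^esub>} = {\<zero>\<^bsub>MS\<^esub>}"
    using MS.submodule_zero[OF Ls] by blast
  then have kernel: "C_nilpotent (loc_ring R S) (MS\<lparr>carrier := {m \<in> L. m = \<zero>\<^bsub>MS\<^esub>}\<rparr>) act"
    unfolding C_nilpotent_def by (intro exI[of _ 0]) (simp add: C_plus_pow_def)
  have act: "act = cartier_act (loc_ring R S) (MS\<lparr>carrier := HS\<rparr>) (loc_cartier R S q M \<kappa>) ?fS n"
    unfolding act_def cartier_act_carrier_update ..
  have "nil_isomorphism (loc_ring R S) (MS\<lparr>carrier := L\<rparr>) act (MS\<lparr>carrier := HS\<rparr>) act (\<lambda>x. x)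
    \<longleftrightarrow> C_nilpotent (loc_ring R S) (quot_module (MS\<lparr>carrier := HS\<rparr>) L) (quot_act (MS\<lparr>carrier := HS\<rparr>) L act)"
    unfolding nil_isomorphism_def using kernel by simp
  also have "\<dots> \<longleftrightarrow> (\<exists>a. \<forall>x\<in>H. \<exists>u\<in>S. u \<odot>\<^bsub>M\<^esub> (\<kappa> ^^ a) x \<in> N)"
  proof
    assume nil: "C_nilpotent (loc_ring R S) (quot_module (MS\<lparr>carrier := HS\<rparr>) L) (quot_act (MS\<lparr>carrier := HS\<rparr>) L act)"
    obtain a c where "\<And>X. X \<in> carrier (MS\<lparr>carrier := HS\<rparr>) \<Longrightarrow>
        (?fS [^]\<^bsub>loc_ring R S\<^esub> (c :: nat)) \<odot>\<^bsub>MS\<lparr>carrier := HS\<rparr>\<^esub> (loc_cartier R S q M \<kappa> ^^ a) X \<in> L"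
      using HS.iter_image_of_quotient_nilpotent[OF fSc L_C nil[unfolded act]] by blast
    then have ac: "(?fS [^]\<^bsub>loc_ring R S\<^esub> c) \<odot>\<^bsub>MS\<^esub> (loc_cartier R S q M \<kappa> ^^ a) X \<in> L" if "X \<in> HS" for X
      using that by simp
    have "\<exists>u\<in>S. u \<odot>\<^bsub>M\<^esub> (\<kappa> ^^ a) x \<in> N" if x: "x \<in> H" for x
    proof -
      have xM: "x \<in> carrier M"
        using x HM by blast
      have "frac R S M x \<one> \<in> HS"
        unfolding HS_def loc_set_def using x by blast
      then have "(?fS [^]\<^bsub>loc_ring R S\<^esub> c) \<odot>\<^bsub>MS\<^esub> (loc_cartier R S q M \<kappa> ^^ a) (frac R S M x \<one>) \<in> L"
        by (rule ac)
      then have "frac R S M ((f [^] c) \<odot>\<^bsub>M\<^esub> (\<kappa> ^^ a) x) \<one> \<in> L"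
        using xM f(1) unfolding fS MS_def by (simp add: loc.loc_cartier_iter loc.loc_ring_pow loc.loc_smult)
      then obtain u where u: "u \<in> S" "u \<odot>\<^bsub>M\<^esub> ((f [^] c) \<odot>\<^bsub>M\<^esub> (\<kappa> ^^ a) x) \<in> N"
        using loc.loc_set_iff[OF HNs, of "(f [^] c) \<odot>\<^bsub>M\<^esub> (\<kappa> ^^ a) x" \<one>] xM f(1) unfolding L_def by auto
      have "f \<in> S"
        unfolding S_def using f by blast
      then have "u \<otimes> f [^] c \<in> S"
        using u(1) by blast
      moreover have "(u \<otimes> f [^] c) \<odot>\<^bsub>M\<^esub> (\<kappa> ^^ a) x \<in> N"
        using u xM f(1) by (simp add: smult_assoc1)
      ultimately show ?thesis by blast
    qed
    then show "\<exists>a. \<forall>x\<in>H. \<exists>u\<in>S. u \<odot>\<^bsub>M\<^esub> (\<kappa> ^^ a) x \<in> N"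
      by blast
  next
    assume "\<exists>a. \<forall>x\<in>H. \<exists>u\<in>S. u \<odot>\<^bsub>M\<^esub> (\<kappa> ^^ a) x \<in> N"
    then obtain a where a: "\<And>x. x \<in> H \<Longrightarrow> \<exists>u\<in>S. u \<odot>\<^bsub>M\<^esub> (\<kappa> ^^ a) x \<in> N"
      by blast
    have "(loc_cartier R S q M \<kappa> ^^ a) X \<in> L" if X: "X \<in> HS" for X
      using X
    proof (rule HS_cases)
      fix x s assume x: "x \<in> H" "s \<in> S" "X = frac R S M x s"
      define y where "y = (s [^] (q ^ a - 1)) \<odot>\<^bsub>M\<^esub> x"
      have y: "y \<in> H"
        unfolding y_def using x by (intro submoduleE(4)[OF Hs]) auto
      obtain u where u: "u \<in> S" "u \<odot>\<^bsub>M\<^esub> (\<kappa> ^^ a) y \<in> N"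
        using a[OF y] by blast
      have "u \<odot>\<^bsub>M\<^esub> (\<kappa> ^^ a) y \<in> H"
        using u H_iter[OF y] by (intro submoduleE(4)[OF Hs]) auto
      then have "frac R S M ((\<kappa> ^^ a) y) s \<in> L"
        unfolding L_def using u x y HM by (subst loc.loc_set_iff[OF HNs]) auto
      moreover have "(loc_cartier R S q M \<kappa> ^^ a) X = frac R S M ((\<kappa> ^^ a) y) s"
        unfolding x(3) y_def using x HM by (intro loc.loc_cartier_iter) auto
      ultimately show ?thesis by simp
    qed
    then have "(loc_cartier R S q M \<kappa> ^^ a) ` carrier (MS\<lparr>carrier := HS\<rparr>) \<subseteq> L"
      by auto
    then show "C_nilpotent (loc_ring R S) (quot_module (MS\<lparr>carrier := HS\<rparr>) L) (quot_act (MS\<lparr>carrier := HS\<rparr>) L act)"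
      unfolding act by (rule HS.quotient_nilpotent[OF fSc L_C])
  qed
  finally show ?thesis
    unfolding HN H_def[symmetric] L_def HS_def .
qed

lemma regular_notin_assoc_prime:
  assumes "module_regular R M f" "\<eta> \<in> assoc_primes R M"
  shows "f \<notin> \<eta>"
proof
  assume "f \<in> \<eta>"
  from assms(2) obtain m where \<eta>: "primeideal \<eta> R" "m \<in> carrier M" "\<eta> = annihilator R M m"
    unfolding assoc_primes_def by blast
  then have "m = \<zero>\<^bsub>M\<^esub>"
    using \<open>f \<in> \<eta>\<close> assms(1) unfolding annihilator_def module_regular_def by auto
  then have "\<eta> = carrier R"
    using \<eta>(3) unfolding annihilator_def by auto
  then show False
    using primeideal.I_notcarr[OF \<eta>(1)] by simp
qed

theorem test_candidate_iff:
  assumes f: "module_regular R M f"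
  shows "test_candidate R q M \<kappa> f lam N \<longleftrightarrow>
    C_submodule R M (cartier_act R M \<kappa> f (tau_exponent q lam)) N \<and>
    (\<forall>\<eta>\<in>assoc_primes R M. \<exists>a. \<forall>x\<in>local_cohomology0 R M \<eta> (carrier M).
      \<exists>u\<in>carrier R - \<eta>. u \<odot>\<^bsub>M\<^esub> (\<kappa> ^^ a) x \<in> N)"
proof -
  have "f \<in> carrier R"
    using f unfolding module_regular_def by blast
  moreover have "primeideal \<eta> R" if "\<eta> \<in> assoc_primes R M" for \<eta>
    using that unfolding assoc_primes_def by blast
  ultimately show ?thesis
    unfolding test_candidate_def Let_def
    using nil_isomorphism_local_iff regular_notin_assoc_prime[OF f] by (metis (no_types, lifting))
qed

end

section \<open>Test modules inside non-F-pure modules\<close>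

text \<open>Euler's theorem, applied to the denominator of \<open>\<lambda>\<close>.\<close>

lemma exponent_clearing_denominator:
  fixes lam :: rat
  assumes "prime p" "\<not> int p dvd snd (quotient_of lam)" "lam > 0"
  obtains e a :: nat where "0 < e" "of_nat a = lam * (of_nat (p ^ e) - 1)"
proof -
  obtain num den where nd: "quotient_of lam = (num, den)"
    by fastforce
  have den: "den > 0" and lam: "lam = of_int num / of_int den"
    using quotient_of_denom_pos[OF nd] quotient_of_div[OF nd] by auto
  have num: "num > 0"
    using assms(3) den unfolding lam by (simp add: zero_less_divide_iff)
  define d where "d = nat den"
  have d: "d > 0" "int d = den"
    unfolding d_def using den by auto
  have "\<not> p dvd d"
    using assms(2) nd d(2) by (metis int_dvd_int_iff snd_conv)
  then have "coprime p d"
    using assms(1) by (simp add: prime_imp_coprime)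
  then have "[p ^ totient d = 1] (mod d)"
    by (rule euler_theorem)
  then have "int d dvd int (p ^ totient d) - 1"
    by (metis cong_iff_dvd_diff cong_int_iff of_nat_1)
  then obtain k where k: "int (p ^ totient d) - 1 = den * k"
    unfolding d(2) by blast
  have "int (p ^ totient d) - 1 \<ge> 0"
    using assms(1) by (simp add: prime_gt_0_nat Suc_leI)
  then have "k \<ge> 0"
    unfolding k using den by (simp add: zero_le_mult_iff)
  have "lam * (of_nat (p ^ totient d) - 1) = lam * of_int (int (p ^ totient d) - 1)"
    by simp
  also have "\<dots> = of_int (num * k)"
    unfolding k lam using den by simp
  also have "\<dots> = of_nat (nat (num * k))"
    using num \<open>k \<ge> 0\<close> by simp
  finally show thesis
    using that[of "totient d" "nat (num * k)"] d(1) by simp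
qed

context q_linear
begin

lemma twisted_q_linear:
  assumes "g \<in> carrier R"
  shows "q_linear R M (q ^ e) (\<lambda>x. (\<kappa> ^^ e) (g \<odot>\<^bsub>M\<^esub> x))"
proof (intro q_linear.intro q_linear_axioms.intro module_axioms)
  show "(\<kappa> ^^ e) (g \<odot>\<^bsub>M\<^esub> ((r [^] (q ^ e)) \<odot>\<^bsub>M\<^esub> x)) = r \<odot>\<^bsub>M\<^esub> (\<kappa> ^^ e) (g \<odot>\<^bsub>M\<^esub> x)"
    if "r \<in> carrier R" "x \<in> carrier M" for r x
    using that assms by (simp add: smult_comm[of g] iter_smult)
qed (use q_pos assms in \<open>auto simp: smult_r_distr iter_add\<close>)

text \<open>
  If \<open>a = \<lambda>(q\<^sup>e - 1)\<close> is an integer, then the iterates of \<open>\<phi> = \<kappa>\<^sup>e f\<^sup>a\<close> are the maps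
  \<open>\<kappa>\<^sup>n\<^sup>e f\<^sup>A\<close> with \<open>A = \<lambda>(q\<^sup>n\<^sup>e - 1)\<close>, by summing a geometric series. No rounding occurs.
\<close>

lemma twisted_iterate:
  fixes lam :: rat
  assumes f: "f \<in> carrier R" and a: "of_nat a = lam * (of_nat (q ^ e) - 1)"
  obtains A :: nat where "of_nat A = lam * (of_nat (q ^ (n * e)) - 1)"
    "\<And>x. x \<in> carrier M \<Longrightarrow> ((\<lambda>x. (\<kappa> ^^ e) ((f [^] a) \<odot>\<^bsub>M\<^esub> x)) ^^ n) x = (\<kappa> ^^ (n * e)) ((f [^] A) \<odot>\<^bsub>M\<^esub> x)"
proof -
  let ?\<phi> = "\<lambda>x. (\<kappa> ^^ e) ((f [^] a) \<odot>\<^bsub>M\<^esub> x)"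
  have "\<exists>A :: nat. of_nat A = lam * (of_nat (q ^ (n * e)) - 1) \<and>
    (\<forall>x\<in>carrier M. (?\<phi> ^^ n) x = (\<kappa> ^^ (n * e)) ((f [^] A) \<odot>\<^bsub>M\<^esub> x))"
  proof (induction n)
    case 0
    show ?case by (rule exI[of _ 0]) simp
  next
    case (Suc n)
    then obtain A :: nat where A: "of_nat A = lam * (of_nat (q ^ (n * e)) - 1)"
      "\<And>x. x \<in> carrier M \<Longrightarrow> (?\<phi> ^^ n) x = (\<kappa> ^^ (n * e)) ((f [^] A) \<odot>\<^bsub>M\<^esub> x)"
      by blast
    show ?case
    proof (intro exI[of _ "a * q ^ (n * e) + A"] conjI ballI)
      show "of_nat (a * q ^ (n * e) + A) = lam * (of_nat (q ^ (Suc n * e)) - 1)"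
        by (simp add: A(1) a power_add algebra_simps)
      show "(?\<phi> ^^ Suc n) x = (\<kappa> ^^ (Suc n * e)) ((f [^] (a * q ^ (n * e) + A)) \<odot>\<^bsub>M\<^esub> x)" if x: "x \<in> carrier M" for x
      proof -
        have "(?\<phi> ^^ Suc n) x = (\<kappa> ^^ e) ((f [^] a) \<odot>\<^bsub>M\<^esub> (\<kappa> ^^ (n * e)) ((f [^] A) \<odot>\<^bsub>M\<^esub> x))"
          by (simp add: A(2) x)
        also have "\<dots> = (\<kappa> ^^ (e + n * e)) (((f [^] a) [^] (q ^ (n * e))) \<odot>\<^bsub>M\<^esub> ((f [^] A) \<odot>\<^bsub>M\<^esub> x))"
          using f x by (intro iter_smult_iter) auto
        also have "((f [^] a) [^] (q ^ (n * e))) \<odot>\<^bsub>M\<^esub> ((f [^] A) \<odot>\<^bsub>M\<^esub> x) = (f [^] (a * q ^ (n * e) + A)) \<odot>\<^bsub>M\<^esub> x"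
          using f x by (simp add: R.nat_pow_pow smult_assoc1[symmetric] R.nat_pow_mult)
        finally show ?thesis by simp
      qed
    qed
  qed
  then show thesis
    using that by blast
qed

text \<open>
  The images of \<open>\<phi> = \<kappa>\<^sup>e f\<^sup>a\<close> stabilise at \<open>T = \<phi>\<^sup>n M = \<kappa>\<^sup>d f\<^sup>A M\<close>, and \<open>T \<subseteq> \<sigma>\<close> because \<open>\<phi>\<close> has positive degree. With
  \<open>t = \<lambda> - \<epsilon>\<close>, an element \<open>\<kappa>\<^sup>i\<^sup>+\<^sup>d f\<^sup>B m\<close> lies in \<open>T\<close> as soon as \<open>B \<ge> A q\<^sup>i\<close>, since \<open>f\<^sup>A\<close> can then be moved out of
  \<open>\<kappa>\<^sup>i\<close>. For \<open>B = \<lceil>t q\<^sup>i\<rceil> q\<^sup>d\<close> this follows from \<open>\<lambda>(q\<^sup>d - 1) \<le> t q\<^sup>d\<close>, that is, from \<open>\<epsilon> \<le> \<lambda>/q\<^sup>d\<close>. So the largest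
  \<open>C\<close>-submodule of \<open>T\<close> for the exponent \<open>t\<close> contains \<open>f\<^sup>A \<kappa>\<^sup>d M\<close>, and as \<open>f\<close> is in no associated prime it
  is a candidate for the test module.
\<close>

theorem test_module_subset_sigma:
  fixes lam :: rat
  assumes noeth: "noetherian_ring R" and fg: "fin_gen_module R M" and q: "2 \<le> q"
    and reg: "module_regular R M f"
    and e: "0 < e" and a: "of_nat a = lam * (of_nat (q ^ e) - 1)" and lam: "lam > 0"
  obtains \<epsilon>\<^sub>0 where "0 < \<epsilon>\<^sub>0" "\<epsilon>\<^sub>0 \<le> lam"
    "\<And>\<epsilon>. 0 < \<epsilon> \<Longrightarrow> \<epsilon> < \<epsilon>\<^sub>0 \<Longrightarrow> test_module R q M \<kappa> f (lam - \<epsilon>) \<subseteq> sigma R q M \<kappa> f lam"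
proof -
  have f: "f \<in> carrier R"
    using reg unfolding module_regular_def by blast
  define \<phi> where "\<phi> = (\<lambda>x. (\<kappa> ^^ e) ((f [^] a) \<odot>\<^bsub>M\<^esub> x))"
  interpret \<phi>: q_linear R M "q ^ e" \<phi>
    unfolding \<phi>_def using f by (intro twisted_q_linear) simp
  have "2 \<le> q ^ e"
    using q e self_le_power[of q e] by linarith
  then obtain n0 where n0: "\<And>n. n \<ge> n0 \<Longrightarrow> (\<phi> ^^ n) ` carrier M = (\<phi> ^^ n0) ` carrier M"
    using \<phi>.iter_image_stabilises[OF noeth fg] by blast
  define T where "T = (\<phi> ^^ n0) ` carrier M"
  have Ts: "submodule T R M"
    unfolding T_def by (rule \<phi>.iter_image_submodule[OF carrier_is_submodule])
  define d where "d = n0 * e"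
  obtain A :: nat where A: "of_nat A = lam * (of_nat (q ^ d) - 1)"
    and \<phi>_iter: "\<And>x. x \<in> carrier M \<Longrightarrow> (\<phi> ^^ n0) x = (\<kappa> ^^ d) ((f [^] A) \<odot>\<^bsub>M\<^esub> x)"
    using twisted_iterate[OF f a, of n0] unfolding d_def \<phi>_def by blast
  let ?act\<sigma> = "cartier_act R M \<kappa> f (sigma_exponent q lam)"
  have T_sigma: "T \<subseteq> sigma R q M \<kappa> f lam"
  proof -
    have "sigma_exponent q lam e = a"
      unfolding sigma_exponent_def a[symmetric] by simp
    then have \<phi>_act: "\<phi> x = ?act\<sigma> e \<one> x" for x
      unfolding \<phi>_def cartier_act_def using f by simp
    have images: "(\<phi> ^^ h) ` carrier M \<subseteq> C_plus_pow R M ?act\<sigma> h" for h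
    proof (induction h)
      case 0
      show ?case by (simp add: C_plus_pow_def)
    next
      case (Suc h)
      have "(\<phi> ^^ Suc h) x \<in> C_plus R M ?act\<sigma> (C_plus_pow R M ?act\<sigma> h)" if "x \<in> carrier M" for x
      proof -
        have "(\<phi> ^^ h) x \<in> C_plus_pow R M ?act\<sigma> h"
          using Suc.IH that by blast
        then have "(\<phi> ^^ Suc h) x \<in> {?act\<sigma> e r m | e r m. 1 \<le> e \<and> r \<in> carrier R \<and> m \<in> C_plus_pow R M ?act\<sigma> h}"
          using e by (intro CollectI exI[of _ e] exI[of _ \<one>] exI[of _ "(\<phi> ^^ h) x"]) (simp add: \<phi>_act)
        then show ?thesis
          unfolding C_plus_def by (rule subsetD[OF mod_span_incl])
      qed
      then show ?case
        by (auto simp: C_plus_pow_def)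
    qed
    then show ?thesis
      unfolding sigma_def
    proof (intro subsetI CollectI exI[of _ n0] allI impI)
      fix x h assume "x \<in> T" "n0 \<le> h"
      then have "x \<in> (\<phi> ^^ h) ` carrier M"
        unfolding T_def using n0 by blast
      then show "x \<in> C_plus_pow R M ?act\<sigma> h"
        using images by blast
    qed
  qed
  show thesis
  proof (rule that)
    have "(of_nat 1 :: rat) \<le> of_nat (q ^ d)"
      using q_pos by (subst of_nat_le_iff) (simp add: Suc_leI)
    then have qd1: "(1 :: rat) \<le> of_nat (q ^ d)"
      by (simp only: of_nat_1)
    note qd = less_le_trans[OF zero_less_one qd1]
    show "0 < lam / of_nat (q ^ d)"
      by (rule divide_pos_pos[OF lam qd])
    show "lam / of_nat (q ^ d) \<le> lam"
      unfolding pos_divide_le_eq[OF qd] using mult_left_mono[OF qd1 less_imp_le[OF lam]] by (simp only: mult_1_right)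
    fix \<epsilon> :: rat assume \<epsilon>: "0 < \<epsilon>" "\<epsilon> < lam / of_nat (q ^ d)"
    have \<epsilon>_le: "\<epsilon> * of_nat (q ^ d) \<le> lam"
      using \<epsilon>(2) unfolding pos_less_divide_eq[OF qd] by (rule less_imp_le)
    define n where "n = tau_exponent q (lam - \<epsilon>)"
    have n: "cartier_exponent q n"
      unfolding n_def by (rule cartier_exponent_tau)
    have exponents: "A * q ^ i \<le> (n i + A) * q ^ d" for i
    proof (cases "i = 0")
      case True
      \<comment> \<open>The exponent in degree \<open>0\<close> is \<open>0\<close> instead of \<open>\<lceil>t\<rceil>\<close>; there the factor \<open>f\<^sup>A\<close> is what helps.\<close>
      have "A * q ^ i = A * 1"
        using True by simp
      also have "\<dots> \<le> A * q ^ d"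
        using q_pos by (intro mult_le_mono2) (simp add: Suc_leI)
      also have "\<dots> \<le> (n i + A) * q ^ d"
        by simp
      finally show ?thesis .
    next
      case False
      have "of_nat (A * q ^ i) = (lam * of_nat (q ^ d) - lam) * of_nat (q ^ i)"
        by (simp add: A algebra_simps)
      also have "\<dots> \<le> (lam * of_nat (q ^ d) - \<epsilon> * of_nat (q ^ d)) * of_nat (q ^ i)"
        using \<epsilon>_le by (intro mult_right_mono) auto
      also have "\<dots> = ((lam - \<epsilon>) * of_nat (q ^ i)) * of_nat (q ^ d)"
        by (simp add: algebra_simps)
      also have "\<dots> \<le> of_nat (n i) * of_nat (q ^ d)"
        unfolding n_def tau_exponent_def using False by (intro mult_right_mono) (simp_all add: le_nat_ceiling del: of_nat_power)
      also have "\<dots> \<le> of_nat ((n i + A) * q ^ d)"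
        by (simp add: algebra_simps)
      finally show ?thesis
        by (simp only: of_nat_le_iff)
    qed
    define N where "N = {x \<in> carrier M. \<forall>i. \<forall>r\<in>carrier R. cartier_act R M \<kappa> f n i r x \<in> T}"
    have in_N: "(f [^] A) \<odot>\<^bsub>M\<^esub> (\<kappa> ^^ d) x \<in> N" if x: "x \<in> carrier M" for x
    proof -
      have "cartier_act R M \<kappa> f n i r ((f [^] A) \<odot>\<^bsub>M\<^esub> (\<kappa> ^^ d) x) \<in> T" if r: "r \<in> carrier R" for i r
      proof -
        define B where "B = (n i + A) * q ^ d - A * q ^ i"
        define z where "z = (f [^] B \<otimes> r [^] (q ^ d)) \<odot>\<^bsub>M\<^esub> x"
        have z: "z \<in> carrier M"
          unfolding z_def using f r x by simp
        have "A * q ^ i + B = (n i + A) * q ^ d"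
          unfolding B_def using exponents[of i] by simp
        then have *: "(f [^] A) [^] (q ^ i) \<otimes> f [^] B = (f [^] n i \<otimes> f [^] A) [^] (q ^ d)"
          using f by (simp add: R.nat_pow_pow R.nat_pow_mult)
        have "cartier_act R M \<kappa> f n i r ((f [^] A) \<odot>\<^bsub>M\<^esub> (\<kappa> ^^ d) x)
          = (\<kappa> ^^ i) ((f [^] n i \<otimes> f [^] A \<otimes> r) \<odot>\<^bsub>M\<^esub> (\<kappa> ^^ d) x)"
          unfolding cartier_act_def using f r x by (simp add: smult_assoc1[symmetric] R.m_ac)
        also have "\<dots> = (\<kappa> ^^ (i + d)) (((f [^] n i \<otimes> f [^] A \<otimes> r) [^] (q ^ d)) \<odot>\<^bsub>M\<^esub> x)"
          using f r x by (intro iter_smult_iter) auto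
        also have "(f [^] n i \<otimes> f [^] A \<otimes> r) [^] (q ^ d) = (f [^] A) [^] (q ^ i) \<otimes> f [^] B \<otimes> r [^] (q ^ d)"
          unfolding * using f r by (simp add: R.nat_pow_distrib)
        also have "\<dots> \<odot>\<^bsub>M\<^esub> x = ((f [^] A) [^] (q ^ i)) \<odot>\<^bsub>M\<^esub> z"
          unfolding z_def using f r x by (simp add: smult_assoc1[symmetric] R.m_assoc)
        also have "(\<kappa> ^^ (i + d)) \<dots> = (\<kappa> ^^ d) ((f [^] A) \<odot>\<^bsub>M\<^esub> (\<kappa> ^^ i) z)"
          using f z by (subst iter_smult_iter) (auto simp: add.commute)
        also have "\<dots> = (\<phi> ^^ n0) ((\<kappa> ^^ i) z)"
          using z by (simp add: \<phi>_iter)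
        finally show ?thesis
          unfolding T_def using z by blast
      qed
      then show ?thesis
        unfolding N_def using f x by simp
    qed
    have "test_candidate R q M \<kappa> f (lam - \<epsilon>) N"
      unfolding test_candidate_iff[OF reg]
    proof (intro conjI ballI)
      show "C_submodule R M (cartier_act R M \<kappa> f (tau_exponent q (lam - \<epsilon>))) N"
        using largest_C_submodule(1)[OF n f Ts] unfolding N_def n_def .
      fix \<eta> assume \<eta>: "\<eta> \<in> assoc_primes R M"
      interpret localization R M "carrier R - \<eta>"
        using \<eta> unfolding assoc_primes_def by (auto intro: R.prime_complement_localization module_axioms)
      have "f [^] A \<in> carrier R - \<eta>"
        using regular_notin_assoc_prime[OF reg \<eta>] f by (intro S_pow) simp
      then show "\<exists>a. \<forall>x\<in>local_cohomology0 R M \<eta> (carrier M). \<exists>u\<in>carrier R - \<eta>. u \<odot>\<^bsub>M\<^esub> (\<kappa> ^^ a) x \<in> N"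
        using in_N unfolding local_cohomology0_def by blast
    qed
    then have "test_module R q M \<kappa> f (lam - \<epsilon>) \<subseteq> N"
      unfolding test_module_def by blast
    also have "N \<subseteq> T"
      unfolding N_def by (rule largest_C_submodule(2)[OF n f Ts])
    finally show "test_module R q M \<kappa> f (lam - \<epsilon>) \<subseteq> sigma R q M \<kappa> f lam"
      using T_sigma by blast
  qed
qed

section \<open>Non-F-pure modules inside test modules\<close>

text \<open>
  An element of \<open>C\<^sub>+\<^sup>h M\<close> is a sum of elements \<open>\<kappa>\<^sup>i f\<^sup>s m\<close> with \<open>i \<ge> h\<close> and \<open>s \<ge> \<lambda>(q\<^sup>i - 1)\<close>. For large \<open>i\<close> the
  gap \<open>\<lambda> - t\<close> makes \<open>s \<ge> \<lceil>t q\<^sup>i\<rceil> + b\<close>, so such an element lies in \<open>\<kappa>\<^sup>i f\<^sup>k f\<^sup>b M \<subseteq> \<kappa>\<^sup>i f\<^sup>k N \<subseteq> N\<close> with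
  \<open>k = \<lceil>t q\<^sup>i\<rceil>\<close>. The submodules
  \<open>U\<^sub>j\<close> of those \<open>x\<close> that every element of degree at least \<open>j\<close> sends into \<open>N\<close> carry the degree count:
  \<open>C\<^sub>+\<close> maps \<open>U\<^sub>j\<^sub>+\<^sub>1\<close> into \<open>U\<^sub>j\<close>.
\<close>

lemma sigma_subset_of_power_multiple:
  fixes lam t :: rat
  assumes q: "2 \<le> q" and f: "f \<in> carrier R" and t: "0 \<le> t" "t < lam"
    and N: "C_submodule R M (cartier_act R M \<kappa> f (tau_exponent q t)) N"
    and b: "\<And>m. m \<in> carrier M \<Longrightarrow> (f [^] (b :: nat)) \<odot>\<^bsub>M\<^esub> m \<in> N"
  shows "sigma R q M \<kappa> f lam \<subseteq> N"
proof
  let ?n = "sigma_exponent q lam"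
  let ?act = "cartier_act R M \<kappa> f ?n"
  have n: "cartier_exponent q ?n"
    by (rule cartier_exponent_sigma)
  have Ns: "submodule N R M"
    by (rule C_submodule_submodule[OF N])
  \<comment> \<open>\<open>q\<^sup>i \<ge> i\<close>, so a linear bound on \<open>i\<close> is enough; the summand \<open>1\<close> pays for rounding up \<open>t q\<^sup>i\<close>\<close>
  obtain h1 :: nat where h1: "lam + 1 + of_nat b \<le> of_nat h1 * (lam - t)"
    using ex_less_of_nat_mult[of "lam - t" "lam + 1 + of_nat b"] t by (auto intro: less_imp_le)
  have exponents: "tau_exponent q t i + b \<le> ?n i" if i: "h1 \<le> i" for i
  proof -
    have "i < 2 ^ i"
      by (rule less_exp)
    also have "(2 :: nat) ^ i \<le> q ^ i"
      using q by (intro power_mono) auto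
    finally have "(of_nat h1 :: rat) \<le> of_nat (q ^ i)"
      using i by (subst of_nat_le_iff) simp
    then have "lam + 1 + of_nat b \<le> of_nat (q ^ i) * (lam - t)"
      using h1 t by (meson diff_ge_0_iff_ge less_imp_le mult_right_mono order_trans)
    then have "(t * of_nat (q ^ i) + 1) + of_nat b \<le> lam * (of_nat (q ^ i) - 1)"
      by (simp add: algebra_simps)
    moreover have "of_nat (tau_exponent q t i) \<le> t * of_nat (q ^ i) + 1"
    proof -
      have "of_nat (nat \<lceil>t * of_nat (q ^ i)\<rceil>) = (of_int \<lceil>t * of_nat (q ^ i)\<rceil> :: rat)"
        using t(1) by (simp del: of_nat_power)
      then show ?thesis
        unfolding tau_exponent_def using t(1) ceiling_correct[of "t * of_nat (q ^ i)"] by auto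
    qed
    moreover have "lam * (of_nat (q ^ i) - 1) \<le> of_nat (?n i)"
      unfolding sigma_exponent_def by (rule le_nat_ceiling)
    ultimately have "(of_nat (tau_exponent q t i + b) :: rat) \<le> of_nat (?n i)"
      by simp
    then show ?thesis
      by (simp only: of_nat_le_iff)
  qed
  define U where "U j = {x \<in> carrier M. \<forall>i. j \<le> i \<longrightarrow> (\<forall>r\<in>carrier R. ?act i r x \<in> N)}" for j
  have Us: "submodule (U j) R M" for j
    unfolding U_def by (rule act_preimage_submodule[OF f Ns])
  have U_top: "carrier M \<subseteq> U h" if h: "h1 \<le> h" for h
  proof -
    have "?act i r x \<in> N" if i: "h \<le> i" and r: "r \<in> carrier R" and x: "x \<in> carrier M" for i r x
    proof -
      let ?k = "tau_exponent q t i"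
      define c where "c = f [^] (?n i - ?k - b) \<otimes> r"
      have c: "c \<in> carrier R"
        unfolding c_def using f r by simp
      have "?k + (b + (?n i - ?k - b)) = ?n i"
        using exponents[of i] h i by simp
      then have "f [^] ?n i = f [^] ?k \<otimes> (f [^] b \<otimes> f [^] (?n i - ?k - b))"
        using f by (simp add: R.nat_pow_mult)
      then have "?act i r x = cartier_act R M \<kappa> f (tau_exponent q t) i \<one> ((f [^] b) \<odot>\<^bsub>M\<^esub> (c \<odot>\<^bsub>M\<^esub> x))"
        unfolding cartier_act_def c_def using f r x by (simp add: smult_assoc1[symmetric] R.m_assoc)
      then show ?thesis
        using C_submodule_act[OF N _ b[of "c \<odot>\<^bsub>M\<^esub> x"]] c x by simp
    qed
    then show ?thesis
      unfolding U_def by blast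
  qed
  have U_step: "C_plus R M ?act X \<subseteq> U j" if X: "X \<subseteq> U (Suc j)" for X j
    unfolding C_plus_def
  proof (rule mod_span_least[OF Us], clarify)
    fix i :: nat and r m assume i: "1 \<le> i" and r: "r \<in> carrier R" and m: "m \<in> X"
    have mM: "m \<in> carrier M"
      using m X unfolding U_def by blast
    have "?act i' r' (?act i r m) \<in> N" if i': "j \<le> i'" and r': "r' \<in> carrier R" for i' :: nat and r'
    proof -
      obtain r'' where "r'' \<in> carrier R" "?act i' r' (?act i r m) = ?act (i' + i) r'' m"
        using act_compose[OF n f r' r mM] by blast
      moreover have "Suc j \<le> i' + i"
        using i i' by simp
      ultimately show ?thesis
        using m X unfolding U_def by auto
    qed
    then show "?act i r m \<in> U j"
      unfolding U_def using f r mM by blast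
  qed
  have U_bottom: "U 0 \<subseteq> N"
  proof
    fix x assume x: "x \<in> U 0"
    then have "?act 0 \<one> x \<in> N"
      unfolding U_def by blast
    then show "x \<in> N"
      using x n act_degree_0[of ?n x f] unfolding cartier_exponent_def U_def by simp
  qed
  have chain: "C_plus_pow R M ?act i \<subseteq> U (h - i)" if "h1 \<le> h" "i \<le> h" for i h
    using that(2)
  proof (induction i)
    case 0
    show ?case
      using U_top[OF that(1)] by (simp add: C_plus_pow_def)
  next
    case (Suc i)
    have "C_plus R M ?act (C_plus_pow R M ?act i) \<subseteq> U (h - Suc i)"
      using Suc by (intro U_step) (simp add: Suc_diff_Suc)
    then show ?case
      by (simp add: C_plus_pow_def)
  qed
  fix x assume "x \<in> sigma R q M \<kappa> f lam"
  then obtain h0 where h0: "\<And>h. h \<ge> h0 \<Longrightarrow> x \<in> C_plus_pow R M ?act h"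
    unfolding sigma_def by blast
  have "x \<in> C_plus_pow R M ?act (max h0 h1)"
    by (rule h0) simp
  then show "x \<in> N"
    using chain[of "max h0 h1" "max h0 h1"] U_bottom by auto
qed

lemma regular_power:
  assumes reg: "module_regular R M f" and m: "m \<in> carrier M" and zero: "(f [^] (n :: nat)) \<odot>\<^bsub>M\<^esub> m = \<zero>\<^bsub>M\<^esub>"
  shows "m = \<zero>\<^bsub>M\<^esub>"
  using zero
proof (induction n)
  case (Suc n)
  have f: "f \<in> carrier R"
    using reg unfolding module_regular_def by blast
  have "f \<odot>\<^bsub>M\<^esub> ((f [^] n) \<odot>\<^bsub>M\<^esub> m) = \<zero>\<^bsub>M\<^esub>"
    using Suc.prems f m by (simp add: smult_assoc1[symmetric] R.m_comm)
  then have "(f [^] n) \<odot>\<^bsub>M\<^esub> m = \<zero>\<^bsub>M\<^esub>"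
    using reg f m unfolding module_regular_def by simp
  then show ?case
    by (rule Suc.IH)
qed (use m in simp)

lemma powers_localization:
  assumes f: "f \<in> carrier R"
  shows "q_linear_localization R M q \<kappa> (powers R f)"
proof (intro q_linear_localization.intro localization.intro localization_axioms.intro q_linear_axioms module_axioms)
  show "powers R f \<subseteq> carrier R"
    unfolding powers_def using f by auto
  show "\<one> \<in> powers R f"
    unfolding powers_def by (rule range_eqI[of _ _ 0]) simp
  fix s t assume "s \<in> powers R f" "t \<in> powers R f"
  then obtain i j :: nat where "s = f [^] i" "t = f [^] j"
    unfolding powers_def by blast
  then show "s \<otimes> t \<in> powers R f"
    unfolding powers_def using f by (intro range_eqI[of _ _ "i + j"]) (simp add: R.nat_pow_mult)
qed

end

context q_linear_localization
begin

lemma ideal_power_localization: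
  assumes \<eta>: "ideal \<eta> R" and incl: "\<And>r. r \<in> \<eta> \<Longrightarrow> frR r \<one> \<in> \<theta>"
    and r: "r \<in> ideal_power R \<eta> n"
  shows "frR r \<one> \<in> ideal_power RS \<theta> n"
  using r
proof (induction n arbitrary: r)
  case 0
  then show ?case by (simp add: ideal_power_def)
next
  case (Suc n)
  have unfold_Suc: "ideal_power R \<eta> (Suc n) = ideal_prod R \<eta> (ideal_power R \<eta> n)"
    by (simp add: ideal_power_def)
  have Jc: "j \<in> carrier R" if "j \<in> ideal_power R \<eta> n" for j
    using ideal.Icarr[OF ideal_power_ideal[OF \<eta>] that] .
  have "r \<in> carrier R \<and> frR r \<one> \<in> ideal_prod RS \<theta> (ideal_power RS \<theta> n)"
    using Suc.prems unfolding unfold_Suc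
  proof (induction r rule: ideal_prod.induct)
    case (prod i j)
    have ic: "i \<in> carrier R" and jc: "j \<in> carrier R"
      using prod ideal.Icarr[OF \<eta>] Jc by auto
    have "frR (i \<otimes> j) \<one> = frR i \<one> \<otimes>\<^bsub>RS\<^esub> frR j \<one>"
      using ic jc by (simp add: loc_ring_mult)
    then show ?case
      using prod ic jc incl Suc.IH by (auto intro: ideal_prod.prod)
  next
    case (sum s1 s2)
    then have "frR (s1 \<oplus> s2) \<one> = frR s1 \<one> \<oplus>\<^bsub>RS\<^esub> frR s2 \<one>"
      by (simp add: loc_ring_add)
    then show ?case
      using sum by (auto intro: ideal_prod.sum)
  qed
  then show ?case
    by (simp add: ideal_power_def)
qed

end

context q_linear
begin

text \<open>
  As \<open>f\<close> is \<open>M\<close>-regular, the annihilator of \<open>m/f\<^sup>i\<close> contracts to the annihilator of \<open>m\<close>; so the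
  associated primes of \<open>M\<^sub>f\<close> come from those of \<open>M\<close>, and likewise for \<open>H\<^sup>0\<close>, which transfers the local
  condition. Closure of \<open>N\<close> under \<open>\<kappa>\<^sup>i f\<^sup>k\<close> gives closure of \<open>N\<^sub>f\<close> under \<open>\<kappa>\<^sup>i\<close> itself, as \<open>f\<close> becomes a unit;
  hence the exponent \<open>0\<close>.
\<close>

lemma test_candidate_localization:
  assumes reg: "module_regular R M f" and cand: "test_candidate R q M \<kappa> f t N"
  defines "S \<equiv> powers R f"
  shows "test_candidate (loc_ring R S) q (loc_module R S M) (loc_cartier R S q M \<kappa>)
    \<one>\<^bsub>loc_ring R S\<^esub> 0 (loc_set R S M N)"
proof -
  have f: "f \<in> carrier R"
    using reg unfolding module_regular_def by blast
  interpret loc: q_linear_localization R M q \<kappa> S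
    unfolding S_def by (rule powers_localization[OF f])
  interpret MS: q_linear loc.RS loc.MS q loc.\<kappa>S
    by (rule loc.loc_q_linear)
  have N: "C_submodule R M (cartier_act R M \<kappa> f (tau_exponent q t)) N"
    and N_loc: "\<And>\<eta>. \<eta> \<in> assoc_primes R M \<Longrightarrow> \<exists>a. \<forall>x\<in>local_cohomology0 R M \<eta> (carrier M).
      \<exists>u\<in>carrier R - \<eta>. u \<odot>\<^bsub>M\<^esub> (\<kappa> ^^ a) x \<in> N"
    using cand unfolding test_candidate_iff[OF reg] by blast+
  have Ns: "submodule N R M"
    by (rule C_submodule_submodule[OF N])
  note NM = submoduleE(1)[OF Ns]
  have regular: "m = \<zero>\<^bsub>M\<^esub>" if "m \<in> carrier M" "s \<in> S" "loc.fr m s = \<zero>\<^bsub>loc.MS\<^esub>" for m s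
    using loc.frac_eq_zeroD[OF that] regular_power[OF reg that(1)] unfolding S_def powers_def by blast
  have "module_regular loc.RS loc.MS \<one>\<^bsub>loc.RS\<^esub>"
    unfolding module_regular_def by simp
  then show ?thesis
  proof (subst MS.test_candidate_iff, assumption, intro conjI ballI)
    show "C_submodule loc.RS loc.MS (cartier_act loc.RS loc.MS loc.\<kappa>S \<one>\<^bsub>loc.RS\<^esub> (tau_exponent q 0)) (loc_set R S M N)"
      unfolding C_submodule_def
    proof (intro conjI allI ballI)
      show "submodule (loc_set R S M N) loc.RS loc.MS"
        by (rule loc.loc_set_submodule[OF Ns])
      fix i A X assume A: "A \<in> carrier loc.RS" and X: "X \<in> loc_set R S M N"
      obtain a s where a: "a \<in> carrier R" "s \<in> S" "A = loc.frR a s"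
        using A by (elim loc.loc_ring_cases) blast
      obtain x s' where x: "x \<in> N" "s' \<in> S" "X = loc.fr x s'"
        using X unfolding loc_set_def by blast
      have xM: "x \<in> carrier M"
        using x NM by blast
      define c where "c = (s \<otimes> s') [^] (q ^ i - 1) \<otimes> a"
      have c: "c \<in> carrier R"
        unfolding c_def using a x by simp
      have one: "\<one>\<^bsub>loc.RS\<^esub> = loc_elem R S \<one>"
        unfolding loc_elem_def loc.loc_ring_one ..
      have eq: "cartier_act loc.RS loc.MS loc.\<kappa>S \<one>\<^bsub>loc.RS\<^esub> (tau_exponent q 0) i A X
        = loc.fr ((\<kappa> ^^ i) (c \<odot>\<^bsub>M\<^esub> x)) (s \<otimes> s')"
        unfolding one a(3) x(3) c_def
        using a x xM by (simp add: loc.loc_act_frac) (simp add: cartier_act_def)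
      define k where "k = tau_exponent q t i"
      have k: "k \<le> k * q ^ i"
        using q_pos by simp
      have "(f [^] k) \<odot>\<^bsub>M\<^esub> (\<kappa> ^^ i) (c \<odot>\<^bsub>M\<^esub> x) = (\<kappa> ^^ i) ((f [^] (k * q ^ i) \<otimes> c) \<odot>\<^bsub>M\<^esub> x)"
        using f c xM by (simp add: iter_smult[symmetric] R.nat_pow_pow smult_assoc1)
      also have "\<dots> = cartier_act R M \<kappa> f (tau_exponent q t) i (f [^] (k * q ^ i - k) \<otimes> c) x"
        using act_of_larger_exponent[OF f c xM, of "tau_exponent q t" i "k * q ^ i"] k unfolding k_def by simp
      also have "\<dots> \<in> N"
        using C_submodule_act[OF N _ x(1)] f c by simp
      finally have "\<exists>u\<in>S. u \<odot>\<^bsub>M\<^esub> (\<kappa> ^^ i) (c \<odot>\<^bsub>M\<^esub> x) \<in> N"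
        unfolding S_def powers_def by blast
      then show "cartier_act loc.RS loc.MS loc.\<kappa>S \<one>\<^bsub>loc.RS\<^esub> (tau_exponent q 0) i A X \<in> loc_set R S M N"
        unfolding eq using loc.loc_set_iff[OF Ns] a x xM c by simp
    qed
  next
    fix \<theta> assume "\<theta> \<in> assoc_primes loc.RS loc.MS"
    then obtain Y where \<theta>p: "primeideal \<theta> loc.RS" and Y: "Y \<in> carrier loc.MS" "\<theta> = annihilator loc.RS loc.MS Y"
      unfolding assoc_primes_def by blast
    interpret \<theta>: primeideal \<theta> loc.RS by (rule \<theta>p)
    obtain m s where m: "m \<in> carrier M" "s \<in> S" "Y = loc.fr m s"
      using Y(1) by (elim loc.loc_cases) blast
    define \<eta> where "\<eta> = annihilator R M m"
    have \<eta>_iff: "r \<in> \<eta> \<longleftrightarrow> loc.frR r \<one> \<in> \<theta>" if r: "r \<in> carrier R" for r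
    proof -
      have "loc.frR r \<one> \<odot>\<^bsub>loc.MS\<^esub> loc.fr m s = loc.fr (r \<odot>\<^bsub>M\<^esub> m) s"
        using r m by (simp add: loc.loc_smult)
      moreover have "loc.fr (r \<odot>\<^bsub>M\<^esub> m) s = \<zero>\<^bsub>loc.MS\<^esub> \<longleftrightarrow> r \<odot>\<^bsub>M\<^esub> m = \<zero>\<^bsub>M\<^esub>"
      proof
        assume "loc.fr (r \<odot>\<^bsub>M\<^esub> m) s = \<zero>\<^bsub>loc.MS\<^esub>"
        then show "r \<odot>\<^bsub>M\<^esub> m = \<zero>\<^bsub>M\<^esub>"
          by (rule regular[OF smult_closed[OF r m(1)] m(2)])
      qed (simp add: loc.frac_zero m)
      ultimately show ?thesis
        unfolding \<eta>_def Y(2) m(3) annihilator_def using r by simp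
    qed
    have \<eta>i: "ideal \<eta> R"
    proof (rule idealI)
      show "subgroup \<eta> (add_monoid R)"
        unfolding \<eta>_def annihilator_def using m(1)
        by (intro R.add.subgroupI) (auto simp: smult_l_distr smult_l_minus intro!: exI[of _ \<zero>])
      show "r \<otimes> a \<in> \<eta>" "a \<otimes> r \<in> \<eta>" if "a \<in> \<eta>" "r \<in> carrier R" for a r
        using that m(1) smult_comm[of a r m] unfolding \<eta>_def annihilator_def by (auto simp: smult_assoc1)
    qed (rule R.ring_axioms)
    have "primeideal \<eta> R"
    proof (rule primeidealI[OF \<eta>i R.is_cring])
      show "carrier R \<noteq> \<eta>"
      proof
        assume "carrier R = \<eta>"
        then have "\<one> \<in> \<eta>"
          using R.one_closed by blast
        then have "\<one>\<^bsub>loc.RS\<^esub> \<in> \<theta>"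
          using \<eta>_iff[OF R.one_closed] unfolding loc.loc_ring_one by blast
        then show False
          using \<theta>.one_imp_carrier \<theta>.I_notcarr by blast
      qed
      show "a \<in> \<eta> \<or> b \<in> \<eta>" if ab: "a \<in> carrier R" "b \<in> carrier R" "a \<otimes> b \<in> \<eta>" for a b
      proof -
        have "loc.frR a \<one> \<otimes>\<^bsub>loc.RS\<^esub> loc.frR b \<one> = loc.frR (a \<otimes> b) \<one>"
          using ab by (simp add: loc.loc_ring_mult)
        then have "loc.frR a \<one> \<otimes>\<^bsub>loc.RS\<^esub> loc.frR b \<one> \<in> \<theta>"
          using \<eta>_iff[of "a \<otimes> b"] ab by simp
        then show ?thesis
          using \<theta>.I_prime[of "loc.frR a \<one>" "loc.frR b \<one>"] \<eta>_iff ab by simp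
      qed
    qed
    then have "\<eta> \<in> assoc_primes R M"
      unfolding assoc_primes_def \<eta>_def using m(1) by blast
    then obtain a where a: "\<And>x. x \<in> local_cohomology0 R M \<eta> (carrier M) \<Longrightarrow>
        \<exists>u\<in>carrier R - \<eta>. u \<odot>\<^bsub>M\<^esub> (\<kappa> ^^ a) x \<in> N"
      using N_loc by blast
    show "\<exists>a. \<forall>X\<in>local_cohomology0 loc.RS loc.MS \<theta> (carrier loc.MS).
      \<exists>U\<in>carrier loc.RS - \<theta>. U \<odot>\<^bsub>loc.MS\<^esub> (loc.\<kappa>S ^^ a) X \<in> loc_set R S M N"
    proof (intro exI[of _ a] ballI)
      fix X assume "X \<in> local_cohomology0 loc.RS loc.MS \<theta> (carrier loc.MS)"
      then obtain n where X: "X \<in> carrier loc.MS"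
        and n: "\<And>r. r \<in> ideal_power loc.RS \<theta> n \<Longrightarrow> r \<odot>\<^bsub>loc.MS\<^esub> X = \<zero>\<^bsub>loc.MS\<^esub>"
        unfolding local_cohomology0_def by blast
      obtain x s where x: "x \<in> carrier M" "s \<in> S" "X = loc.fr x s"
        using X by (elim loc.loc_cases) blast
      have "r \<odot>\<^bsub>M\<^esub> x = \<zero>\<^bsub>M\<^esub>" if r: "r \<in> ideal_power R \<eta> n" for r
      proof -
        have rc: "r \<in> carrier R"
          by (rule ideal.Icarr[OF ideal_power_ideal[OF \<eta>i] r])
        have "loc.frR r \<one> \<in> ideal_power loc.RS \<theta> n"
          using loc.ideal_power_localization[OF \<eta>i _ r, of \<theta>] \<eta>_iff ideal.Icarr[OF \<eta>i] by blast
        then have "loc.frR r \<one> \<odot>\<^bsub>loc.MS\<^esub> X = \<zero>\<^bsub>loc.MS\<^esub>"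
          by (rule n)
        then show ?thesis
          using regular[of "r \<odot>\<^bsub>M\<^esub> x" s] rc x by (simp add: loc.loc_smult)
      qed
      then have xH: "x \<in> local_cohomology0 R M \<eta> (carrier M)"
        unfolding local_cohomology0_def using x(1) by blast
      define y where "y = (s [^] (q ^ a - 1)) \<odot>\<^bsub>M\<^esub> x"
      have y: "y \<in> local_cohomology0 R M \<eta> (carrier M)"
        unfolding y_def using xH x(2)
        by (intro submoduleE(4)[OF local_cohomology0_submodule[OF \<eta>i carrier_is_submodule]]) auto
      have yM: "y \<in> carrier M"
        using y unfolding local_cohomology0_def by blast
      obtain u where u: "u \<in> carrier R" "u \<notin> \<eta>" "u \<odot>\<^bsub>M\<^esub> (\<kappa> ^^ a) y \<in> N"
        using a[OF y] by blast
      have "loc.frR u \<one> \<odot>\<^bsub>loc.MS\<^esub> (loc.\<kappa>S ^^ a) X = loc.fr (u \<odot>\<^bsub>M\<^esub> (\<kappa> ^^ a) y) s"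
        unfolding x(3) using x u yM by (simp add: loc.loc_cartier_iter loc.loc_smult y_def)
      then have "loc.frR u \<one> \<odot>\<^bsub>loc.MS\<^esub> (loc.\<kappa>S ^^ a) X \<in> loc_set R S M N"
        unfolding loc_set_def using u(3) x(2) by blast
      moreover have "loc.frR u \<one> \<in> carrier loc.RS - \<theta>"
        using u \<eta>_iff[of u] by simp
      ultimately show "\<exists>U\<in>carrier loc.RS - \<theta>. U \<odot>\<^bsub>loc.MS\<^esub> (loc.\<kappa>S ^^ a) X \<in> loc_set R S M N"
        by blast
    qed
  qed
qed

text \<open>
  \<open>N\<^sub>f\<close> is a candidate for the F-regular module \<open>M\<^sub>f\<close>, hence all of it; thus a power of \<open>f\<close> maps \<open>M\<close>
  into \<open>N\<close>.
\<close>

theorem sigma_subset_test_candidate: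
  fixes lam t :: rat
  assumes noeth: "noetherian_ring R" and fg: "fin_gen_module R M" and q: "2 \<le> q"
    and reg: "module_regular R M f"
    and F_reg: "F_regular (loc_ring R (powers R f)) q (loc_module R (powers R f) M) (loc_cartier R (powers R f) q M \<kappa>)"
    and t: "0 \<le> t" "t < lam" and cand: "test_candidate R q M \<kappa> f t N"
  shows "sigma R q M \<kappa> f lam \<subseteq> N"
proof -
  have f: "f \<in> carrier R"
    using reg unfolding module_regular_def by blast
  interpret loc: q_linear_localization R M q \<kappa> "powers R f"
    by (rule powers_localization[OF f])
  have N: "C_submodule R M (cartier_act R M \<kappa> f (tau_exponent q t)) N"
    using cand unfolding test_candidate_iff[OF reg] by blast
  have Ns: "submodule N R M"
    by (rule C_submodule_submodule[OF N])
  have "carrier loc.MS \<subseteq> loc_set R (powers R f) M N"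
    using F_reg test_candidate_localization[OF reg cand] unfolding F_regular_def test_module_def by blast
  then have "\<exists>u\<in>powers R f. u \<odot>\<^bsub>M\<^esub> m \<in> N" if "m \<in> carrier M" for m
    using loc.loc_set_iff[OF Ns that, of \<one>] that by blast
  then have "\<exists>u\<in>powers R f. \<forall>m\<in>carrier M. u \<odot>\<^bsub>M\<^esub> m \<in> N"
    by (intro uniform_denominator[OF noeth fg carrier_is_submodule Ns loc.S_subset]) auto
  then obtain b :: nat where "\<And>m. m \<in> carrier M \<Longrightarrow> (f [^] b) \<odot>\<^bsub>M\<^esub> m \<in> N"
    unfolding powers_def by blast
  then show ?thesis
    by (rule sigma_subset_of_power_multiple[OF q f t N])
qed

end

section \<open>Comparison of non-F-pure modules and test modules\<close>

lemma cartier_module_q_linear: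
  assumes "cartier_module R p M \<kappa>" "0 < p"
  shows "q_linear R M p \<kappa>"
  using assms unfolding cartier_module_def lin_maps_def frob_push_def
  by (intro q_linear.intro q_linear_axioms.intro) auto

theorem proposition4p9:
  fixes k :: "('k, 'y) ring_scheme" and R :: "('a, 'x) ring_scheme"
    and M :: "('a, 'm, 'z) module_scheme" and \<kappa> :: "'m \<Rightarrow> 'm"
    and p :: nat and f :: 'a and lam :: rat
  assumes "field k" and "prime_char p k" and "F_finite p k"
    and "cring R" and "noetherian_ring R" and "prime_char p R"
    and "ess_finite_type k R"
    and "cartier_module R p M \<kappa>"
    and "module_regular R M f"
    and "lam > 0"
  shows
    "(\<not> int p dvd snd (quotient_of lam) \<longrightarrow>
       (\<exists>\<epsilon>\<^sub>0. 0 < \<epsilon>\<^sub>0 \<and> \<epsilon>\<^sub>0 \<le> lam \<and>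
         (\<forall>\<epsilon>. 0 < \<epsilon> \<and> \<epsilon> < \<epsilon>\<^sub>0 \<longrightarrow>
           test_module R p M \<kappa> f (lam - \<epsilon>) \<subseteq> sigma R p M \<kappa> f lam)))
     \<and>
     (F_regular (loc_ring R (powers R f)) p (loc_module R (powers R f) M)
        (loc_cartier R (powers R f) p M \<kappa>) \<longrightarrow>
       (\<exists>\<epsilon>\<^sub>0. 0 < \<epsilon>\<^sub>0 \<and> \<epsilon>\<^sub>0 \<le> lam \<and>
         (\<forall>\<epsilon>. 0 < \<epsilon> \<and> \<epsilon> < \<epsilon>\<^sub>0 \<longrightarrow>
           sigma R p M \<kappa> f lam \<subseteq> test_module R p M \<kappa> f (lam - \<epsilon>))))"
proof -
  have p: "prime p"
    using assms(6) unfolding prime_char_def by blast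
  then have p2: "2 \<le> p"
    by (rule prime_ge_2_nat)
  interpret q_linear R M p \<kappa>
    using p2 by (intro cartier_module_q_linear assms(8)) simp
  have fg: "fin_gen_module R M"
    using assms(8) unfolding cartier_module_def by blast
  show ?thesis
  proof (intro conjI impI)
    assume "\<not> int p dvd snd (quotient_of lam)"
    then obtain e a where "0 < e" "of_nat a = lam * (of_nat (p ^ e) - 1)"
      using exponent_clearing_denominator[OF p _ assms(10)] by blast
    then show "\<exists>\<epsilon>\<^sub>0. 0 < \<epsilon>\<^sub>0 \<and> \<epsilon>\<^sub>0 \<le> lam \<and> (\<forall>\<epsilon>. 0 < \<epsilon> \<and> \<epsilon> < \<epsilon>\<^sub>0 \<longrightarrow>
        test_module R p M \<kappa> f (lam - \<epsilon>) \<subseteq> sigma R p M \<kappa> f lam)"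
      using test_module_subset_sigma[OF assms(5) fg p2 assms(9) _ _ assms(10)] by metis
  next
    assume F_reg: "F_regular (loc_ring R (powers R f)) p (loc_module R (powers R f) M)
        (loc_cartier R (powers R f) p M \<kappa>)"
    have "sigma R p M \<kappa> f lam \<subseteq> test_module R p M \<kappa> f (lam - \<epsilon>)" if "0 < \<epsilon>" "\<epsilon> < lam" for \<epsilon>
      unfolding test_module_def
      using sigma_subset_test_candidate[OF assms(5) fg p2 assms(9) F_reg, of "lam - \<epsilon>" lam] that by auto
    then show "\<exists>\<epsilon>\<^sub>0. 0 < \<epsilon>\<^sub>0 \<and> \<epsilon>\<^sub>0 \<le> lam \<and> (\<forall>\<epsilon>. 0 < \<epsilon> \<and> \<epsilon> < \<epsilon>\<^sub>0 \<longrightarrow>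
        sigma R p M \<kappa> f lam \<subseteq> test_module R p M \<kappa> f (lam - \<epsilon>))"
      using assms(10) by (intro exI[of _ lam]) auto
  qed
qed

end
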